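(* Let $n\ge 2k$, $\mathfrak g=\mathfrak{gl}_n(\mathbb{C})$ acting on $\mathfrak{sl}_n^{\otimes k}$ via the adjoint action on each factor, let $0\le r\le k$ and let $\lambda,\mu$ be partitions of $r$. Then the multiplicity $m^k_{\lambda,\mu}$ of the irreducible $\mathfrak g$-module $L(\lambda,\mu)$ as a direct summand of $\mathfrak{sl}_n^{\otimes k}$ is $$m^k_{\lambda,\mu}=f^\lambda f^\mu\Bigg(\sum_{j=0}^{k-r}(-1)^j\binom{k}{j}\binom{k-j}{r}^2(k-r-j)!\Bigg).$$
   Context: $f^\lambda$ denotes the number of standard Young tableaux of shape $\lambda$ (fillings of the Young diagram of $\lambda$ with $1,\dots,r$, increasing along rows and down columns). For partitions $\lambda=(\lambda_1\ge\dots\ge\lambda_a>0)$, $\mu=(\mu_1\ge\dots\ge\mu_b>0)$ with $a+b\le n$, $L(\lambda,\mu)$ is the irreducible $\mathfrak{gl}_n$-module with highest weight $\sum_{i=1}^a\lambda_i\epsilon_i-\sum_{i=1}^b\mu_i\epsilon_{n+1-i}$, where $\epsilon_i$ picks out the $(i,i)$ entry of a diagonal matrix. ($\mathfrak{gl}_n=\mathfrak{sl}_n\oplus\mathbb{C}I$ and $I$ acts trivially, so this is the same as the decomposition as an $\mathfrak{sl}_n$-module.) *)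

theory Defs
  imports Complex_Main
begin

text \<open>Vectors of gl_n^{tensor k} are coefficient functions on index words
  t = [(i1,j1),...,(ik,jk)] (basis E_{i1 j1} tensor ... tensor E_{ik jk});
  coefficients vanish outside valid index words.\<close>

type_synonym tvec = "(nat \<times> nat) list \<Rightarrow> complex"

definition valid_idx :: "nat \<Rightarrow> nat \<Rightarrow> (nat \<times> nat) list \<Rightarrow> bool" where
  "valid_idx n k t \<longleftrightarrow> length t = k \<and> (\<forall>p<k. fst (t!p) < n \<and> snd (t!p) < n)"

text \<open>sl_n^{tensor k}: intersection of the kernels of the trace applied in each factor.\<close>
definition sl_tensor :: "nat \<Rightarrow> nat \<Rightarrow> tvec set" where
  "sl_tensor n k = {f. (\<forall>t. \<not> valid_idx n k t \<longrightarrow> f t = 0) \<and>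
      (\<forall>t p. valid_idx n k t \<and> p < k \<longrightarrow> (\<Sum>a<n. f (t[p := (a,a)])) = 0)}"

text \<open>Action of X in gl_n (entries X i j, i,j<n) by the adjoint action on every factor:
  [X, E_ij] = sum_a X_ai E_aj - sum_b X_jb E_ib.\<close>
definition gl_act :: "nat \<Rightarrow> nat \<Rightarrow> (nat \<Rightarrow> nat \<Rightarrow> complex) \<Rightarrow> tvec \<Rightarrow> tvec" where
  "gl_act n k X f = (\<lambda>s. if valid_idx n k s then
      (\<Sum>p<k. (\<Sum>i<n. X (fst (s!p)) i * f (s[p := (i, snd (s!p))]))
             - (\<Sum>j<n. X j (snd (s!p)) * f (s[p := (fst (s!p), j)])))
    else 0)"

definition is_csubspace :: "tvec set \<Rightarrow> bool" where
  "is_csubspace W \<longleftrightarrow> (\<lambda>_. 0) \<in> W \<and> (\<forall>x\<in>W. \<forall>y\<in>W. (\<lambda>s. x s + y s) \<in> W)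
     \<and> (\<forall>c::complex. \<forall>x\<in>W. (\<lambda>s. c * x s) \<in> W)"

definition gl_submodule :: "nat \<Rightarrow> nat \<Rightarrow> tvec set \<Rightarrow> bool" where
  "gl_submodule n k W \<longleftrightarrow> W \<subseteq> sl_tensor n k \<and> is_csubspace W \<and>
     (\<forall>X. \<forall>v\<in>W. gl_act n k X v \<in> W)"

definition irreducible_submodule :: "nat \<Rightarrow> nat \<Rightarrow> tvec set \<Rightarrow> bool" where
  "irreducible_submodule n k W \<longleftrightarrow> gl_submodule n k W \<and> W \<noteq> {\<lambda>_. 0} \<and>
     (\<forall>U. gl_submodule n k U \<and> U \<subseteq> W \<longrightarrow> U = {\<lambda>_. 0} \<or> U = W)"

definition elem_mat :: "nat \<Rightarrow> nat \<Rightarrow> nat \<Rightarrow> nat \<Rightarrow> complex" where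
  "elem_mat a b = (\<lambda>i j. if i = a \<and> j = b then 1 else 0)"

text \<open>W (irreducible) has highest weight w (w a = coefficient of epsilon_{a+1}),
  w.r.t. the upper triangular Borel subalgebra.\<close>
definition has_highest_weight :: "nat \<Rightarrow> nat \<Rightarrow> tvec set \<Rightarrow> (nat \<Rightarrow> int) \<Rightarrow> bool" where
  "has_highest_weight n k W w \<longleftrightarrow> (\<exists>v\<in>W. v \<noteq> (\<lambda>_. 0) \<and>
     (\<forall>a b. a < b \<and> b < n \<longrightarrow> gl_act n k (elem_mat a b) v = (\<lambda>_. 0)) \<and>
     (\<forall>a<n. gl_act n k (elem_mat a a) v = (\<lambda>s. of_int (w a) * v s)))"

definition is_irred_decomposition :: "nat \<Rightarrow> nat \<Rightarrow> nat \<Rightarrow> (nat \<Rightarrow> tvec set) \<Rightarrow> bool" where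
  "is_irred_decomposition n k m W \<longleftrightarrow> (\<forall>i<m. irreducible_submodule n k (W i)) \<and>
     (\<forall>v\<in>sl_tensor n k. \<exists>!u. (\<forall>i<m. u i \<in> W i) \<and> (\<forall>i\<ge>m. u i = (\<lambda>_. 0)) \<and>
                                 v = (\<lambda>s. \<Sum>i<m. u i s))"

definition is_partition :: "nat \<Rightarrow> nat list \<Rightarrow> bool" where
  "is_partition r la \<longleftrightarrow> sorted_wrt (\<ge>) la \<and> (\<forall>x\<in>set la. 0 < x) \<and> sum_list la = r"

text \<open>Highest weight sum_i la_i eps_i - sum_i mu_i eps_{n+1-i}, 0-indexed.\<close>
definition lm_weight :: "nat \<Rightarrow> nat list \<Rightarrow> nat list \<Rightarrow> nat \<Rightarrow> int" where
  "lm_weight n la mu a = (if a < length la then int (la ! a)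
      else if n - length mu \<le> a \<and> a < n then - int (mu ! (n - 1 - a)) else 0)"

definition young_diagram :: "nat list \<Rightarrow> (nat \<times> nat) set" where
  "young_diagram la = {(i,j). i < length la \<and> j < la ! i}"

definition num_syt :: "nat list \<Rightarrow> nat" where
  "num_syt la = card {T :: nat \<times> nat \<Rightarrow> nat.
      (\<forall>x. x \<notin> young_diagram la \<longrightarrow> T x = 0) \<and>
      bij_betw T (young_diagram la) {1..sum_list la} \<and>
      (\<forall>i j. (i, Suc j) \<in> young_diagram la \<longrightarrow> T (i,j) < T (i, Suc j)) \<and>
      (\<forall>i j. (Suc i, j) \<in> young_diagram la \<longrightarrow> T (i,j) < T (Suc i, j))}"

end

(*
  In a completely reducible module the multiplicity of L(lambda, mu) is the dimension of the space of
  highest weight vectors of that weight.  For gl_n^{tensor k} this dimension is at most the number of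
  paths of dominant weights that alternately remove and add a unit vector (a highest weight vector is
  determined by its coefficients on such paths), which is at most
    N(lambda, mu) = f^lambda f^mu (k choose r)^2 (k - r)!.
  Since sum f^2 = r! over the partitions of r, the sum of N^2 over all pairs is (2k)!.  On the other hand
  the endomorphism algebra acts faithfully on the highest weight spaces and, for n >= 2k, contains (2k)!
  linearly independent contractions, so all the upper bounds are attained.  Splitting off the trace one
  tensor factor at a time turns this into the alternating sum for sl_n^{tensor k}.
*)
theory Submission
  imports Defs "HOL-Combinatorics.Permutations" "HOL-Library.Function_Algebras"
begin

section \<open>Partitions and standard Young tableaux\<close>

text \<open>No multiplicity in the full tensor power is computed directly. Writing d for the
  dimension of a highest weight space, the argument gives d \<le> N weight by weight and (2k)! \<le>
  sum of d N \<le> sum of N^2 = (2k)!, which leaves no room for d < N where N is positive. The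
  origin of N: keep r of the k vector factors and r of the k dual factors, pair off the remaining
  ones in (k - r)! ways, and grow the two shapes box by box. Complete reducibility and the faithful
  action both rest on the standard Hermitian form on coefficients, for which a matrix and its
  conjugate transpose act as adjoint operators. Complements of submodules are then submodules, and
  every nonzero submodule contains a highest weight vector. The condition n >= 2k enters in two
  places: 2k distinct index values are needed to tell the contractions apart, and the rows of
  \<lambda> and \<mu> must fit into n weight coordinates without meeting.\<close>

definition parts :: "nat \<Rightarrow> (nat \<Rightarrow> nat) set" where
  "parts d = {l. (\<forall>i. l (Suc i) \<le> l i) \<and> (\<exists>M. (\<forall>i\<ge>M. l i = 0) \<and> sum l {..<M} = d)}"

definition removable :: "(nat \<Rightarrow> nat) \<Rightarrow> nat set" where
  "removable l = {i. l (Suc i) < l i}"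

definition addable :: "(nat \<Rightarrow> nat) \<Rightarrow> nat set" where
  "addable l = {i. i = 0 \<or> l i < l (i - 1)}"

text \<open>With partitions padded by zeros, opening a new row is an update at an index of value 0,
  so nothing has to grow or shrink.\<close>

definition add_box :: "(nat \<Rightarrow> nat) \<Rightarrow> nat \<Rightarrow> nat \<Rightarrow> nat" where
  "add_box l i = l(i := Suc (l i))"

definition del_box :: "(nat \<Rightarrow> nat) \<Rightarrow> nat \<Rightarrow> nat \<Rightarrow> nat" where
  "del_box l i = l(i := l i - 1)"

lemma parts_Suc_le: "l \<in> parts d \<Longrightarrow> l (Suc i) \<le> l i"
  by (auto simp: parts_def)

lemma parts_antimono: "l \<in> parts d \<Longrightarrow> i \<le> j \<Longrightarrow> l j \<le> l i"
  using lift_Suc_antimono_le[of l i j] by (auto simp: parts_def)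

lemma sum_zero_extend:
  fixes l :: "nat \<Rightarrow> nat"
  assumes "\<forall>i\<ge>M. l i = 0" and "M \<le> N"
  shows "sum l {..<N} = sum l {..<M}"
  by (rule sum.mono_neutral_right) (use assms in auto)

lemma parts_sum:
  assumes "l \<in> parts d" and "\<forall>i\<ge>M. l i = 0"
  shows "sum l {..<M} = d"
proof -
  obtain N where N: "\<forall>i\<ge>N. l i = 0" "sum l {..<N} = d"
    using assms(1) by (auto simp: parts_def)
  have "sum l {..<M} = sum l {..<max M N}"
    by (rule sum_zero_extend[symmetric]) (use assms in auto)
  also have "\<dots> = sum l {..<N}"
    by (rule sum_zero_extend) (use N in auto)
  finally show ?thesis using N by simp
qed

lemma partsI:
  assumes "\<And>i. l (Suc i) \<le> l i" "\<forall>i\<ge>M. l i = 0" "sum l {..<M} = d"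
  shows "l \<in> parts d"
  using assms by (auto simp: parts_def)

lemma parts_bound:
  assumes "l \<in> parts d"
  obtains M where "\<forall>i\<ge>M. l i = 0" "sum l {..<M} = d"
  using assms by (auto simp: parts_def)

lemma sum_fun_upd_lessThan:
  fixes l :: "nat \<Rightarrow> nat"
  assumes "i < M"
  shows "sum (l(i := x)) {..<M} + l i = sum l {..<M} + x"
proof -
  have "sum (l(i := x)) {..<M} = x + sum l ({..<M} - {i})"
    using assms by (subst sum.remove[of _ i]) (auto intro!: sum.cong)
  moreover have "sum l {..<M} = l i + sum l ({..<M} - {i})"
    using assms by (subst sum.remove[of _ i]) auto
  ultimately show ?thesis by simp
qed

text \<open>Together with \<open>addable_add_box\<close> this makes removing and adding mutually
  inverse between pairs (larger shape, removable row) and pairs (smaller shape, addable row); the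
  double counts below reindex along it.\<close>

lemma removable_del_box:
  assumes "l \<in> parts (Suc d)" "i \<in> removable l"
  shows "del_box l i \<in> parts d" "i \<in> addable (del_box l i)" "add_box (del_box l i) i = l"
proof -
  obtain M where M: "\<forall>i\<ge>M. l i = 0" "sum l {..<M} = Suc d"
    using parts_bound[OF assms(1)] .
  have "i < M" using assms(2) M(1) by (cases "i < M") (auto simp: removable_def)
  moreover have "l i > 0" using assms(2) by (auto simp: removable_def)
  ultimately have s: "sum (del_box l i) {..<M} = d"
    using sum_fun_upd_lessThan[of i M l "l i - 1"] M by (auto simp: del_box_def)
  show "del_box l i \<in> parts d"
  proof (rule partsI)
    show "del_box l i (Suc j) \<le> del_box l i j" for j
      using assms(2) parts_Suc_le[OF assms(1), of j] by (auto simp: del_box_def removable_def)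
    show "\<forall>j\<ge>M. del_box l i j = 0" using M by (auto simp: del_box_def)
  qed (rule s)
  show "i \<in> addable (del_box l i)"
    using \<open>l i > 0\<close> parts_Suc_le[OF assms(1), of "i - 1"] by (cases i) (auto simp: del_box_def addable_def)
  show "add_box (del_box l i) i = l"
    using \<open>l i > 0\<close> by (auto simp: del_box_def add_box_def)
qed

lemma addable_add_box:
  assumes "l \<in> parts d" "i \<in> addable l"
  shows "add_box l i \<in> parts (Suc d)" "i \<in> removable (add_box l i)" "del_box (add_box l i) i = l"
proof -
  obtain M where M: "\<forall>i\<ge>M. l i = 0" "sum l {..<M} = d"
    using parts_bound[OF assms(1)] .
  define N where "N = max M (Suc i)"
  have "\<forall>i\<ge>N. l i = 0" using M by (auto simp: N_def)
  then have N: "sum l {..<N} = d" using parts_sum assms(1) by blast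
  then have s: "sum (add_box l i) {..<N} = Suc d"
    using sum_fun_upd_lessThan[of i N l "Suc (l i)"] by (auto simp: add_box_def N_def)
  show "add_box l i \<in> parts (Suc d)"
  proof (rule partsI)
    show "add_box l i (Suc j) \<le> add_box l i j" for j
      using assms(2) parts_Suc_le[OF assms(1), of j] by (auto simp: add_box_def addable_def)
    show "\<forall>j\<ge>N. add_box l i j = 0" using M by (auto simp: add_box_def N_def)
  qed (rule s)
  show "i \<in> removable (add_box l i)"
    using parts_Suc_le[OF assms(1), of i] by (auto simp: add_box_def removable_def)
  show "del_box (add_box l i) i = l"
    by (auto simp: del_box_def add_box_def)
qed

lemma finite_removable: "l \<in> parts d \<Longrightarrow> finite (removable l)"
proof -
  assume "l \<in> parts d"
  then obtain M where "\<forall>i\<ge>M. l i = 0" using parts_bound by blast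
  then have "i < M" if "i \<in> removable l" for i
    using that by (cases "i < M") (auto simp: removable_def)
  then have "removable l \<subseteq> {..<M}" by blast
  then show ?thesis using finite_subset by blast
qed

lemma addable_eq: "addable l = insert 0 (Suc ` removable l)"
proof -
  have "i \<in> addable l \<longleftrightarrow> i \<in> insert 0 (Suc ` removable l)" for i
    by (cases i) (auto simp: addable_def removable_def)
  then show ?thesis by blast
qed

lemma finite_addable: "l \<in> parts d \<Longrightarrow> finite (addable l)"
  by (simp add: addable_eq finite_removable)

text \<open>The row below a removable corner is addable, and row 0 always is. This surplus of one is
  the identity term in the commutation of adding and removing boxes.\<close>

lemma card_addable: "l \<in> parts d \<Longrightarrow> card (addable l) = Suc (card (removable l))"
  unfolding addable_eq by (subst card_insert_disjoint) (auto simp: finite_removable card_image)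

lemma parts_0: "parts 0 = {\<lambda>_. 0}"
proof -
  have "l = (\<lambda>_. 0)" if "l \<in> parts 0" for l
  proof
    fix i
    obtain M where "\<forall>i\<ge>M. l i = 0" "sum l {..<M} = 0" using parts_bound[OF \<open>l \<in> parts 0\<close>] .
    then show "l i = 0" by (cases "i < M") auto
  qed
  then show ?thesis by (auto intro!: partsI[of _ 0])
qed

text \<open>Only meaningful for \<open>l \<in> parts d\<close>: the number of standard tableaux of shape \<open>l\<close>.\<close>

primrec npaths :: "nat \<Rightarrow> (nat \<Rightarrow> nat) \<Rightarrow> nat" where
  "npaths 0 l = 1"
| "npaths (Suc d) l = (\<Sum>i\<in>removable l. npaths d (del_box l i))"

section \<open>Commutation of adding and removing boxes in Young's lattice\<close>

lemma exchange_boxes: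
  assumes "l \<in> parts (Suc d)"
  shows "{(i, j). i \<in> addable l \<and> j \<in> removable (add_box l i) \<and> j \<noteq> i} =
         {(i, j). j \<in> removable l \<and> i \<in> addable (del_box l j) \<and> j \<noteq> i}"
proof -
  have m: "l (Suc j) \<le> l j" for j using parts_Suc_le[OF assms] .
  have "i \<in> addable l \<and> j \<in> removable (add_box l i) \<longleftrightarrow>
        j \<in> removable l \<and> i \<in> addable (del_box l j)" if "j \<noteq> i" for i j
    using that m[of j] m[of i] m[of "i - 1"]
    by (cases i) (auto simp: addable_def removable_def add_box_def del_box_def)
  then show ?thesis by blast
qed

text \<open>Expand the left side by the last box. Where it is the box just added, the terms give
  \<open>card (addable l)\<close> copies of the count; the others become, by
  \<open>exchange_boxes\<close>, terms that remove first and add afterwards. By induction these same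
  terms, with only \<open>card (removable l)\<close> copies, make up the product for the smaller
  factor, so exactly one copy is gained.\<close>

lemma sum_npaths_add_box:
  "l \<in> parts d \<Longrightarrow> (\<Sum>i\<in>addable l. npaths (Suc d) (add_box l i)) = Suc d * npaths d l"
proof (induction d arbitrary: l)
  case 0
  then have "l = (\<lambda>_. 0)" by (simp add: parts_0)
  then have "addable l = {0}" "removable (add_box l 0) = {0}"
    by (auto simp: addable_def removable_def add_box_def split: if_splits)
  then show ?case by simp
next
  case (Suc d)
  let ?g = "\<lambda>(i, j). npaths d (del_box (add_box l i) j)"
  let ?P = "{(i, j). i \<in> addable l \<and> j \<in> removable (add_box l i) \<and> j \<noteq> i}"
  have split1: "(\<Sum>j\<in>removable (add_box l i). npaths (Suc d) (del_box (add_box l i) j)) =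
      npaths (Suc d) l + (\<Sum>j\<in>removable (add_box l i) - {i}. npaths (Suc d) (del_box (add_box l i) j))"
    if "i \<in> addable l" for i
    using addable_add_box[OF Suc.prems that]
    by (subst sum.remove[of _ i]) (auto simp: finite_removable simp del: npaths.simps)
  have "(\<Sum>i\<in>addable l. npaths (Suc (Suc d)) (add_box l i)) =
     (\<Sum>i\<in>addable l. \<Sum>j\<in>removable (add_box l i). npaths (Suc d) (del_box (add_box l i) j))"
    by (subst npaths.simps) simp
  also have "\<dots> = (\<Sum>i\<in>addable l. npaths (Suc d) l + (\<Sum>j\<in>removable (add_box l i) - {i}. npaths (Suc d) (del_box (add_box l i) j)))"
    by (rule sum.cong) (use split1 in auto)
  also have "\<dots> = card (addable l) * npaths (Suc d) l +
      (\<Sum>i\<in>addable l. \<Sum>j\<in>removable (add_box l i) - {i}. npaths (Suc d) (del_box (add_box l i) j))"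
    by (simp add: sum.distrib del: npaths.simps)
  also have "(\<Sum>i\<in>addable l. \<Sum>j\<in>removable (add_box l i) - {i}. npaths (Suc d) (del_box (add_box l i) j))
     = (\<Sum>(i, j)\<in>(SIGMA i:addable l. removable (add_box l i) - {i}). npaths (Suc d) (del_box (add_box l i) j))"
    by (rule sum.Sigma)
      (use Suc.prems in \<open>auto simp: finite_addable intro!: finite_removable addable_add_box\<close>)
  also have "(SIGMA i:addable l. removable (add_box l i) - {i}) = ?P" by auto
  also have "(\<Sum>(i, j)\<in>?P. npaths (Suc d) (del_box (add_box l i) j)) =
      (\<Sum>(i, j)\<in>?P. npaths (Suc d) (add_box (del_box l j) i))"
    by (rule sum.cong)
      (auto simp: add_box_def del_box_def fun_upd_twist simp del: npaths.simps)
  also have "?P = {(i, j). j \<in> removable l \<and> i \<in> addable (del_box l j) \<and> j \<noteq> i}"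
    by (rule exchange_boxes[OF Suc.prems])
  also have "(\<Sum>(i, j)\<in>{(i, j). j \<in> removable l \<and> i \<in> addable (del_box l j) \<and> j \<noteq> i}. npaths (Suc d) (add_box (del_box l j) i))
     = (\<Sum>(j, i)\<in>(SIGMA j:removable l. addable (del_box l j) - {j}). npaths (Suc d) (add_box (del_box l j) i))"
    by (rule sum.reindex_bij_witness[of _ "\<lambda>(i, j). (j, i)" "\<lambda>(i, j). (j, i)"]) auto
  also have "\<dots> = (\<Sum>j\<in>removable l. \<Sum>i\<in>addable (del_box l j) - {j}. npaths (Suc d) (add_box (del_box l j) i))"
    by (rule sum.Sigma[symmetric])
      (use finite_addable[OF removable_del_box(1)[OF Suc.prems]] in \<open>auto simp: finite_removable[OF Suc.prems]\<close>)
  finally have A: "(\<Sum>i\<in>addable l. npaths (Suc (Suc d)) (add_box l i)) =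
     card (addable l) * npaths (Suc d) l +
     (\<Sum>j\<in>removable l. \<Sum>i\<in>addable (del_box l j) - {j}. npaths (Suc d) (add_box (del_box l j) i))" .
  have "Suc d * npaths (Suc d) l = (\<Sum>j\<in>removable l. Suc d * npaths d (del_box l j))"
    by (simp add: sum_distrib_left)
  also have "\<dots> = (\<Sum>j\<in>removable l. \<Sum>i\<in>addable (del_box l j). npaths (Suc d) (add_box (del_box l j) i))"
    by (rule sum.cong) (use Suc.IH removable_del_box(1)[OF Suc.prems] in auto)
  also have "\<dots> = (\<Sum>j\<in>removable l. npaths (Suc d) l + (\<Sum>i\<in>addable (del_box l j) - {j}. npaths (Suc d) (add_box (del_box l j) i)))"
  proof (rule sum.cong, simp)
    fix j assume "j \<in> removable l"
    then show "(\<Sum>i\<in>addable (del_box l j). npaths (Suc d) (add_box (del_box l j) i)) =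
        npaths (Suc d) l + (\<Sum>i\<in>addable (del_box l j) - {j}. npaths (Suc d) (add_box (del_box l j) i))"
      using removable_del_box[OF Suc.prems] finite_addable[OF removable_del_box(1)[OF Suc.prems]]
      by (subst sum.remove[of _ j]) (auto simp del: npaths.simps)
  qed
  also have "\<dots> = card (removable l) * npaths (Suc d) l + (\<Sum>j\<in>removable l. \<Sum>i\<in>addable (del_box l j) - {j}. npaths (Suc d) (add_box (del_box l j) i))"
    by (simp add: sum.distrib del: npaths.simps)
  finally show ?case using A card_addable[OF Suc.prems] by (simp del: npaths.simps)
qed

lemma finite_parts: "finite (parts d)"
proof (induction d)
  case (Suc d)
  have "l \<in> (\<Union>m\<in>parts d. add_box m ` addable m)" if l: "l \<in> parts (Suc d)" for l
  proof -
    \<comment> \<open>A partition without a removable row is constant, and being eventually zero it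
      would be zero.\<close>
    have "removable l \<noteq> {}"
    proof
      assume "removable l = {}"
      then have c: "l (Suc i) = l i" for i
        using parts_Suc_le[OF l, of i] by (auto simp: removable_def not_less intro: antisym)
      have z: "l i = l 0" for i by (induction i) (simp_all add: c)
      obtain M where M: "\<forall>i\<ge>M. l i = 0" "sum l {..<M} = Suc d" using parts_bound[OF l] .
      from M(1) have "l M = 0" by simp
      then have "l i = 0" for i using z[of M] z[of i] by simp
      with M show False by simp
    qed
    then obtain i where "i \<in> removable l" by blast
    then show ?thesis using removable_del_box[OF l] by (metis UN_I imageI)
  qed
  then have "parts (Suc d) \<subseteq> (\<Union>m\<in>parts d. add_box m ` addable m)" by blast
  then show ?case using Suc finite_addable by (meson finite_UN_I finite_imageI finite_subset)
qed (simp add: parts_0)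

text \<open>One of the two factors is peeled by a box and the sum regrouped by the smaller shape,
  where \<open>sum_npaths_add_box\<close> supplies the next factor of the factorial. This is the
  counting form of the Robinson-Schensted correspondence.\<close>

lemma sum_npaths_squared: "(\<Sum>l\<in>parts d. npaths d l * npaths d l) = fact d"
proof (induction d)
  case (Suc d)
  have "(\<Sum>l\<in>parts (Suc d). npaths (Suc d) l * npaths (Suc d) l) =
     (\<Sum>l\<in>parts (Suc d). \<Sum>i\<in>removable l. npaths (Suc d) l * npaths d (del_box l i))"
    by (simp add: sum_distrib_left)
  also have "\<dots> = (\<Sum>(l, i)\<in>(SIGMA l:parts (Suc d). removable l). npaths (Suc d) l * npaths d (del_box l i))"
    by (rule sum.Sigma) (auto simp: finite_parts finite_removable)
  also have "\<dots> = (\<Sum>(m, i)\<in>(SIGMA m:parts d. addable m). npaths (Suc d) (add_box m i) * npaths d m)"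
    by (rule sum.reindex_bij_witness[of _ "\<lambda>(m, i). (add_box m i, i)" "\<lambda>(l, i). (del_box l i, i)"])
      (auto simp: removable_del_box addable_add_box simp del: npaths.simps)
  also have "\<dots> = (\<Sum>m\<in>parts d. \<Sum>i\<in>addable m. npaths (Suc d) (add_box m i) * npaths d m)"
    by (rule sum.Sigma[symmetric]) (auto simp: finite_parts finite_addable)
  also have "\<dots> = (\<Sum>m\<in>parts d. Suc d * npaths d m * npaths d m)"
    by (rule sum.cong, rule refl, subst sum_distrib_right[symmetric], subst sum_npaths_add_box) auto
  also have "\<dots> = Suc d * (\<Sum>m\<in>parts d. npaths d m * npaths d m)"
    by (simp only: sum_distrib_left mult.assoc)
  finally show ?case using Suc by (simp del: npaths.simps)
qed (simp add: parts_0)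

section \<open>Standard tableaux counted by growth of their shape\<close>

definition diagram :: "(nat \<Rightarrow> nat) \<Rightarrow> (nat \<times> nat) set" where
  "diagram l = {(i, j). j < l i}"

definition syts :: "nat \<Rightarrow> (nat \<Rightarrow> nat) \<Rightarrow> (nat \<times> nat \<Rightarrow> nat) set" where
  "syts d l = {T. (\<forall>x. x \<notin> diagram l \<longrightarrow> T x = 0) \<and> bij_betw T (diagram l) {1..d} \<and>
     (\<forall>i j. (i, Suc j) \<in> diagram l \<longrightarrow> T (i, j) < T (i, Suc j)) \<and>
     (\<forall>i j. (Suc i, j) \<in> diagram l \<longrightarrow> T (i, j) < T (Suc i, j))}"

lemma diagram_del_box:
  "i \<in> removable l \<Longrightarrow> diagram (del_box l i) = diagram l - {(i, l i - 1)}"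
  by (auto simp: diagram_def del_box_def removable_def split: if_splits)

text \<open>Nothing can stand to the right of the largest entry or below it, so it occupies a
  removable corner; erasing it leaves a tableau of the smaller shape, and every such tableau extends
  back.\<close>

lemma syts_Suc:
  assumes l: "l \<in> parts (Suc d)"
  shows "syts (Suc d) l = (\<Union>i\<in>removable l. (\<lambda>T. T((i, l i - 1) := Suc d)) ` syts d (del_box l i))"
proof (intro equalityI subsetI)
  fix T assume T: "T \<in> syts (Suc d) l"
  then have bij: "bij_betw T (diagram l) {1..Suc d}" by (simp add: syts_def)
  have le: "T x \<le> Suc d" if "x \<in> diagram l" for x
    using bij that by (force simp: bij_betw_def)
  have "Suc d \<in> T ` diagram l" using bij by (simp add: bij_betw_def)
  then obtain i j where ij: "(i, j) \<in> diagram l" "T (i, j) = Suc d" by force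
  have "(i, Suc j) \<notin> diagram l"
    using T ij le[of "(i, Suc j)"] by (force simp: syts_def)
  then have j: "j = l i - 1" "l i > 0" using ij by (auto simp: diagram_def)
  have "(Suc i, j) \<notin> diagram l"
    using T ij le[of "(Suc i, j)"] by (force simp: syts_def)
  then have i: "i \<in> removable l" using j by (auto simp: diagram_def removable_def)
  define T' where "T' = T((i, j) := 0)"
  have D: "diagram (del_box l i) = diagram l - {(i, j)}" using diagram_del_box[OF i] j by simp
  have "bij_betw T (diagram l - {(i, j)}) ({1..Suc d} - {Suc d})"
    using bij_betw_DiffI[OF bij, of "{(i, j)}" "{Suc d}"] ij by (auto simp: bij_betw_def)
  moreover have "{1..Suc d} - {Suc d} = {1..d}" by auto
  ultimately have "bij_betw T' (diagram (del_box l i)) {1..d}"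
    unfolding D T'_def by (subst bij_betw_cong[of _ _ T]) auto
  moreover have "T' (a, c) < T' (a, Suc c)" if h: "(a, Suc c) \<in> diagram (del_box l i)" for a c
  proof -
    have "(a, Suc c) \<in> diagram l" "(a, Suc c) \<noteq> (i, j)" "(a, c) \<noteq> (i, j)"
      using h \<open>(i, Suc j) \<notin> diagram l\<close> unfolding D by auto
    then show ?thesis using T by (auto simp: T'_def syts_def)
  qed
  moreover have "T' (a, c) < T' (Suc a, c)" if h: "(Suc a, c) \<in> diagram (del_box l i)" for a c
  proof -
    have "(Suc a, c) \<in> diagram l" "(Suc a, c) \<noteq> (i, j)" "(a, c) \<noteq> (i, j)"
      using h \<open>(Suc i, j) \<notin> diagram l\<close> unfolding D by auto
    then show ?thesis using T by (auto simp: T'_def syts_def)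
  qed
  moreover have "T' x = 0" if "x \<notin> diagram (del_box l i)" for x
    using that T by (cases x) (auto simp: T'_def syts_def D)
  ultimately have "T' \<in> syts d (del_box l i)"
    unfolding syts_def by blast
  moreover have "T = T'((i, l i - 1) := Suc d)" using ij j by (auto simp: T'_def)
  ultimately show "T \<in> (\<Union>i\<in>removable l. (\<lambda>T. T((i, l i - 1) := Suc d)) ` syts d (del_box l i))"
    using i by blast
next
  fix T assume "T \<in> (\<Union>i\<in>removable l. (\<lambda>T. T((i, l i - 1) := Suc d)) ` syts d (del_box l i))"
  then obtain i T' where i: "i \<in> removable l" and T': "T' \<in> syts d (del_box l i)"
    and T: "T = T'((i, l i - 1) := Suc d)" by blast
  define j where "j = l i - 1"
  have lj: "l i = Suc j" using i by (auto simp: j_def removable_def)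
  have "(i, j) \<in> diagram l" using lj by (simp add: diagram_def)
  moreover have "diagram (del_box l i) = diagram l - {(i, j)}" using diagram_del_box[OF i] lj by simp
  ultimately have D: "diagram l = insert (i, j) (diagram (del_box l i))" "(i, j) \<notin> diagram (del_box l i)"
    by blast+
  have bij: "bij_betw T' (diagram (del_box l i)) {1..d}" using T' by (simp add: syts_def)
  then have lt: "T' x \<le> d" if "x \<in> diagram (del_box l i)" for x
    using that by (force simp: bij_betw_def)
  have z: "T' x = 0" if "x \<notin> diagram (del_box l i)" for x using T' that by (cases x) (auto simp: syts_def)
  have le: "T' x \<le> d" for x using lt z by (cases "x \<in> diagram (del_box l i)") auto
  have "bij_betw T (diagram (del_box l i)) {1..d}"
    using bij D(2) unfolding T j_def[symmetric] by (subst bij_betw_cong[of _ _ T']) auto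
  then have "bij_betw T (diagram (del_box l i) \<union> {(i, j)}) ({1..d} \<union> {T (i, j)})"
    by (intro notIn_Un_bij_betw[OF D(2)]) (auto simp: T j_def)
  then have "bij_betw T (insert (i, j) (diagram (del_box l i))) (insert (T (i, j)) {1..d})" by simp
  moreover have "insert (T (i, j)) {1..d} = {1..Suc d}" by (auto simp: T j_def)
  ultimately have b: "bij_betw T (diagram l) {1..Suc d}" by (simp only: D(1))
  have n1: "(i, Suc j) \<notin> diagram l" "(Suc i, j) \<notin> diagram l"
    using i lj by (auto simp: diagram_def removable_def)
  have r: "T (a, c) < T (a, Suc c)" if h: "(a, Suc c) \<in> diagram l" for a c
  proof (cases "(a, Suc c) = (i, j)")
    case True
    then show ?thesis using le[of "(a, c)"] by (auto simp: T j_def less_Suc_eq_le)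
  next
    case False
    then have "(a, Suc c) \<in> diagram (del_box l i)" using h D by auto
    moreover have "(a, c) \<noteq> (i, j)" using h n1 by auto
    ultimately show ?thesis using T' False by (auto simp: syts_def T j_def)
  qed
  have c: "T (a, c) < T (Suc a, c)" if h: "(Suc a, c) \<in> diagram l" for a c
  proof (cases "(Suc a, c) = (i, j)")
    case True
    then show ?thesis using le[of "(a, c)"] by (auto simp: T j_def less_Suc_eq_le)
  next
    case False
    then have "(Suc a, c) \<in> diagram (del_box l i)" using h D by auto
    moreover have "(a, c) \<noteq> (i, j)" using h n1 by auto
    ultimately show ?thesis using T' False by (auto simp: syts_def T j_def)
  qed
  show "T \<in> syts (Suc d) l"
  proof -
    have "T x = 0" if "x \<notin> diagram l" for x
      using that z[of x] D(1) by (auto simp: T j_def)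
    with b r c show ?thesis unfolding syts_def by blast
  qed
qed

lemma card_syts: "l \<in> parts d \<Longrightarrow> finite (syts d l) \<and> card (syts d l) = npaths d l"
proof (induction d arbitrary: l)
  case 0
  then have "diagram l = {}" by (auto simp: parts_0 diagram_def)
  then have "syts 0 l = {\<lambda>_. 0}" by (auto simp: syts_def bij_betw_def)
  then show ?case by simp
next
  case (Suc d)
  let ?U = "\<lambda>i T. T((i, l i - 1) := Suc d)"
  have IH: "finite (syts d (del_box l i)) \<and> card (syts d (del_box l i)) = npaths d (del_box l i)"
    if "i \<in> removable l" for i
    using Suc.IH removable_del_box(1)[OF Suc.prems that] .
  \<comment> \<open>The cell to be filled lies outside the smaller diagram, where every tableau
    vanishes, so overwriting it loses nothing.\<close>
  have z: "T (i, l i - 1) = 0" if "i \<in> removable l" "T \<in> syts d (del_box l i)" for i T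
    using that diagram_del_box[of i l] by (auto simp: syts_def)
  have inj: "inj_on (?U i) (syts d (del_box l i))" if "i \<in> removable l" for i
  proof (rule inj_onI)
    fix S T assume "S \<in> syts d (del_box l i)" "T \<in> syts d (del_box l i)" "?U i S = ?U i T"
    then show "S = T" using z[OF that] by (metis fun_upd_triv fun_upd_upd)
  qed
  have dis: "?U i ` syts d (del_box l i) \<inter> ?U j ` syts d (del_box l j) = {}"
    if "i \<in> removable l" "j \<in> removable l" "i \<noteq> j" for i j
  proof -
    have "?U i S \<noteq> ?U j T" if S: "S \<in> syts d (del_box l i)" and T: "T \<in> syts d (del_box l j)" for S T
    proof
      assume "?U i S = ?U j T"
      then have "?U i S (i, l i - 1) = ?U j T (i, l i - 1)" by simp
      then have e: "T (i, l i - 1) = Suc d" using \<open>i \<noteq> j\<close> by simp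
      then have "(i, l i - 1) \<in> diagram (del_box l j)" using T by (force simp: syts_def)
      then have "T (i, l i - 1) \<in> {1..d}" using T by (auto simp: syts_def bij_betw_def)
      then show False using e by simp
    qed
    then show ?thesis by blast
  qed
  have "card (syts (Suc d) l) = (\<Sum>i\<in>removable l. card (?U i ` syts d (del_box l i)))"
    unfolding syts_Suc[OF Suc.prems] using IH dis finite_removable[OF Suc.prems]
    by (subst card_UN_disjoint) auto
  also have "\<dots> = npaths (Suc d) l"
    using inj IH by (auto simp: card_image intro!: sum.cong)
  finally show ?case
    unfolding syts_Suc[OF Suc.prems] using IH finite_removable[OF Suc.prems] by auto
qed

definition shape :: "nat list \<Rightarrow> nat \<Rightarrow> nat" where
  "shape la i = (if i < length la then la ! i else 0)"

lemma shape_parts: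
  assumes "is_partition r la"
  shows "shape la \<in> parts r"
proof (rule partsI)
  show "shape la (Suc i) \<le> shape la i" for i
    using assms by (auto simp: is_partition_def shape_def sorted_wrt_iff_nth_less)
  show "\<forall>i\<ge>length la. shape la i = 0" by (auto simp: shape_def)
  have "sum (shape la) {..<length la} = sum_list la"
    by (simp add: sum_list_sum_nth atLeast0LessThan shape_def)
  then show "sum (shape la) {..<length la} = r" using assms by (simp add: is_partition_def)
qed

lemma num_syt_eq_npaths:
  assumes "is_partition r la"
  shows "num_syt la = npaths r (shape la)"
proof -
  have "young_diagram la = diagram (shape la)"
    by (auto simp: young_diagram_def diagram_def shape_def split: if_splits)
  then have "num_syt la = card (syts r (shape la))"
    using assms by (simp add: num_syt_def syts_def is_partition_def)
  then show ?thesis using card_syts[OF shape_parts[OF assms]] by simp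
qed

lemma length_partition:
  assumes "is_partition r la"
  shows "length la \<le> r"
proof -
  have "length la = sum_list (map (\<lambda>_. 1) la)" by (simp add: sum_list_triv)
  also have "\<dots> \<le> sum_list (map (\<lambda>x. x) la)"
    by (rule sum_list_mono) (use assms in \<open>auto simp: is_partition_def Suc_le_eq\<close>)
  finally show ?thesis using assms by (simp add: is_partition_def)
qed

section \<open>Dominant lattice paths\<close>

definition dominant :: "nat \<Rightarrow> (nat \<Rightarrow> int) \<Rightarrow> bool" where
  "dominant n w \<longleftrightarrow> (\<forall>a. Suc a < n \<longrightarrow> w (Suc a) \<le> w a)"

text \<open>The weight that remains after a letter \<open>a\<close> is stripped off. A letter of V
  carries +1 in coordinate \<open>a\<close> and a letter of the dual carries -1, hence the opposite
  signs here.\<close>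

definition shift :: "bool \<Rightarrow> nat \<Rightarrow> (nat \<Rightarrow> int) \<Rightarrow> nat \<Rightarrow> int" where
  "shift b a w = w(a := w a + (if b then -1 else 1))"

text \<open>Sign lists encode mixed tensor products: \<open>True\<close> is a factor \<open>V\<close>, \<open>False\<close> its dual. Reading a
  word from the right adds one weight vector at a time; \<open>pathwords\<close> keeps the words all of whose
  intermediate weights are dominant.\<close>

primrec pathwords :: "nat \<Rightarrow> bool list \<Rightarrow> (nat \<Rightarrow> int) \<Rightarrow> nat list set" where
  "pathwords n [] w = (if \<forall>a<n. w a = 0 then {[]} else {})"
| "pathwords n (b # sg) w =
    (if dominant n w then (\<Union>a\<in>{..<n}. (#) a ` pathwords n sg (shift b a w)) else {})"

lemma finite_pathwords: "finite (pathwords n sg w)"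
  by (induction sg arbitrary: w) auto

lemma pathwords_dominant: "pathwords n sg w \<noteq> {} \<Longrightarrow> dominant n w"
  by (cases sg) (auto simp: dominant_def split: if_splits)

lemma card_pathwords_Cons:
  "card (pathwords n (b # sg) w) =
     (if dominant n w then \<Sum>a<n. card (pathwords n sg (shift b a w)) else 0)"
proof -
  have "card (\<Union>a\<in>{..<n}. (#) a ` pathwords n sg (shift b a w)) =
      (\<Sum>a<n. card ((#) a ` pathwords n sg (shift b a w)))"
    by (rule card_UN_disjoint) (auto simp: finite_pathwords)
  then show ?thesis by (simp add: card_image)
qed

text \<open>Reflecting the coordinates gives agreement of weights only below \<open>n\<close>, and
  these coordinates are all that the recursion reads.\<close>

lemma card_pathwords_cong:
  "(\<And>a. a < n \<Longrightarrow> w a = w' a) \<Longrightarrow> card (pathwords n sg w) = card (pathwords n sg w')"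
proof (induction sg arbitrary: w w')
  case (Cons b sg)
  have "dominant n w \<longleftrightarrow> dominant n w'" using Cons.prems by (simp add: dominant_def)
  moreover have "card (pathwords n sg (shift b a w)) = card (pathwords n sg (shift b a w'))" for a
    by (rule Cons.IH) (use Cons.prems in \<open>auto simp: shift_def\<close>)
  ultimately show ?case by (simp add: card_pathwords_Cons del: pathwords.simps)
qed auto

text \<open>On highest weights this is passage to the dual module. It exchanges V with its dual, so
  the recursion has to be estimated only for a factor V.\<close>

definition dual_weight :: "nat \<Rightarrow> (nat \<Rightarrow> int) \<Rightarrow> nat \<Rightarrow> int" where
  "dual_weight n w a = - w (n - 1 - a)"

text \<open>A dominant weight splits into its positive entries and, read from the far end with the
  sign changed, its negative ones. These are the \<lambda> and \<mu> of the theorem.\<close>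

definition pos_part :: "nat \<Rightarrow> (nat \<Rightarrow> int) \<Rightarrow> nat \<Rightarrow> nat" where
  "pos_part n w i = (if i < n then nat (w i) else 0)"

definition neg_part :: "nat \<Rightarrow> (nat \<Rightarrow> int) \<Rightarrow> nat \<Rightarrow> nat" where
  "neg_part n w = pos_part n (dual_weight n w)"

lemma pos_part_dual: "pos_part n (dual_weight n w) = neg_part n w"
  and neg_part_dual: "neg_part n (dual_weight n w) = pos_part n w"
  by (auto simp: neg_part_def pos_part_def dual_weight_def fun_eq_iff)

lemma dominant_dual: "dominant n (dual_weight n w) \<longleftrightarrow> dominant n w"
proof -
  have *: "dominant n (dual_weight n w)" if "dominant n w" for w
  proof -
    have "w (n - Suc a) \<le> w (n - Suc (Suc a))" if "Suc a < n" for a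
    proof -
      have "Suc (n - Suc (Suc a)) = n - Suc a" using that by simp
      then show ?thesis using \<open>dominant n w\<close> that unfolding dominant_def
        by (metis diff_Suc_less less_nat_zero_code not_gr_zero)
    qed
    then show ?thesis by (auto simp: dominant_def dual_weight_def)
  qed
  have "dominant n w \<longleftrightarrow> dominant n (dual_weight n (dual_weight n w))"
    by (auto simp: dominant_def dual_weight_def)
  then show ?thesis using * by blast
qed

lemma card_pathwords_dual:
  "card (pathwords n (map Not sg) (dual_weight n w)) = card (pathwords n sg w)"
proof (induction sg arbitrary: w)
  case Nil
  have "(\<forall>a<n. dual_weight n w a = 0) \<longleftrightarrow> (\<forall>a<n. w a = 0)"
  proof
    assume h: "\<forall>a<n. dual_weight n w a = 0"
    show "\<forall>a<n. w a = 0"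
    proof (intro allI impI)
      fix a assume "a < n"
      then show "w a = 0" using h[rule_format, of "n - 1 - a"] by (auto simp: dual_weight_def)
    qed
  qed (auto simp: dual_weight_def)
  then show ?case by simp
next
  case (Cons b sg)
  have "card (pathwords n (map Not sg) (shift (\<not> b) (n - 1 - a) (dual_weight n w))) =
        card (pathwords n sg (shift b a w))" if "a < n" for a
  proof -
    have "card (pathwords n (map Not sg) (shift (\<not> b) (n - 1 - a) (dual_weight n w))) =
       card (pathwords n (map Not sg) (dual_weight n (shift b a w)))"
      by (rule card_pathwords_cong) (use that in \<open>auto simp: shift_def dual_weight_def\<close>)
    then show ?thesis by (simp add: Cons.IH)
  qed
  then have "(\<Sum>a<n. card (pathwords n sg (shift b a w))) =
     (\<Sum>a<n. card (pathwords n (map Not sg) (shift (\<not> b) (n - 1 - a) (dual_weight n w))))"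
    by simp
  also have "\<dots> = (\<Sum>a<n. card (pathwords n (map Not sg) (shift (\<not> b) a (dual_weight n w))))"
    by (rule sum.reindex_bij_witness[of _ "\<lambda>a. n - 1 - a" "\<lambda>a. n - 1 - a"]) auto
  finally show ?case by (simp add: card_pathwords_Cons dominant_dual del: pathwords.simps)
qed

text \<open>Choose \<open>a\<close> of the \<open>p\<close> vector factors and \<open>b\<close> of
  the \<open>q\<close> dual factors to survive, and match the other vector factors with the other
  dual factors; without equally many of both there is no matching.\<close>

definition mixed_coeff :: "nat \<Rightarrow> nat \<Rightarrow> nat \<Rightarrow> nat \<Rightarrow> nat" where
  "mixed_coeff p q a b =
     (if a \<le> p \<and> b \<le> q \<and> p - a = q - b then (p choose a) * (q choose b) * fact (p - a) else 0)"

lemma mixed_coeff_sym: "mixed_coeff p q a b = mixed_coeff q p b a"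
  by (auto simp: mixed_coeff_def mult.commute)

lemma binomial_Suc_mult: "Suc b * (q choose Suc b) = (q - b) * (q choose b)"
  by (simp only: binomial_absorption binomial_absorb_comp)

text \<open>If no vector factor survives, a new one must be matched, and its partner is one of the b
  + 1 dual factors that were free before.\<close>

lemma mixed_coeff_Suc_0: "mixed_coeff p q 0 (Suc b) * Suc b = mixed_coeff (Suc p) q 0 b"
proof (cases "b < q \<and> p = q - Suc b")
  case True
  define s where "s = q - Suc b"
  have s: "q - b = Suc s" "p = s" using True by (auto simp: s_def)
  have "(q choose Suc b) * fact s * Suc b = fact s * (Suc b * (q choose Suc b))" by (simp only: ac_simps)
  also have "\<dots> = fact (Suc s) * (q choose b)" unfolding binomial_Suc_mult s by (simp add: algebra_simps)
  finally show ?thesis using True s by (auto simp: mixed_coeff_def s_def[symmetric] algebra_simps)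
qed (auto simp: mixed_coeff_def)

text \<open>A new vector factor either survives, which is the first term, or is matched with one of
  the b + 1 dual factors that were free before, which is the second.\<close>

lemma mixed_coeff_Suc_Suc:
  "mixed_coeff p q a b + mixed_coeff p q (Suc a) (Suc b) * Suc b = mixed_coeff (Suc p) q (Suc a) b"
proof (cases "a \<le> p \<and> b \<le> q \<and> p - a = q - b")
  case True
  show ?thesis
  proof (cases "b = q")
    case True
    with \<open>a \<le> p \<and> b \<le> q \<and> p - a = q - b\<close> show ?thesis by (auto simp: mixed_coeff_def)
  next
    case False
    define s where "s = p - Suc a"
    have s: "p - a = Suc s" "q - b = Suc s" "q - Suc b = s" "Suc a \<le> p" "Suc b \<le> q"
      using True False by (auto simp: s_def)
    have "(p choose Suc a) * (q choose Suc b) * fact s * Suc b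
        = (p choose Suc a) * fact s * (Suc b * (q choose Suc b))" by (simp only: ac_simps)
    also have "\<dots> = (p choose Suc a) * (q choose b) * fact (Suc s)"
      unfolding binomial_Suc_mult s by (simp add: algebra_simps)
    finally have "(p choose Suc a) * (q choose Suc b) * fact s * Suc b
        = (p choose Suc a) * (q choose b) * fact (Suc s)" .
    then show ?thesis
      using s True by (auto simp: mixed_coeff_def s_def[symmetric] algebra_simps)
  qed
qed (auto simp: mixed_coeff_def)

lemma sum_le_sum_inj:
  assumes "\<And>b. b \<in> A \<Longrightarrow> f b \<in> B" "inj_on f A" "finite B" "\<And>x. x \<in> A \<Longrightarrow> g x \<le> (h (f x) :: nat)"
  shows "sum g A \<le> sum h B"
proof -
  have "sum g A \<le> sum (h \<circ> f) A" using assms(4) by (auto intro: sum_mono)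
  also have "\<dots> = sum h (f ` A)" using assms(2) by (simp add: sum.reindex)
  also have "\<dots> \<le> sum h B" using assms by (intro sum_mono2) auto
  finally show ?thesis .
qed

text \<open>Only an inequality can hold for every \<open>n\<close>: when \<open>n\<close> is small,
  some boxes counted on the right have no coordinate of the weight to live in.\<close>

definition path_bound :: "nat \<Rightarrow> bool list \<Rightarrow> nat \<Rightarrow> nat \<Rightarrow> bool" where
  "path_bound n sg p q \<longleftrightarrow> (\<forall>w a b. dominant n w \<longrightarrow> pos_part n w \<in> parts a \<longrightarrow> neg_part n w \<in> parts b \<longrightarrow>
     card (pathwords n sg w) \<le> mixed_coeff p q a b * npaths a (pos_part n w) * npaths b (neg_part n w))"

text \<open>Stripping a letter c of V lowers coordinate c. If the coordinate was positive, a box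
  leaves the positive part (\<open>A1\<close>); otherwise a box joins the negative part
  (\<open>A2\<close>). The first kind sums by the recursion of \<open>npaths\<close>, the second by
  \<open>sum_npaths_add_box\<close>, and the two coefficients combine as in
  \<open>mixed_coeff_Suc_Suc\<close>.\<close>

lemma path_bound_True:
  assumes H: "path_bound n sg p q"
  shows "path_bound n (True # sg) (Suc p) q"
  unfolding path_bound_def
proof (intro allI impI)
  fix w a b
  assume dom: "dominant n w" and pa: "pos_part n w \<in> parts a" and nb: "neg_part n w \<in> parts b"
  let ?l = "pos_part n w" and ?m = "neg_part n w"
  let ?N = "\<lambda>c. card (pathwords n sg (shift True c w))"
  define A1 where "A1 = {c. c < n \<and> w c > 0 \<and> dominant n (shift True c w)}"
  define A2 where "A2 = {c. c < n \<and> w c \<le> 0 \<and> dominant n (shift True c w)}"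
  have fin: "finite A1" "finite A2" by (auto simp: A1_def A2_def)
  have "card (pathwords n (True # sg) w) = (\<Sum>c<n. ?N c)"
    using dom by (simp add: card_pathwords_Cons del: pathwords.simps)
  also have "\<dots> = sum ?N (A1 \<union> A2)"
  proof (rule sum.mono_neutral_right)
    show "\<forall>c\<in>{..<n} - (A1 \<union> A2). ?N c = 0"
    proof
      fix c assume c: "c \<in> {..<n} - (A1 \<union> A2)"
      then have "\<not> dominant n (shift True c w)" by (auto simp: A1_def A2_def not_less)
      then have "pathwords n sg (shift True c w) = {}" using pathwords_dominant by blast
      then show "?N c = 0" by simp
    qed
  qed (auto simp: A1_def A2_def)
  also have "\<dots> = sum ?N A1 + sum ?N A2"
    by (rule sum.union_disjoint) (use fin in \<open>auto simp: A1_def A2_def\<close>)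
  finally have tot: "card (pathwords n (True # sg) w) = sum ?N A1 + sum ?N A2" .
  have s1: "pos_part n (shift True c w) = del_box ?l c" "neg_part n (shift True c w) = ?m"
    "c \<in> removable ?l" if "c \<in> A1" for c
  proof -
    have c: "c < n" "w c > 0" and d: "dominant n (shift True c w)" using that by (auto simp: A1_def)
    show "pos_part n (shift True c w) = del_box ?l c" using c by (auto simp: pos_part_def shift_def del_box_def fun_eq_iff nat_diff_distrib)
    show "neg_part n (shift True c w) = ?m"
      using c by (auto simp: neg_part_def pos_part_def shift_def dual_weight_def)
    show "c \<in> removable ?l"
      using c d by (auto simp: removable_def pos_part_def shift_def dominant_def dest: spec[of _ c])
  qed
  have s2: "pos_part n (shift True c w) = ?l" "neg_part n (shift True c w) = add_box ?m (n - 1 - c)"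
    "n - 1 - c \<in> addable ?m" if "c \<in> A2" for c
  proof -
    have c: "c < n" "w c \<le> 0" and d: "dominant n (shift True c w)" using that by (auto simp: A2_def)
    show "pos_part n (shift True c w) = ?l" using c by (auto simp: pos_part_def shift_def)
    show "neg_part n (shift True c w) = add_box ?m (n - 1 - c)"
      using c by (auto simp: neg_part_def pos_part_def shift_def dual_weight_def add_box_def fun_eq_iff nat_add_distrib)
    show "n - 1 - c \<in> addable ?m"
    proof (cases "Suc c < n")
      case True
      then have "w (Suc c) < w c" using d by (auto simp: shift_def dominant_def dest: spec[of _ c])
      moreover have "n - Suc (n - Suc (Suc c)) = Suc c" "n - Suc (n - Suc c) = c" "n - Suc c \<noteq> 0"
        "n - Suc c - 1 = n - Suc (Suc c)"
        using True by auto
      ultimately show ?thesis using c(2) True by (auto simp: addable_def neg_part_def pos_part_def dual_weight_def)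
    next
      case False
      then have "n - 1 - c = 0" by simp
      then show ?thesis by (simp add: addable_def)
    qed
  qed
  have "sum ?N A2 \<le> (\<Sum>j\<in>addable ?m. mixed_coeff p q a (Suc b) * npaths a ?l * npaths (Suc b) (add_box ?m j))"
  \<comment> \<open>The negative part is read from the far end, so coordinate c is its row n - 1 -
    c. Addable rows that no c reaches only enlarge the right side.\<close>
  proof (rule sum_le_sum_inj[of _ "\<lambda>c. n - 1 - c"])
    show "inj_on (\<lambda>c. n - 1 - c) A2" by (auto simp: inj_on_def A2_def)
    show "finite (addable ?m)" using nb by (rule finite_addable)
    fix c assume c: "c \<in> A2"
    then show "n - 1 - c \<in> addable ?m" by (rule s2)
    have "dominant n (shift True c w)" using c by (simp add: A2_def)
    then show "?N c \<le> mixed_coeff p q a (Suc b) * npaths a ?l * npaths (Suc b) (add_box ?m (n - 1 - c))"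
      using H[unfolded path_bound_def, rule_format, of "shift True c w" a "Suc b"]
        pa addable_add_box(1)[OF nb s2(3)[OF c]] unfolding s2(1,2)[OF c] by blast
  qed
  also have "\<dots> = mixed_coeff p q a (Suc b) * npaths a ?l * (Suc b * npaths b ?m)"
    by (simp only: sum_npaths_add_box[OF nb] flip: sum_distrib_left)
  finally have B2: "sum ?N A2 \<le> mixed_coeff p q a (Suc b) * Suc b * (npaths a ?l * npaths b ?m)"
    by (simp add: algebra_simps)
  show "card (pathwords n (True # sg) w) \<le> mixed_coeff (Suc p) q a b * npaths a ?l * npaths b ?m"
  proof (cases a)
    case 0
    then have "?l = (\<lambda>_. 0)" using pa by (simp add: parts_0)
    then have "removable ?l = {}" by (auto simp: removable_def)
    then have "A1 = {}" using s1(3) by blast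
    then show ?thesis using tot B2 0 by (simp add: mixed_coeff_Suc_0[symmetric] algebra_simps)
  next
    case (Suc a')
    have "sum ?N A1 \<le> (\<Sum>j\<in>removable ?l. mixed_coeff p q a' b * npaths b ?m * npaths a' (del_box ?l j))"
    proof (rule sum_le_sum_inj[of _ "\<lambda>c. c"])
      show "finite (removable ?l)" using pa by (rule finite_removable)
      fix c assume c: "c \<in> A1"
      then show "c \<in> removable ?l" by (rule s1)
      have "dominant n (shift True c w)" using c by (simp add: A1_def)
      then have "?N c \<le> mixed_coeff p q a' b * npaths a' (del_box ?l c) * npaths b ?m"
        using H[unfolded path_bound_def, rule_format, of "shift True c w" a' b]
          nb removable_del_box(1)[OF pa[unfolded Suc] s1(3)[OF c]] unfolding s1(1,2)[OF c] by blast
      then show "?N c \<le> mixed_coeff p q a' b * npaths b ?m * npaths a' (del_box ?l c)"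
        by (simp add: algebra_simps)
    qed auto
    also have "\<dots> = mixed_coeff p q a' b * npaths b ?m * npaths (Suc a') ?l"
      by (simp flip: sum_distrib_left)
    finally have B1: "sum ?N A1 \<le> mixed_coeff p q a' b * (npaths a ?l * npaths b ?m)"
      by (simp only: Suc ac_simps)
    have "sum ?N A1 + sum ?N A2 \<le> (mixed_coeff p q a' b + mixed_coeff p q a (Suc b) * Suc b) * (npaths a ?l * npaths b ?m)"
      using B1 B2 by (simp only: distrib_right add_mono)
    also have "mixed_coeff p q a' b + mixed_coeff p q a (Suc b) * Suc b = mixed_coeff (Suc p) q a b"
      unfolding Suc by (rule mixed_coeff_Suc_Suc)
    finally show ?thesis using tot by (simp only: mult.assoc)
  qed
qed

lemma path_bound_dual:
  assumes "path_bound n sg p q"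
  shows "path_bound n (map Not sg) q p"
  unfolding path_bound_def
proof (intro allI impI)
  fix w a b
  assume d: "dominant n w" "pos_part n w \<in> parts a" "neg_part n w \<in> parts b"
  have "card (pathwords n (map Not sg) w) = card (pathwords n sg (dual_weight n w))"
    using card_pathwords_dual[of n "map Not sg" w] by (simp add: comp_def)
  also have "\<dots> \<le> mixed_coeff p q b a * npaths b (neg_part n w) * npaths a (pos_part n w)"
    using assms[unfolded path_bound_def, rule_format, of "dual_weight n w" b a] d
    unfolding dominant_dual pos_part_dual neg_part_dual by blast
  finally show "card (pathwords n (map Not sg) w) \<le>
      mixed_coeff q p a b * npaths a (pos_part n w) * npaths b (neg_part n w)"
    by (simp add: mixed_coeff_sym[of p q] algebra_simps)
qed

lemma path_bound_False:
  assumes "path_bound n sg p q"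
  shows "path_bound n (False # sg) p (Suc q)"
  using path_bound_dual[OF path_bound_True[OF path_bound_dual[OF assms]]] by (simp add: comp_def)

lemma path_bound: "path_bound n sg (count_list sg True) (count_list sg False)"
proof (induction sg)
  case Nil
  have "card (pathwords n [] w) \<le> mixed_coeff 0 0 a b * npaths a (pos_part n w) * npaths b (neg_part n w)"
    if "pos_part n w \<in> parts a" "neg_part n w \<in> parts b" for w a b
  proof (cases "\<forall>a<n. w a = 0")
    case True
    then have z: "pos_part n w = (\<lambda>_. 0)" "neg_part n w = (\<lambda>_. 0)"
      by (auto simp: pos_part_def neg_part_def dual_weight_def)
    then have "a = 0" "b = 0"
      using that parts_sum[of "\<lambda>_. 0" _ 0] by force+
    then show ?thesis by (simp add: mixed_coeff_def)
  next
    case False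
    then have "pathwords n [] w = {}" by auto
    then show ?thesis by (simp only: card.empty)
  qed
  then show ?case unfolding path_bound_def by simp
next
  case (Cons b sg)
  then show ?case by (cases b) (auto intro: path_bound_True path_bound_False)
qed

section \<open>Highest weight vectors in mixed tensor products\<close>

text \<open>The matrix of \<open>X\<close> on one factor: \<open>X\<close> on V, minus its transpose
  on the dual. Coefficients are transformed rather than basis vectors, so the first index is the
  letter of the output word.\<close>

definition slot :: "bool \<Rightarrow> (nat \<Rightarrow> nat \<Rightarrow> complex) \<Rightarrow> nat \<Rightarrow> nat \<Rightarrow> complex" where
  "slot b X a i = (if b then X a i else - X i a)"

text \<open>The Leibniz rule with the first factor split off. The values of \<open>hd\<close> and
  \<open>tl\<close> are meaningful on words as long as the sign list.\<close>

primrec sact :: "nat \<Rightarrow> bool list \<Rightarrow> (nat \<Rightarrow> nat \<Rightarrow> complex) \<Rightarrow> (nat list \<Rightarrow> complex) \<Rightarrow> nat list \<Rightarrow> complex" where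
  "sact n [] X g s = 0"
| "sact n (b # sg) X g s =
     (\<Sum>i<n. slot b X (hd s) i * g (i # tl s)) + sact n sg X (\<lambda>u. g (hd s # u)) (tl s)"

definition mat_mult :: "nat \<Rightarrow> (nat \<Rightarrow> nat \<Rightarrow> complex) \<Rightarrow> (nat \<Rightarrow> nat \<Rightarrow> complex) \<Rightarrow> nat \<Rightarrow> nat \<Rightarrow> complex" where
  "mat_mult n X Y i j = (\<Sum>l<n. X i l * Y l j)"

definition commutator :: "nat \<Rightarrow> (nat \<Rightarrow> nat \<Rightarrow> complex) \<Rightarrow> (nat \<Rightarrow> nat \<Rightarrow> complex) \<Rightarrow> nat \<Rightarrow> nat \<Rightarrow> complex" where
  "commutator n X Y i j = mat_mult n X Y i j - mat_mult n Y X i j"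

definition adjoint_mat :: "(nat \<Rightarrow> nat \<Rightarrow> complex) \<Rightarrow> nat \<Rightarrow> nat \<Rightarrow> complex" where
  "adjoint_mat X i j = cnj (X j i)"

primrec words :: "nat \<Rightarrow> nat \<Rightarrow> nat list set" where
  "words n 0 = {[]}"
| "words n (Suc m) = (\<lambda>(a, s). a # s) ` ({..<n} \<times> words n m)"

lemma finite_words: "finite (words n m)"
  by (induction m) auto

lemma sum_words_Suc:
  "(\<Sum>s\<in>words n (Suc m). F s) = (\<Sum>a<n. \<Sum>s\<in>words n m. F (a # s))"
proof -
  have "(\<Sum>s\<in>words n (Suc m). F s) = (\<Sum>(a, s)\<in>{..<n} \<times> words n m. F (a # s))"
    unfolding words.simps by (subst sum.reindex) (auto simp: inj_on_def case_prod_unfold intro!: sum.cong)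
  then show ?thesis by (simp add: sum.cartesian_product)
qed

lemma sact_add: "sact n sg X (\<lambda>u. f u + g u) s = sact n sg X f s + sact n sg X g s"
proof (induction sg arbitrary: f g s)
  case (Cons b sg)
  show ?case by (simp add: Cons.IH distrib_left sum.distrib)
qed simp

lemma sact_scale: "sact n sg X (\<lambda>u. c * f u) s = c * sact n sg X f s"
proof (induction sg arbitrary: f s)
  case (Cons b sg)
  show ?case by (simp add: Cons.IH distrib_left sum_distrib_left mult.left_commute)
qed simp

lemma sact_zero: "sact n sg X (\<lambda>u. 0) s = 0"
  using sact_scale[of n sg X 0 "\<lambda>_. 0" s] by simp

lemma sact_sum:
  "finite I \<Longrightarrow> sact n sg X (\<lambda>u. \<Sum>i\<in>I. c i * f i u) s = (\<Sum>i\<in>I. c i * sact n sg X (f i) s)"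
  by (induction I rule: finite_induct) (auto simp: sact_zero sact_add sact_scale)

lemma sact_mat_sum:
  "finite I \<Longrightarrow> sact n sg (\<lambda>i j. \<Sum>k\<in>I. c k * M k i j) f s = (\<Sum>k\<in>I. c k * sact n sg (M k) f s)"
proof (induction sg arbitrary: f s)
  case (Cons b sg)
  have sl: "slot b (\<lambda>i j. \<Sum>k\<in>I. c k * M k i j) x y = (\<Sum>k\<in>I. c k * slot b (M k) x y)" for x y
    by (simp add: slot_def sum_negf)
  have "(\<Sum>i<n. slot b (\<lambda>i j. \<Sum>k\<in>I. c k * M k i j) (hd s) i * f (i # tl s)) =
        (\<Sum>i<n. \<Sum>k\<in>I. c k * (slot b (M k) (hd s) i * f (i # tl s)))"
    by (simp add: sl sum_distrib_right mult.assoc)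
  also have "\<dots> = (\<Sum>k\<in>I. c k * (\<Sum>i<n. slot b (M k) (hd s) i * f (i # tl s)))"
    by (subst sum.swap) (simp add: sum_distrib_left)
  finally show ?case using Cons by (simp add: sum.distrib distrib_left)
qed simp

text \<open>Lets an equation known only on valid words, such as the vanishing under a raising
  operator, be substituted under the action.\<close>

lemma sact_cong:
  "s \<in> words n (length sg) \<Longrightarrow> (\<And>u. u \<in> words n (length sg) \<Longrightarrow> f u = g u) \<Longrightarrow>
     sact n sg X f s = sact n sg X g s"
proof (induction sg arbitrary: f g s)
  case (Cons b sg)
  then obtain a u where s: "s = a # u" "a < n" "u \<in> words n (length sg)" by auto
  have "sact n sg X (\<lambda>u. f (a # u)) u = sact n sg X (\<lambda>u. g (a # u)) u"
    by (rule Cons.IH) (use s Cons.prems in auto)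
  moreover have "(\<Sum>i<n. slot b X a i * f (i # u)) = (\<Sum>i<n. slot b X a i * g (i # u))"
    by (rule sum.cong) (use s Cons.prems in auto)
  ultimately show ?case by (simp add: s)
qed simp

lemma slot_commutator:
  "(\<Sum>i<n. slot b X a i * slot b Y i j) - (\<Sum>i<n. slot b Y a i * slot b X i j) =
     slot b (commutator n X Y) a j"
  by (cases b) (auto simp: slot_def commutator_def mat_mult_def mult.commute)

text \<open>Operators on different tensor factors commute, so only the contributions in which both
  act on the same factor remain.\<close>

lemma sact_commutator:
  "sact n sg X (sact n sg Y g) s - sact n sg Y (sact n sg X g) s = sact n sg (commutator n X Y) g s"
proof (induction sg arbitrary: g s)
  case (Cons b sg)
  let ?a = "hd s" and ?u = "tl s"
  \<comment> \<open>The composite sorted by where the two operators act. Exchanging \<open>X\<close>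
    and \<open>Y\<close> exchanges the two middle sums, so they cancel in the difference.\<close>
  have e: "sact n (b # sg) X (sact n (b # sg) Y g) s =
     (\<Sum>j<n. (\<Sum>i<n. slot b X ?a i * slot b Y i j) * g (j # ?u))
     + (\<Sum>i<n. slot b X ?a i * sact n sg Y (\<lambda>v. g (i # v)) ?u)
     + (\<Sum>i<n. slot b Y ?a i * sact n sg X (\<lambda>v. g (i # v)) ?u)
     + sact n sg X (sact n sg Y (\<lambda>v. g (?a # v))) ?u" for X Y
  proof -
    have "sact n (b # sg) X (sact n (b # sg) Y g) s =
      (\<Sum>i<n. slot b X ?a i * ((\<Sum>j<n. slot b Y i j * g (j # ?u)) + sact n sg Y (\<lambda>v. g (i # v)) ?u))
      + sact n sg X (\<lambda>u. (\<Sum>j<n. slot b Y ?a j * g (j # u)) + sact n sg Y (\<lambda>v. g (?a # v)) u) ?u"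
      by simp
    also have "sact n sg X (\<lambda>u. (\<Sum>j<n. slot b Y ?a j * g (j # u)) + sact n sg Y (\<lambda>v. g (?a # v)) u) ?u
      = (\<Sum>j<n. slot b Y ?a j * sact n sg X (\<lambda>v. g (j # v)) ?u) + sact n sg X (sact n sg Y (\<lambda>v. g (?a # v))) ?u"
      by (simp add: sact_add sact_sum)
    also have "(\<Sum>i<n. slot b X ?a i * ((\<Sum>j<n. slot b Y i j * g (j # ?u)) + sact n sg Y (\<lambda>v. g (i # v)) ?u))
      = (\<Sum>i<n. \<Sum>j<n. slot b X ?a i * slot b Y i j * g (j # ?u))
        + (\<Sum>i<n. slot b X ?a i * sact n sg Y (\<lambda>v. g (i # v)) ?u)"
      by (simp add: distrib_left sum.distrib sum_distrib_left mult.assoc)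
    also have "(\<Sum>i<n. \<Sum>j<n. slot b X ?a i * slot b Y i j * g (j # ?u)) =
       (\<Sum>j<n. (\<Sum>i<n. slot b X ?a i * slot b Y i j) * g (j # ?u))"
      by (subst sum.swap) (simp add: sum_distrib_right)
    finally show ?thesis by (simp only: add.assoc)
  qed
  have "sact n (b # sg) X (sact n (b # sg) Y g) s - sact n (b # sg) Y (sact n (b # sg) X g) s =
     (\<Sum>j<n. ((\<Sum>i<n. slot b X ?a i * slot b Y i j) - (\<Sum>i<n. slot b Y ?a i * slot b X i j)) * g (j # ?u))
     + (sact n sg X (sact n sg Y (\<lambda>v. g (?a # v))) ?u - sact n sg Y (sact n sg X (\<lambda>v. g (?a # v))) ?u)"
    unfolding e by (simp add: left_diff_distrib sum_subtractf)
  also have "\<dots> = sact n (b # sg) (commutator n X Y) g s"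
    unfolding slot_commutator Cons.IH by simp
  finally show ?case .
qed simp

lemma slot_adjoint: "slot b (adjoint_mat X) i j = cnj (slot b X j i)"
  by (simp add: slot_def adjoint_mat_def)

text \<open>Factor by factor, the matrix of the conjugate transpose is the conjugate transpose of
  the matrix, for V and for its dual alike. So the standard Hermitian form is contravariant.\<close>

lemma sact_adjoint:
  "(\<Sum>s\<in>words n (length sg). cnj (h s) * sact n sg X g s) =
   (\<Sum>s\<in>words n (length sg). cnj (sact n sg (adjoint_mat X) h s) * g s)"
proof (induction sg arbitrary: g h)
  case (Cons b sg)
  let ?W = "words n (length sg)"
  have "(\<Sum>s\<in>words n (length (b # sg)). cnj (h s) * sact n (b # sg) X g s) =
    (\<Sum>a<n. \<Sum>s\<in>?W. \<Sum>i<n. cnj (h (a # s)) * (slot b X a i * g (i # s)))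
    + (\<Sum>a<n. \<Sum>s\<in>?W. cnj (h (a # s)) * sact n sg X (\<lambda>u. g (a # u)) s)"
    by (simp only: list.size add_0_right add_Suc_right sum_words_Suc sact.simps list.sel distrib_left sum.distrib sum_distrib_left)
  also have "(\<Sum>a<n. \<Sum>s\<in>?W. \<Sum>i<n. cnj (h (a # s)) * (slot b X a i * g (i # s))) =
     (\<Sum>a<n. \<Sum>i<n. \<Sum>s\<in>?W. cnj (h (a # s)) * (slot b X a i * g (i # s)))"
    by (intro sum.cong refl sum.swap)
  also have "\<dots> = (\<Sum>i<n. \<Sum>a<n. \<Sum>s\<in>?W. cnj (h (a # s)) * (slot b X a i * g (i # s)))"
    by (rule sum.swap)
  also have "\<dots> = (\<Sum>i<n. \<Sum>s\<in>?W. \<Sum>a<n. cnj (h (a # s)) * (slot b X a i * g (i # s)))"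
    by (intro sum.cong refl sum.swap)
  also have "\<dots> = (\<Sum>i<n. \<Sum>s\<in>?W. cnj (\<Sum>a<n. slot b (adjoint_mat X) i a * h (a # s)) * g (i # s))"
    by (simp add: slot_adjoint sum_distrib_left sum_distrib_right ac_simps)
  also have "(\<Sum>a<n. \<Sum>s\<in>?W. cnj (h (a # s)) * sact n sg X (\<lambda>u. g (a # u)) s) =
     (\<Sum>a<n. \<Sum>s\<in>?W. cnj (sact n sg (adjoint_mat X) (\<lambda>u. h (a # u)) s) * g (a # s))"
    by (simp only: Cons.IH)
  also have "(\<Sum>i<n. \<Sum>s\<in>?W. cnj (\<Sum>a<n. slot b (adjoint_mat X) i a * h (a # s)) * g (i # s)) + \<dots> =
     (\<Sum>s\<in>words n (length (b # sg)). cnj (sact n (b # sg) (adjoint_mat X) h s) * g s)"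
    by (simp only: list.size add_0_right add_Suc_right sum_words_Suc sact.simps list.sel distrib_right sum.distrib complex_cnj_add)
  finally show ?case .
qed simp

lemma sum_elem_mat:
  fixes g :: "nat \<Rightarrow> complex"
  assumes "i < n" "j < n"
  shows "(\<Sum>l<n. slot b (elem_mat i j) c l * g l) =
     (if b then if c = i then g j else 0 else if c = j then - g i else 0)"
proof -
  have "(\<Sum>l<n. slot b (elem_mat i j) c l * g l) =
     (\<Sum>l<n. if l = (if b then j else i) then (if b then if c = i then g j else 0 else if c = j then - g i else 0) else 0)"
    by (rule sum.cong) (auto simp: slot_def elem_mat_def)
  also have "\<dots> = (if b then if c = i then g j else 0 else if c = j then - g i else 0)"
    using assms by (subst sum.delta) auto
  finally show ?thesis .
qed

lemma sact_elem_Cons: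
  assumes "i < n" "j < n"
  shows "sact n (b # sg) (elem_mat i j) g (c # u) =
     (if b then if c = i then g (j # u) else 0 else if c = j then - g (i # u) else 0)
     + sact n sg (elem_mat i j) (\<lambda>v. g (c # v)) u"
  using assms by (simp add: sum_elem_mat[of i n j b c "\<lambda>l. g (l # u)"])

primrec sweight :: "bool list \<Rightarrow> nat list \<Rightarrow> nat \<Rightarrow> int" where
  "sweight [] s a = 0"
| "sweight (b # sg) s a = (if hd s = a then (if b then 1 else -1) else 0) + sweight sg (tl s) a"

lemma sact_diag:
  "a < n \<Longrightarrow> s \<in> words n (length sg) \<Longrightarrow> sact n sg (elem_mat a a) g s = of_int (sweight sg s a) * g s"
proof (induction sg arbitrary: g s)
  case (Cons b sg)
  then obtain c u where s: "s = c # u" "c < n" "u \<in> words n (length sg)" by auto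
  show ?case unfolding s(1) sact_elem_Cons[OF Cons.prems(1) Cons.prems(1)] Cons.IH[OF Cons.prems(1) s(3)]
    by (simp add: distrib_right)
qed simp

section \<open>Dominance and rigidity of highest weight vectors\<close>

definition shw :: "nat \<Rightarrow> bool list \<Rightarrow> (nat \<Rightarrow> int) \<Rightarrow> (nat list \<Rightarrow> complex) \<Rightarrow> bool" where
  "shw n sg w g \<longleftrightarrow> (\<forall>s\<in>words n (length sg).
     (\<forall>i j. i < j \<and> j < n \<longrightarrow> sact n sg (elem_mat i j) g s = 0) \<and>
     (\<forall>a<n. sact n sg (elem_mat a a) g s = of_int (w a) * g s))"

lemma commutator_elem:
  assumes "i < n" "j < n"
  shows "commutator n (elem_mat i j) (elem_mat j i) = (\<lambda>x y. elem_mat i i x y - elem_mat j j x y)"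
proof -
  have "mat_mult n (elem_mat i j) (elem_mat j i) x y = elem_mat i i x y" if "j < n" for x y i j
  proof -
    have "mat_mult n (elem_mat i j) (elem_mat j i) x y = (\<Sum>l<n. if l = j then elem_mat i i x y else 0)"
      unfolding mat_mult_def by (rule sum.cong) (auto simp: elem_mat_def)
    then show ?thesis using that by simp
  qed
  then show ?thesis using assms by (simp add: commutator_def fun_eq_iff)
qed

lemma sact_diff_mat:
  "sact n sg (\<lambda>x y. X x y - Y x y) g s = sact n sg X g s - sact n sg Y g s"
  using sact_mat_sum[where I = UNIV and c = "\<lambda>b. if b then 1 else -1" and M = "\<lambda>b. if b then X else Y"]
  by (simp add: UNIV_bool)

text \<open>The classical sl_2 argument. With E the raising and F the lowering operator of two
  neighbouring coordinates, |F g|^2 is the pairing of E F g with g, which equals (w a - w (a+1))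
  |g|^2. It cannot be negative.\<close>

lemma shw_dominant:
  assumes g: "shw n sg w g" and nz: "s \<in> words n (length sg)" "g s \<noteq> 0"
  shows "dominant n w"
  unfolding dominant_def
proof (intro allI impI)
  fix a assume a: "Suc a < n"
  let ?W = "words n (length sg)" and ?E = "elem_mat a (Suc a)" and ?F = "elem_mat (Suc a) a"
  have adj: "adjoint_mat ?F = ?E" by (auto simp: adjoint_mat_def elem_mat_def fun_eq_iff)
  \<comment> \<open>E annihilates \<open>g\<close>, so E F g is the commutator applied to
    \<open>g\<close>, and that is diagonal.\<close>
  have EF: "sact n sg ?E (sact n sg ?F g) s = of_int (w a - w (Suc a)) * g s" if s: "s \<in> ?W" for s
  proof -
    have "sact n sg ?F (sact n sg ?E g) s = sact n sg ?F (\<lambda>_. 0) s"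
      by (rule sact_cong) (use g s a in \<open>auto simp: shw_def\<close>)
    then have "sact n sg ?E (sact n sg ?F g) s = sact n sg (commutator n ?E ?F) g s"
      using sact_commutator[of n sg ?E ?F g s] by (simp add: sact_zero)
    also have "\<dots> = sact n sg (elem_mat a a) g s - sact n sg (elem_mat (Suc a) (Suc a)) g s"
      using a by (simp add: commutator_elem sact_diff_mat)
    also have "\<dots> = of_int (w a - w (Suc a)) * g s"
      using g s a by (simp add: shw_def left_diff_distrib)
    finally show ?thesis .
  qed
  have "(\<Sum>s\<in>?W. cnj (sact n sg ?F g s) * sact n sg ?F g s) = (\<Sum>s\<in>?W. cnj (sact n sg ?E (sact n sg ?F g) s) * g s)"
    using sact_adjoint[where n = n and sg = sg and h = "sact n sg ?F g" and X = ?F and g = g] adj by simp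
  also have "\<dots> = (\<Sum>s\<in>?W. of_int (w a - w (Suc a)) * (cnj (g s) * g s))"
    by (rule sum.cong) (simp_all add: EF)
  also have "\<dots> = of_int (w a - w (Suc a)) * (\<Sum>s\<in>?W. cnj (g s) * g s)"
    by (simp only: sum_distrib_left)
  finally have "complex_of_real (\<Sum>s\<in>?W. (cmod (sact n sg ?F g s))\<^sup>2) =
      complex_of_real (of_int (w a - w (Suc a)) * (\<Sum>s\<in>?W. (cmod (g s))\<^sup>2))"
    by (simp add: mult.commute[of "cnj _"] flip: complex_norm_square)
  then have eq: "(\<Sum>s\<in>?W. (cmod (sact n sg ?F g s))\<^sup>2) = of_int (w a - w (Suc a)) * (\<Sum>s\<in>?W. (cmod (g s))\<^sup>2)"
    using of_real_eq_iff by blast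
  have "0 < (\<Sum>s\<in>?W. (cmod (g s))\<^sup>2)"
    by (rule sum_pos2[of _ s]) (use nz finite_words in auto)
  moreover have "0 \<le> (\<Sum>s\<in>?W. (cmod (sact n sg ?F g s))\<^sup>2)" by (simp add: sum_nonneg)
  ultimately have "0 \<le> real_of_int (w a - w (Suc a))"
    unfolding eq by (simp add: zero_le_mult_iff)
  then show "w (Suc a) \<le> w a" by simp
qed

text \<open>The leading letter with a nonzero coefficient again carries a highest weight vector, so a highest
  weight vector is determined by its values on the words with dominant intermediate weights.\<close>

lemma shw_determined:
  "shw n sg w g \<Longrightarrow> (\<forall>s\<in>pathwords n sg w. g s = 0) \<Longrightarrow> s \<in> words n (length sg) \<Longrightarrow> g s = 0"
proof (induction sg arbitrary: w g s)
  case Nil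
  show ?case
  proof (cases "\<forall>a<n. w a = 0")
    case False
    then obtain a where "a < n" "w a \<noteq> 0" by blast
    then show ?thesis using Nil by (auto simp: shw_def)
  qed (use Nil in auto)
next
  case (Cons b sg)
  show ?case
  proof (cases "dominant n w")
    case False
    then show ?thesis using shw_dominant Cons.prems by blast
  next
    case dom: True
    \<comment> \<open>On the slice with leading letter c, a raising operator differs from the full
      action by one term at another leading letter: a larger one for V, a smaller one for the dual.
      If those slices vanish already, slice c satisfies the highest weight equations itself.\<close>
    have step: "g (c # u) = 0" if c: "c < n" and u: "u \<in> words n (length sg)"
      and prev: "\<And>c' v. c' < n \<Longrightarrow> (if b then c < c' else c' < c) \<Longrightarrow> v \<in> words n (length sg) \<Longrightarrow> g (c' # v) = 0" for c u
    proof (rule Cons.IH[of "shift b c w" "\<lambda>u. g (c # u)"])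
      show "u \<in> words n (length sg)" by (rule u)
      show "\<forall>s\<in>pathwords n sg (shift b c w). g (c # s) = 0"
        using Cons.prems(2) dom c by auto
      show "shw n sg (shift b c w) (\<lambda>u. g (c # u))"
        unfolding shw_def
      proof (intro ballI conjI allI impI)
        fix v i j assume v: "v \<in> words n (length sg)" and ij: "i < j \<and> j < n"
        have "c # v \<in> words n (length (b # sg))" using v c by auto
        then have "sact n (b # sg) (elem_mat i j) g (c # v) = 0"
          using Cons.prems(1) ij by (auto simp: shw_def simp del: sact.simps)
        moreover have "g (j # v) = 0" if b "c = i" using prev[of j v] that ij v by simp
        moreover have "g (i # v) = 0" if "\<not> b" "c = j" using prev[of i v] that ij v by simp
        moreover have "i < n" "j < n" using ij by auto
        ultimately show "sact n sg (elem_mat i j) (\<lambda>u. g (c # u)) v = 0"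
          by (simp add: sact_elem_Cons del: sact.simps split: if_splits)
      next
        fix v a assume v: "v \<in> words n (length sg)" and a: "a < n"
        have "c # v \<in> words n (length (b # sg))" using v c by auto
        then have "sact n (b # sg) (elem_mat a a) g (c # v) = of_int (w a) * g (c # v)"
          using Cons.prems(1) a by (auto simp: shw_def simp del: sact.simps)
        then show "sact n sg (elem_mat a a) (\<lambda>u. g (c # u)) v = of_int (shift b c w a) * g (c # v)"
          using a by (auto simp: sact_elem_Cons shift_def algebra_simps simp del: sact.simps split: if_splits)
      qed
    qed
    have all: "g (c # u) = 0" if "c < n" "u \<in> words n (length sg)" for c u
    proof (cases b)
      case True
      show ?thesis using that
      \<comment> \<open>For V the letters are treated from the largest down, for the dual from the
        smallest up.\<close>
      proof (induction "n - c" arbitrary: c u rule: less_induct)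
        case less
        show ?case by (rule step) (use less True in auto)
      qed
    next
      case False
      show ?thesis using that
      proof (induction c arbitrary: u rule: less_induct)
        case (less c)
        show ?case by (rule step) (use less False in auto)
      qed
    qed
    then show ?thesis using Cons.prems(3) by auto
  qed
qed

section \<open>The tensor power of the adjoint module as a vector space\<close>

text \<open>Scaling as a named operation, so that the vector space locale can be instantiated on
  complex-valued functions and its span, independence and dimension used.\<close>

definition scal :: "complex \<Rightarrow> ('a \<Rightarrow> complex) \<Rightarrow> 'a \<Rightarrow> complex" where
  "scal c f = (\<lambda>x. c * f x)"

interpretation fs: vector_space "scal :: complex \<Rightarrow> ('a \<Rightarrow> complex) \<Rightarrow> 'a \<Rightarrow> complex"
  by unfold_locales (auto simp: scal_def fun_eq_iff algebra_simps)

interpretation fp: vector_space_pair "scal :: complex \<Rightarrow> ('a \<Rightarrow> complex) \<Rightarrow> 'a \<Rightarrow> complex"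
  "scal :: complex \<Rightarrow> ('b \<Rightarrow> complex) \<Rightarrow> 'b \<Rightarrow> complex"
  by unfold_locales

lemma sum_fun_apply: "(\<Sum>i\<in>I. f i) x = (\<Sum>i\<in>I. f i x)"
  by (induction I rule: infinite_finite_induct) auto

lemma is_csubspace_iff: "is_csubspace W \<longleftrightarrow> fs.subspace W"
  by (simp add: is_csubspace_def fs.subspace_def scal_def plus_fun_def zero_fun_def)

lemma linearI_fun:
  assumes "\<And>f g. T (f + g) = T f + T g" "\<And>c f. T (scal c f) = scal c (T f)"
  shows "Vector_Spaces.linear scal scal T"
  using assms by unfold_locales auto

section \<open>Index words and the comparison with mixed tensors\<close>

definition idx :: "nat \<Rightarrow> nat \<Rightarrow> (nat \<times> nat) list set" where
  "idx n k = {t. valid_idx n k t}"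

lemma idx_iff: "t \<in> idx n k \<longleftrightarrow> length t = k \<and> (\<forall>x\<in>set t. fst x < n \<and> snd x < n)"
  unfolding idx_def valid_idx_def mem_Collect_eq by (metis in_set_conv_nth)

lemma valid_idx_iff: "valid_idx n k t \<longleftrightarrow> t \<in> idx n k"
  by (simp add: idx_def)

lemma idx_Cons: "x # t \<in> idx n (Suc k) \<longleftrightarrow> fst x < n \<and> snd x < n \<and> t \<in> idx n k"
  by (auto simp: idx_iff)

lemma idx_0: "idx n 0 = {[]}"
  by (auto simp: idx_iff)

lemma idx_SucE:
  assumes "t \<in> idx n (Suc k)"
  obtains a b u where "t = (a, b) # u" "a < n" "b < n" "u \<in> idx n k"
  using assms by (cases t) (auto simp: idx_iff)

text \<open>A matrix factor is V tensored with its dual, so a word of k index pairs flattens to 2k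
  letters with alternating signs.\<close>

primrec alt_signs :: "nat \<Rightarrow> bool list" where
  "alt_signs 0 = []"
| "alt_signs (Suc k) = True # False # alt_signs k"

fun pairs :: "nat list \<Rightarrow> (nat \<times> nat) list" where
  "pairs (a # b # s) = (a, b) # pairs s"
| "pairs _ = []"

primrec flat :: "(nat \<times> nat) list \<Rightarrow> nat list" where
  "flat [] = []"
| "flat (x # t) = fst x # snd x # flat t"

lemma pairs_flat: "pairs (flat t) = t"
  by (induction t) auto

lemma count_alt_signs: "count_list (alt_signs k) b = k"
  by (induction k) auto

lemma flat_idx: "t \<in> idx n k \<Longrightarrow> flat t \<in> words n (length (alt_signs k))"
proof (induction k arbitrary: t)
  case (Suc k)
  have w: "a # s \<in> words n (Suc m) \<longleftrightarrow> a < n \<and> s \<in> words n m" for a s m by auto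
  from Suc.prems show ?case
    by (rule idx_SucE) (use Suc.IH in \<open>auto simp: w simp del: words.simps\<close>)
qed (simp add: idx_0)

lemma pairs_words: "s \<in> words n (length (alt_signs k)) \<Longrightarrow> pairs s \<in> idx n k \<and> flat (pairs s) = s"
  by (induction k arbitrary: s) (auto simp: idx_0 idx_Cons)

lemma sum_idx: "(\<Sum>t\<in>idx n k. F t) = (\<Sum>s\<in>words n (length (alt_signs k)). F (pairs s))"
  by (rule sum.reindex_bij_witness[of _ pairs flat]) (auto simp: pairs_flat pairs_words flat_idx)

lemma finite_idx: "finite (idx n k)"
proof -
  have "idx n k \<subseteq> pairs ` words n (length (alt_signs k))"
    using flat_idx pairs_flat by (metis imageI subsetI)
  then show ?thesis using finite_words finite_surj by blast
qed

text \<open>Bridge between \<open>gl_act\<close>, which updates a list at a position, and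
  \<open>sact\<close>: recursion on the factors permits induction, and the pairs are still intact,
  as the trace arguments require.\<close>

primrec gact :: "nat \<Rightarrow> nat \<Rightarrow> (nat \<Rightarrow> nat \<Rightarrow> complex) \<Rightarrow> tvec \<Rightarrow> tvec" where
  "gact n 0 X f t = 0"
| "gact n (Suc k) X f t = (\<Sum>i<n. X (fst (hd t)) i * f ((i, snd (hd t)) # tl t))
     - (\<Sum>j<n. X j (snd (hd t)) * f ((fst (hd t), j) # tl t)) + gact n k X (\<lambda>u. f (hd t # u)) (tl t)"

lemma gl_act_gact: "gl_act n k X f t = (if t \<in> idx n k then gact n k X f t else 0)"
proof -
  have "(\<Sum>p<k. (\<Sum>i<n. X (fst (s!p)) i * f (s[p := (i, snd (s!p))]))
             - (\<Sum>j<n. X j (snd (s!p)) * f (s[p := (fst (s!p), j)]))) = gact n k X f s"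
    if "length s = k" for s f
    using that
  proof (induction k arbitrary: s f)
    case (Suc k)
    then obtain x u where s: "s = x # u" "length u = k" by (cases s) auto
    show ?case
      unfolding s(1) sum.lessThan_Suc_shift using Suc.IH[OF s(2), of "\<lambda>u. f (x # u)"] by simp
  qed simp
  then show ?thesis by (auto simp: gl_act_def valid_idx_iff idx_iff)
qed

lemma gact_sact:
  "length t = k \<Longrightarrow> gact n k X f t = sact n (alt_signs k) X (\<lambda>s. f (pairs s)) (flat t)"
proof (induction k arbitrary: t f)
  case (Suc k)
  then obtain x u where s: "t = x # u" "length u = k" by (cases t) auto
  show ?case
    using Suc.IH[OF s(2), of "\<lambda>u. f (x # u)"] by (simp add: s pairs_flat slot_def sum_negf)
qed simp

lemma gl_act_sact:
  "t \<in> idx n k \<Longrightarrow> gl_act n k X f t = sact n (alt_signs k) X (\<lambda>s. f (pairs s)) (flat t)"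
  by (subst gl_act_gact) (simp add: gact_sact idx_iff)

lemma gl_act_outside: "t \<notin> idx n k \<Longrightarrow> gl_act n k X f t = 0"
  by (simp add: gl_act_gact)

lemma gl_act_cong: "(\<And>t. t \<in> idx n k \<Longrightarrow> f t = g t) \<Longrightarrow> gl_act n k X f = gl_act n k X g"
proof
  fix t assume eq: "\<And>t. t \<in> idx n k \<Longrightarrow> f t = g t"
  show "gl_act n k X f t = gl_act n k X g t"
  proof (cases "t \<in> idx n k")
    case True
    then show ?thesis
      unfolding gl_act_sact[OF True] by (intro sact_cong) (auto simp: flat_idx eq pairs_words)
  qed (simp add: gl_act_outside)
qed

lemma gl_act_add: "gl_act n k X (f + g) = gl_act n k X f + gl_act n k X g"
proof
  fix t
  show "gl_act n k X (f + g) t = (gl_act n k X f + gl_act n k X g) t"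
    by (cases "t \<in> idx n k") (simp_all add: gl_act_sact gl_act_outside sact_add)
qed

lemma gl_act_scal: "gl_act n k X (scal c f) = scal c (gl_act n k X f)"
proof
  fix t
  show "gl_act n k X (scal c f) t = scal c (gl_act n k X f) t"
    by (cases "t \<in> idx n k") (simp_all add: gl_act_sact gl_act_outside sact_scale scal_def)
qed

lemma linear_gl_act: "Vector_Spaces.linear scal scal (gl_act n k X)"
  by (rule linearI_fun) (auto simp: gl_act_add gl_act_scal)

lemma gl_act_zero: "gl_act n k X 0 = 0"
  using linear_gl_act by (rule fp.linear_0)

lemma gl_act_sum: "gl_act n k X (\<Sum>i\<in>I. f i) = (\<Sum>i\<in>I. gl_act n k X (f i))"
  using linear_gl_act by (rule fp.linear_sum)

lemma gl_act_commutator: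
  "gl_act n k X (gl_act n k Y f) = gl_act n k Y (gl_act n k X f) + gl_act n k (commutator n X Y) f"
proof
  fix t
  show "gl_act n k X (gl_act n k Y f) t = (gl_act n k Y (gl_act n k X f) + gl_act n k (commutator n X Y) f) t"
  proof (cases "t \<in> idx n k")
    case True
    let ?sg = "alt_signs k" and ?f = "\<lambda>s. f (pairs s)"
    have *: "gl_act n k X (gl_act n k Y f) t = sact n ?sg X (sact n ?sg Y ?f) (flat t)" for X Y
      unfolding gl_act_sact[OF True, where f = "gl_act n k Y f"]
      by (rule sact_cong) (use True in \<open>auto simp: flat_idx gl_act_sact pairs_words\<close>)
    have "sact n ?sg X (sact n ?sg Y ?f) (flat t) - sact n ?sg Y (sact n ?sg X ?f) (flat t) =
      gl_act n k (commutator n X Y) f t"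
      unfolding gl_act_sact[OF True] by (rule sact_commutator)
    then show ?thesis
      unfolding * plus_fun_apply by (simp add: algebra_simps)
  qed (simp add: gl_act_outside)
qed

definition inner :: "nat \<Rightarrow> nat \<Rightarrow> tvec \<Rightarrow> tvec \<Rightarrow> complex" where
  "inner n k f g = (\<Sum>t\<in>idx n k. cnj (f t) * g t)"

text \<open>This is what makes the orthogonal complement of a submodule a submodule, hence the
  source of complete reducibility.\<close>

lemma inner_gl_act: "inner n k h (gl_act n k X g) = inner n k (gl_act n k (adjoint_mat X) h) g"
proof -
  let ?W = "words n (length (alt_signs k))" and ?sg = "alt_signs k"
  have "inner n k h (gl_act n k X g) = (\<Sum>s\<in>?W. cnj (h (pairs s)) * sact n ?sg X (\<lambda>s. g (pairs s)) s)"
    unfolding inner_def sum_idx by (rule sum.cong) (auto simp: gl_act_sact pairs_words)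
  also have "\<dots> = (\<Sum>s\<in>?W. cnj (sact n ?sg (adjoint_mat X) (\<lambda>s. h (pairs s)) s) * g (pairs s))"
    by (rule sact_adjoint)
  also have "\<dots> = inner n k (gl_act n k (adjoint_mat X) h) g"
    unfolding inner_def sum_idx by (rule sum.cong) (auto simp: gl_act_sact pairs_words)
  finally show ?thesis .
qed

lemma gl_act_cong_mat:
  assumes "\<And>i j. i < n \<Longrightarrow> j < n \<Longrightarrow> X i j = Y i j"
  shows "gl_act n k X f = gl_act n k Y f"
  unfolding gl_act_def using assms by (auto simp: fun_eq_iff valid_idx_def intro!: sum.cong arg_cong2[of _ _ _ _ "(-)"])

text \<open>Reduces stability under all matrices to stability under the matrix units.\<close>

lemma gl_act_elem_expand:
  "gl_act n k X f = (\<Sum>(a, b)\<in>{..<n} \<times> {..<n}. scal (X a b) (gl_act n k (elem_mat a b) f))"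
proof
  fix t
  let ?I = "{..<n} \<times> {..<n}"
  define Y where "Y = (\<lambda>i j. \<Sum>p\<in>?I. X (fst p) (snd p) * elem_mat (fst p) (snd p) i j)"
  have "Y i j = X i j" if "i < n" "j < n" for i j
  proof -
    have "Y i j = (\<Sum>p\<in>?I. if p = (i, j) then X i j else 0)"
      unfolding Y_def by (rule sum.cong) (auto simp: elem_mat_def)
    then show ?thesis using that by simp
  qed
  then have "gl_act n k X f = gl_act n k Y f" by (intro gl_act_cong_mat) simp
  then have "gl_act n k X f t = gl_act n k Y f t" by simp
  also have "gl_act n k Y f t = (\<Sum>p\<in>?I. X (fst p) (snd p) * gl_act n k (elem_mat (fst p) (snd p)) f t)"
  proof (cases "t \<in> idx n k")
    case True
    then show ?thesis unfolding gl_act_sact[OF True] Y_def by (rule_tac sact_mat_sum) simp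
  qed (simp add: gl_act_outside)
  finally show "gl_act n k X f t = (\<Sum>(a, b)\<in>?I. scal (X a b) (gl_act n k (elem_mat a b) f)) t"
    by (simp add: sum_fun_apply case_prod_unfold scal_def)
qed

lemma gl_act_diag:
  "a < n \<Longrightarrow> t \<in> idx n k \<Longrightarrow> gl_act n k (elem_mat a a) f t = of_int (sweight (alt_signs k) (flat t) a) * f t"
  by (simp add: gl_act_sact sact_diag flat_idx pairs_flat)

section \<open>Bases, dimensions and orthogonal projection\<close>

definition tens :: "nat \<Rightarrow> nat \<Rightarrow> tvec set" where
  "tens n k = {f. \<forall>t. t \<notin> idx n k \<longrightarrow> f t = 0}"

lemma tens_eqI: "f \<in> tens n k \<Longrightarrow> g \<in> tens n k \<Longrightarrow> (\<And>t. t \<in> idx n k \<Longrightarrow> f t = g t) \<Longrightarrow> f = g"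
  by (fastforce simp: tens_def fun_eq_iff)

lemma subspace_tens: "fs.subspace (tens n k)"
  by (auto simp: fs.subspace_def tens_def scal_def)

lemma gl_act_tens: "gl_act n k X f \<in> tens n k"
  by (simp add: tens_def gl_act_outside)

definition delta :: "'a \<Rightarrow> 'a \<Rightarrow> complex" where
  "delta t = (\<lambda>s. if s = t then 1 else 0)"

lemma tens_expand: "f \<in> tens n k \<Longrightarrow> f = (\<Sum>t\<in>idx n k. scal (f t) (delta t))"
proof
  fix s assume f: "f \<in> tens n k"
  have "(\<Sum>t\<in>idx n k. scal (f t) (delta t)) s = (\<Sum>t\<in>idx n k. if s = t then f t else 0)"
    by (simp add: sum_fun_apply scal_def delta_def if_distrib cong: if_cong)
  then show "f s = (\<Sum>t\<in>idx n k. scal (f t) (delta t)) s"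
    using f by (simp add: finite_idx tens_def)
qed

lemma tens_span: "tens n k \<subseteq> fs.span (delta ` idx n k)"
proof
  fix f assume "f \<in> tens n k"
  then have "f = (\<Sum>t\<in>idx n k. scal (f t) (delta t))" by (rule tens_expand)
  also have "\<dots> \<in> fs.span (delta ` idx n k)"
    by (intro fs.span_sum fs.span_scale fs.span_base) auto
  finally show "f \<in> fs.span (delta ` idx n k)" .
qed

lemma finite_independent_tens: "B \<subseteq> tens n k \<Longrightarrow> fs.independent B \<Longrightarrow> finite B"
  using fs.independent_span_bound[of "delta ` idx n k" B] tens_span finite_idx by blast

lemma tens_basis:
  assumes "fs.subspace S" "S \<subseteq> tens n k"
  obtains B where "B \<subseteq> S" "finite B" "fs.independent B" "fs.span B = S" "card B = fs.dim S"
proof -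
  obtain B where B: "B \<subseteq> S" "fs.independent B" "S \<subseteq> fs.span B" "card B = fs.dim S"
    using fs.basis_exists[of S] by blast
  moreover have "finite B" using B assms finite_independent_tens by blast
  moreover have "fs.span B = S" using B assms by (metis fs.span_minimal subset_antisym)
  ultimately show ?thesis using that by blast
qed

lemma dim_eqI: "fs.independent B \<Longrightarrow> fs.span B = S \<Longrightarrow> fs.dim S = card B"
  using fs.dim_eq_card_independent[of B] fs.dim_span[of B] by simp

lemma psubset_dim_less:
  assumes "fs.subspace S" "fs.subspace U" "U \<subset> S" "S \<subseteq> tens n k"
  shows "fs.dim U < fs.dim S"
proof -
  obtain B where B: "B \<subseteq> U" "finite B" "fs.independent B" "fs.span B = U" "card B = fs.dim U"
    using tens_basis[of U n k] assms by blast
  obtain x where x: "x \<in> S" "x \<notin> U" using assms by blast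
  have ind: "fs.independent (insert x B)" using B x fs.independent_insertI by blast
  obtain C where C: "C \<subseteq> S" "finite C" "fs.independent C" "fs.span C = S" "card C = fs.dim S"
    using tens_basis[of S n k] assms by blast
  have "card (insert x B) \<le> card C"
    using fs.independent_span_bound[OF C(2) ind] C(4) x B(1) assms by blast
  moreover have "x \<notin> B" using x B by blast
  ultimately show ?thesis using B C by simp
qed

text \<open>\<open>F\<close> maps \<open>P\<close> onto \<open>B\<close> with section
  \<open>G\<close> and kernel \<open>A\<close>, so \<open>P\<close> is the direct sum of
  \<open>A\<close> and the image of \<open>G\<close>. Finite bases are hypotheses because the
  surrounding function space may be infinite-dimensional.\<close>

lemma dim_split:
  fixes F :: "('a \<Rightarrow> complex) \<Rightarrow> 'b \<Rightarrow> complex" and G :: "('b \<Rightarrow> complex) \<Rightarrow> 'a \<Rightarrow> complex"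
  assumes lin: "Vector_Spaces.linear scal scal F" "Vector_Spaces.linear scal scal G"
    and A: "A0 \<subseteq> A" "finite A0" "fs.independent A0" "fs.span A0 = A"
    and B: "B0 \<subseteq> B" "finite B0" "fs.independent B0" "fs.span B0 = B"
    and P: "fs.subspace P"
    and maps: "\<And>f. f \<in> P \<Longrightarrow> F f \<in> B" "\<And>g. g \<in> B \<Longrightarrow> G g \<in> P" "\<And>g. g \<in> B \<Longrightarrow> F (G g) = g"
    and ker: "\<And>f. f \<in> A \<longleftrightarrow> f \<in> P \<and> F f = 0"
  shows "fs.dim P = fs.dim A + fs.dim B"
proof -
  have subB: "fs.subspace B" using B by (metis fs.subspace_span)
  have FG: "F (G g) = g" if "g \<in> B0" for g using that B maps by blast
  have injG: "inj_on G B0" using FG by (metis inj_onI)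
  have spanG: "fs.span (G ` B0) = G ` B" using fp.linear_span_image[OF lin(2), of B0] B by simp
  have dis: "A0 \<inter> G ` B0 = {}"
  proof -
    have "False" if "g \<in> B0" "G g \<in> A0" for g
    proof -
      have "F (G g) = 0" using that A ker by blast
      then have "g = 0" using FG that by simp
      then show False using B(3) that fs.dependent_zero by blast
    qed
    then show ?thesis by blast
  qed
  have indG: "fs.independent (G ` B0)"
  proof (rule fp.linear_independent_injective_image[OF lin(2) B(3)])
    show "inj_on G (fs.span B0)" using maps(3) B(4) by (metis inj_onI)
  qed
  have ind: "fs.independent (A0 \<union> G ` B0)"
  proof
    assume "fs.dependent (A0 \<union> G ` B0)"
    then obtain u v where u: "(\<Sum>x\<in>A0 \<union> G ` B0. scal (u x) x) = 0" and v: "v \<in> A0 \<union> G ` B0" "u v \<noteq> 0"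
      using fs.dependent_finite[of "A0 \<union> G ` B0"] A B by auto
    define x where "x = (\<Sum>x\<in>A0. scal (u x) x)"
    define y where "y = (\<Sum>x\<in>G ` B0. scal (u x) x)"
    have "x + y = 0" using u A B dis unfolding x_def y_def by (simp add: sum.union_disjoint)
    have "x \<in> A" unfolding x_def A(4)[symmetric] by (intro fs.span_sum fs.span_scale fs.span_base)
    have "y \<in> fs.span (G ` B0)" unfolding y_def by (intro fs.span_sum fs.span_scale fs.span_base)
    then obtain g where g: "g \<in> B" "y = G g" using spanG by blast
    have "- x \<in> A" using \<open>x \<in> A\<close> A(4) by (metis fs.span_neg)
    moreover have "- x = y" using \<open>x + y = 0\<close> by (rule minus_unique)
    ultimately have "F (G g) = 0" using g ker by metis
    then have "g = 0" using maps(3) g by simp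
    then have "y = 0" using g fp.linear_0[OF lin(2)] by simp
    then have "x = 0" using \<open>x + y = 0\<close> by simp
    have "u a = 0" if "a \<in> A0" for a
      using A(3) \<open>x = 0\<close> that fs.dependent_finite[OF A(2)] unfolding x_def by blast
    moreover have "u a = 0" if "a \<in> G ` B0" for a
      using indG \<open>y = 0\<close> that fs.dependent_finite[of "G ` B0"] B(2) unfolding y_def by blast
    ultimately show False using v by blast
  qed
  have span: "fs.span (A0 \<union> G ` B0) = P"
  proof (rule subset_antisym)
    show "fs.span (A0 \<union> G ` B0) \<subseteq> P"
      by (rule fs.span_minimal) (use A B P ker maps in auto)
    show "P \<subseteq> fs.span (A0 \<union> G ` B0)"
    proof
      fix f assume f: "f \<in> P"
      have "f - G (F f) \<in> A" using f maps fp.linear_diff[OF lin(1)] ker fs.subspace_diff[OF P] by simp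
      then have "f - G (F f) \<in> fs.span (A0 \<union> G ` B0)"
        using A(4) fs.span_mono[of A0 "A0 \<union> G ` B0"] by blast
      moreover have "G (F f) \<in> fs.span (A0 \<union> G ` B0)"
        using spanG f maps fs.span_mono[of "G ` B0" "A0 \<union> G ` B0"] by blast
      ultimately have "f - G (F f) + G (F f) \<in> fs.span (A0 \<union> G ` B0)" by (rule fs.span_add)
      then show "f \<in> fs.span (A0 \<union> G ` B0)" by simp
    qed
  qed
  have "fs.dim P = card (A0 \<union> G ` B0)" using ind span by (rule dim_eqI)
  also have "\<dots> = card A0 + card B0"
    using A B dis injG by (simp add: card_Un_disjoint card_image)
  also have "\<dots> = fs.dim A + fs.dim B" using A B dim_eqI by metis
  finally show ?thesis .
qed

text \<open>Gaussian elimination: a homogeneous system with more unknowns than equations has a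
  nonzero solution. It serves both for bounding dimensions and for producing a combination of
  contractions.\<close>

lemma fewer_equations:
  fixes M :: "'a \<Rightarrow> 'e \<Rightarrow> complex"
  assumes "finite E" "finite A" "card E < card A"
  shows "\<exists>c. (\<exists>a\<in>A. c a \<noteq> 0) \<and> (\<forall>e\<in>E. (\<Sum>a\<in>A. c a * M a e) = 0)"
  using assms
proof (induction E arbitrary: A M rule: finite_induct)
  case empty
  then obtain a where "a \<in> A" by (metis card_gt_0_iff ex_in_conv card.empty)
  then show ?case by (intro exI[of _ "\<lambda>_. 1"]) auto
next
  case (insert e E)
  show ?case
  proof (cases "\<exists>p\<in>A. M p e \<noteq> 0")
    case False
    have "card E < card A" using insert by simp
    from insert.IH[OF insert.prems(1) this, of M] obtain c
      where "\<exists>a\<in>A. c a \<noteq> 0" "\<forall>e\<in>E. (\<Sum>a\<in>A. c a * M a e) = 0" by blast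
    then show ?thesis using False by (intro exI[of _ c]) auto
  next
    case True
    then obtain p where p: "p \<in> A" "M p e \<noteq> 0" by blast
    \<comment> \<open>Subtracting multiples of the pivot row \<open>p\<close> clears equation
      \<open>e\<close>.\<close>
    define M' where "M' = (\<lambda>a x. M a x - M a e / M p e * M p x)"
    have "card E < card (A - {p})" using insert p by simp
    from insert.IH[OF _ this, of M'] insert.prems obtain c
      where c: "\<exists>a\<in>A - {p}. c a \<noteq> 0" "\<forall>x\<in>E. (\<Sum>a\<in>A - {p}. c a * M' a x) = 0" by blast
    \<comment> \<open>The value at the pivot is what makes the original sums equal to the reduced
      ones.\<close>
    define d where "d = c(p := - (\<Sum>a\<in>A - {p}. c a * (M a e / M p e)))"
    have s: "(\<Sum>a\<in>A. d a * M a x) = (\<Sum>a\<in>A - {p}. c a * M' a x)" for x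
    proof -
      have "(\<Sum>a\<in>A. d a * M a x) = d p * M p x + (\<Sum>a\<in>A - {p}. c a * M a x)"
        using p insert.prems by (subst sum.remove[of _ p]) (auto simp: d_def intro!: sum.cong)
      also have "\<dots> = (\<Sum>a\<in>A - {p}. c a * M' a x)"
        by (simp add: d_def M'_def right_diff_distrib sum_subtractf sum_distrib_right mult.assoc)
      finally show ?thesis .
    qed
    have "M' a e = 0" for a using p by (simp add: M'_def)
    then have "\<forall>x\<in>insert e E. (\<Sum>a\<in>A. d a * M a x) = 0" using c s by simp
    moreover have "\<exists>a\<in>A. d a \<noteq> 0" using c by (auto simp: d_def)
    ultimately show ?thesis by blast
  qed
qed

lemma inner_add_right: "inner n k f (g + h) = inner n k f g + inner n k f h"
  and inner_add_left: "inner n k (g + h) f = inner n k g f + inner n k h f"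
  and inner_scal_right: "inner n k f (scal c g) = c * inner n k f g"
  and inner_scal_left: "inner n k (scal c g) f = cnj c * inner n k g f"
  and inner_diff_right: "inner n k f (g - h) = inner n k f g - inner n k f h"
  and inner_zero_right: "inner n k f 0 = 0"
  and inner_zero_left: "inner n k 0 f = 0"
  by (simp_all add: inner_def scal_def distrib_left distrib_right right_diff_distrib sum.distrib
      sum_subtractf sum_distrib_left mult.assoc mult.left_commute)

lemma inner_eq_0: "inner n k f f = 0 \<Longrightarrow> f \<in> tens n k \<Longrightarrow> f = 0"
proof -
  assume 0: "inner n k f f = 0" and f: "f \<in> tens n k"
  have "complex_of_real (\<Sum>t\<in>idx n k. (cmod (f t))\<^sup>2) = inner n k f f"
    by (simp add: inner_def mult.commute[of "cnj _"] flip: complex_norm_square)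
  then have "(\<Sum>t\<in>idx n k. (cmod (f t))\<^sup>2) = 0" using 0 by (metis of_real_eq_0_iff)
  then have "\<forall>t\<in>idx n k. f t = 0" by (simp add: sum_nonneg_eq_0_iff finite_idx)
  then show "f = 0" using f by (intro tens_eqI[of f n k 0]) (auto simp: tens_def)
qed

text \<open>Gram-Schmidt, adding one generator at a time. Only its part orthogonal to the earlier
  span contributes a correction.\<close>

lemma orthogonal_projection:
  assumes "finite B" "B \<subseteq> tens n k"
  shows "\<exists>u\<in>fs.span B. \<forall>b\<in>fs.span B. inner n k b (v - u) = 0"
proof -
  have "\<exists>u\<in>fs.span B. \<forall>b\<in>B. inner n k b (v - u) = 0" for v
    using assms
  proof (induction B arbitrary: v rule: finite_induct)
    case empty
    then show ?case using fs.span_zero by blast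
  next
    case (insert x B)
    obtain y where y: "y \<in> fs.span B" "\<forall>b\<in>B. inner n k b (x - y) = 0" using insert by blast
    obtain u where u: "u \<in> fs.span B" "\<forall>b\<in>B. inner n k b (v - u) = 0" using insert by blast
    define z where "z = x - y"
    have sub: "fs.span B \<subseteq> fs.span (insert x B)" by (rule fs.span_mono[OF subset_insertI])
    have x: "x \<in> fs.span (insert x B)" by (simp add: fs.span_base)
    have zs: "z \<in> fs.span (insert x B)" unfolding z_def using x y sub by (blast intro: fs.span_diff)
    have tens: "fs.span B \<subseteq> tens n k" using insert.prems subspace_tens by (meson fs.span_minimal insert_subset)
    have "z \<in> tens n k" unfolding z_def using insert.prems y tens fs.subspace_diff[OF subspace_tens] by blast
    \<comment> \<open>The generators may be dependent; if \<open>x\<close> already lies in the span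
      of the others through \<open>z = 0\<close>, no correction is made.\<close>
    define c where "c = (if z = 0 then 0 else inner n k z (v - u) / inner n k z z)"
    have zz: "inner n k z (v - (u + scal c z)) = 0"
    proof (cases "z = 0")
      case True
      show ?thesis unfolding True by (rule inner_zero_left)
    next
      case False
      then have "inner n k z z \<noteq> 0" using inner_eq_0[OF _ \<open>z \<in> tens n k\<close>] by blast
      then show ?thesis using False
        by (simp add: c_def inner_diff_right inner_add_right inner_scal_right)
    qed
    have Bz: "inner n k b (v - (u + scal c z)) = 0" if "b \<in> B" for b
      using y u that by (simp add: z_def inner_diff_right inner_add_right inner_scal_right)
    have "inner n k w (v - (u + scal c z)) = 0" if "w \<in> fs.span B" for w
      using that
    proof (induction rule: fs.span_induct_alt)
      case base
      show ?case by (rule inner_zero_left)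
    next
      case (step c x y)
      show ?case unfolding inner_add_left inner_scal_left by (simp only: Bz step mult_zero_right add_0_left)
    qed
    then have "inner n k (z + y) (v - (u + scal c z)) = 0" using zz y by (simp add: inner_add_left)
    then have "inner n k x (v - (u + scal c z)) = 0" by (simp add: z_def)
    moreover have "u + scal c z \<in> fs.span (insert x B)"
      using u sub zs by (blast intro: fs.span_add fs.span_scale)
    ultimately show ?case using Bz by blast
  qed
  then obtain u where u: "u \<in> fs.span B" "\<forall>b\<in>B. inner n k b (v - u) = 0" by blast
  have "inner n k w (v - u) = 0" if "w \<in> fs.span B" for w
    using that
  proof (induction rule: fs.span_induct_alt)
    case base
    show ?case by (rule inner_zero_left)
  next
    case (step c x y)
    show ?case unfolding inner_add_left inner_scal_left by (simp only: u(2)[rule_format] step mult_zero_right add_0_left)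
  qed
  then show ?thesis using u by blast
qed

section \<open>The endomorphism algebra\<close>

lemma gl_act_lincomb:
  "finite I \<Longrightarrow> gl_act n k X (\<lambda>s. \<Sum>i\<in>I. c i * f i s) t = (\<Sum>i\<in>I. c i * gl_act n k X (f i) t)"
  by (cases "t \<in> idx n k") (simp_all add: gl_act_sact gl_act_outside sact_sum)

lemma gl_act_mat_diff:
  "gl_act n k (\<lambda>x y. X x y - Y x y) f = gl_act n k X f - gl_act n k Y f"
proof
  fix t
  show "gl_act n k (\<lambda>x y. X x y - Y x y) f t = (gl_act n k X f - gl_act n k Y f) t"
    by (cases "t \<in> idx n k") (simp_all add: gl_act_sact gl_act_outside sact_diff_mat)
qed

lemma mat_mult_elem:
  "b < n \<Longrightarrow> mat_mult n (elem_mat a b) (elem_mat c d) = (if b = c then elem_mat a d else (\<lambda>_ _. 0))"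
proof (intro ext)
  fix x y assume b: "b < n"
  have "mat_mult n (elem_mat a b) (elem_mat c d) x y =
      (\<Sum>l<n. if l = b then (if b = c then elem_mat a d x y else 0) else 0)"
    unfolding mat_mult_def by (rule sum.cong) (auto simp: elem_mat_def)
  then show "mat_mult n (elem_mat a b) (elem_mat c d) x y = (if b = c then elem_mat a d else (\<lambda>_ _. 0)) x y"
    using b by simp
qed

lemma gl_act_mat_zero: "gl_act n k (\<lambda>_ _. 0) f = 0"
  by (auto simp: gl_act_def fun_eq_iff)

lemma gl_act_elem_commute:
  assumes "b < n" "d < n"
  shows "gl_act n k (elem_mat a b) (gl_act n k (elem_mat c d) f) =
    gl_act n k (elem_mat c d) (gl_act n k (elem_mat a b) f)
    + ((if b = c then gl_act n k (elem_mat a d) f else 0) - (if d = a then gl_act n k (elem_mat c b) f else 0))"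
proof -
  have "commutator n (elem_mat a b) (elem_mat c d) =
     (\<lambda>x y. (if b = c then elem_mat a d else (\<lambda>_ _. 0)) x y - (if d = a then elem_mat c b else (\<lambda>_ _. 0)) x y)"
    using assms by (simp add: commutator_def mat_mult_elem fun_eq_iff)
  then show ?thesis
    unfolding gl_act_commutator[of n k "elem_mat a b"]
    by (simp only: gl_act_mat_diff gl_act_mat_zero if_distrib[where f = "\<lambda>M. gl_act n k M f"])
qed

section \<open>Highest weight spaces of the full tensor power\<close>

definition hw :: "nat \<Rightarrow> nat \<Rightarrow> (nat \<Rightarrow> int) \<Rightarrow> tvec set" where
  "hw n k w = {f \<in> tens n k. (\<forall>a b. a < b \<and> b < n \<longrightarrow> gl_act n k (elem_mat a b) f = 0) \<and>
     (\<forall>a<n. gl_act n k (elem_mat a a) f = scal (of_int (w a)) f)}"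

definition stable :: "nat \<Rightarrow> nat \<Rightarrow> tvec set \<Rightarrow> bool" where
  "stable n k S \<longleftrightarrow> fs.subspace S \<and> S \<subseteq> tens n k \<and> (\<forall>X. \<forall>f\<in>S. gl_act n k X f \<in> S)"

lemma stable_tens: "stable n k (tens n k)"
  by (simp add: stable_def subspace_tens gl_act_tens)

lemma subspace_hw: "fs.subspace (hw n k w)"
proof -
  have "scal x (f + g) = scal x f + scal x g" "scal x (scal y f) = scal y (scal x f)"
    "scal x (0 :: tvec) = 0" for x y and f g :: tvec
    by (auto simp: scal_def fun_eq_iff distrib_left)
  then show ?thesis
    unfolding fs.subspace_def hw_def
    using subspace_tens[of n k, unfolded fs.subspace_def]
    by (auto simp: gl_act_add gl_act_scal gl_act_zero)
qed

lemma hw_determined: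
  assumes f: "f \<in> hw n k w" and z: "\<forall>s\<in>pathwords n (alt_signs k) w. f (pairs s) = 0"
  shows "f = 0"
proof (rule tens_eqI[of f n k 0])
  fix t assume t: "t \<in> idx n k"
  have act: "sact n (alt_signs k) X (\<lambda>s. f (pairs s)) s = gl_act n k X f (pairs s)"
    if "s \<in> words n (length (alt_signs k))" for X s
    using that by (simp add: gl_act_sact pairs_words)
  have "shw n (alt_signs k) w (\<lambda>s. f (pairs s))"
    unfolding shw_def using f by (simp add: act hw_def scal_def)
  then have "f (pairs (flat t)) = 0"
    using z flat_idx[OF t] by (rule shw_determined)
  then show "f t = 0 t" by (simp add: pairs_flat)
qed (use f in \<open>auto simp: hw_def tens_def\<close>)

lemma hw_subset_tens: "hw n k w \<subseteq> tens n k"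
  by (auto simp: hw_def)

text \<open>Evaluation at the path words is injective on the space. A basis with more elements than
  there are path words would have a nonzero combination vanishing on all of them.\<close>

lemma dim_hw_le: "fs.dim (hw n k w) \<le> card (pathwords n (alt_signs k) w)"
proof (rule ccontr)
  assume less: "\<not> ?thesis"
  obtain B where B: "B \<subseteq> hw n k w" "finite B" "fs.independent B" "card B = fs.dim (hw n k w)"
    using tens_basis[OF subspace_hw hw_subset_tens] by metis
  obtain c where c: "\<exists>b\<in>B. c b \<noteq> 0"
    "\<forall>s\<in>pathwords n (alt_signs k) w. (\<Sum>b\<in>B. c b * b (pairs s)) = 0"
    using fewer_equations[OF finite_pathwords B(2), of n "alt_signs k" w "\<lambda>b s. b (pairs s)"] less B(4) by auto
  define f where "f = (\<Sum>b\<in>B. scal (c b) b)"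
  have "f \<in> hw n k w"
    unfolding f_def using B(1) subspace_hw by (blast intro: fs.subspace_sum fs.subspace_scale)
  moreover have "f (pairs s) = (\<Sum>b\<in>B. c b * b (pairs s))" for s
    by (simp add: f_def sum_fun_apply scal_def)
  ultimately have "f = 0" using c(2) by (intro hw_determined) auto
  then have "\<forall>b\<in>B. c b = 0" using B(3) fs.dependent_finite[OF B(2)] unfolding f_def by blast
  then show False using c(1) by blast
qed

text \<open>The value 0 beyond \<open>n\<close> makes a weight a unique function, so that weights
  can be compared by equality and form a finite set.\<close>

definition tweight :: "nat \<Rightarrow> nat \<Rightarrow> (nat \<times> nat) list \<Rightarrow> nat \<Rightarrow> int" where
  "tweight n k t a = (if a < n then sweight (alt_signs k) (flat t) a else 0)"

lemma tweight_eqI: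
  assumes "gl_act n k (elem_mat a a) f = scal (of_int x) f" "a < n" "t \<in> idx n k" "f t \<noteq> 0"
  shows "tweight n k t a = x"
proof -
  have "of_int (tweight n k t a) * f t = of_int x * f t"
    using gl_act_diag[OF assms(2,3), of f] assms by (simp add: scal_def tweight_def)
  then show ?thesis using assms(4) by simp
qed

text \<open>If two words in the support of a vector have different weights, a diagonal operator
  minus a scalar annihilates the component at one and keeps the other, which strictly shrinks the
  support inside the submodule. Induction on the size of the support ends at a weight
  vector.\<close>

lemma weight_vector_exists:
  assumes S: "stable n k S"
  shows "f \<in> S \<Longrightarrow> f \<noteq> 0 \<Longrightarrow> \<exists>g\<in>S. g \<noteq> 0 \<and> (\<exists>w\<in>tweight n k ` idx n k.
     \<forall>a<n. gl_act n k (elem_mat a a) g = scal (of_int (w a)) g)"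
proof (induction "card {t \<in> idx n k. f t \<noteq> 0}" arbitrary: f rule: less_induct)
  case less
  have f: "f \<in> tens n k" using S less.prems by (auto simp: stable_def)
  then obtain t where t: "t \<in> idx n k" "f t \<noteq> 0"
    using less.prems(2) tens_eqI[of f n k 0] by (force simp: tens_def)
  show ?case
  proof (cases "\<forall>s\<in>idx n k. f s \<noteq> 0 \<longrightarrow> (\<forall>a<n. tweight n k s a = tweight n k t a)")
    case True
    have "gl_act n k (elem_mat a a) f = scal (of_int (tweight n k t a)) f" if a: "a < n" for a
    proof (rule tens_eqI[OF gl_act_tens])
      show "scal (of_int (tweight n k t a)) f \<in> tens n k" using f by (auto simp: tens_def scal_def)
      fix s assume "s \<in> idx n k"
      then show "gl_act n k (elem_mat a a) f s = scal (of_int (tweight n k t a)) f s"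
        using True a gl_act_diag[OF a, of s k f] by (cases "f s = 0") (auto simp: scal_def tweight_def)
    qed
    then show ?thesis using less.prems t by blast
  next
    case False
    then obtain s a where s: "s \<in> idx n k" "f s \<noteq> 0" "a < n" "tweight n k s a \<noteq> tweight n k t a" by blast
    define g where "g = gl_act n k (elem_mat a a) f - scal (of_int (tweight n k t a)) f"
    have g: "g u = of_int (tweight n k u a - tweight n k t a) * f u" if "u \<in> idx n k" for u
      using gl_act_diag[OF s(3) that, of f] s(3) by (simp add: g_def scal_def tweight_def left_diff_distrib)
    have "g \<in> S" unfolding g_def using S less.prems(1)
      by (auto simp: stable_def intro!: fs.subspace_diff fs.subspace_scale)
    moreover have "g s \<noteq> 0" using s g by simp
    then have "g \<noteq> 0" by auto
    moreover have "{u \<in> idx n k. g u \<noteq> 0} \<subseteq> {u \<in> idx n k. f u \<noteq> 0}" "g t = 0" using g t by auto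
    then have "{u \<in> idx n k. g u \<noteq> 0} \<subset> {u \<in> idx n k. f u \<noteq> 0}" using t by blast
    then have "card {u \<in> idx n k. g u \<noteq> 0} < card {u \<in> idx n k. f u \<noteq> 0}"
      by (intro psubset_card_mono) (simp_all add: finite_idx)
    ultimately show ?thesis using less.hyps by blast
  qed
qed

text \<open>Among the finitely many weights of the submodule, one extremal for a suitable height
  cannot be raised.\<close>

lemma hw_exists:
  assumes S: "stable n k S" and f: "f \<in> S" "f \<noteq> 0"
  shows "\<exists>w\<in>tweight n k ` idx n k. \<exists>g\<in>S. g \<noteq> 0 \<and> g \<in> hw n k w"
proof -
  define wv where "wv = (\<lambda>w g. g \<in> S \<and> g \<noteq> 0 \<and> (\<forall>a<n. gl_act n k (elem_mat a a) g = scal (of_int (w a)) g))"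
  define W where "W = {w \<in> tweight n k ` idx n k. \<exists>g. wv w g}"
  \<comment> \<open>Raising by E_ij with i < j adds 1 in coordinate i and subtracts 1 in coordinate
    j, so it changes this height by i - j < 0. A weight of minimal height is therefore
    highest.\<close>
  define ht where "ht = (\<lambda>w :: nat \<Rightarrow> int. \<Sum>a<n. int a * w a)"
  have "finite W" by (simp add: W_def finite_idx)
  moreover have "W \<noteq> {}" using weight_vector_exists[OF S f] by (auto simp: W_def wv_def)
  ultimately obtain w where w: "w \<in> W" "\<And>v. v \<in> W \<Longrightarrow> ht w \<le> ht v"
    using arg_min_if_finite[of W ht] by (meson not_less)
  then obtain g where g: "wv w g" by (auto simp: W_def)
  have "gl_act n k (elem_mat i j) g = 0" if ij: "i < j" "j < n" for i j
  proof (rule ccontr)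
    assume nz: "gl_act n k (elem_mat i j) g \<noteq> 0"
    define h where "h = gl_act n k (elem_mat i j) g"
    define v where "v = w(i := w i + 1, j := w j - 1)"
    have hS: "h \<in> S" using S g by (auto simp: h_def stable_def wv_def)
    have wvh: "gl_act n k (elem_mat a a) h = scal (of_int (v a)) h" if a: "a < n" for a
    proof -
      have "gl_act n k (elem_mat a a) h = gl_act n k (elem_mat i j) (scal (of_int (w a)) g) +
         ((if a = i then gl_act n k (elem_mat a j) g else 0) - (if j = a then gl_act n k (elem_mat i a) g else 0))"
        using g a unfolding h_def gl_act_elem_commute[OF a ij(2)] by (simp add: wv_def)
      also have "\<dots> = scal (of_int (v a)) h"
        unfolding gl_act_scal using ij by (auto simp: h_def scal_def v_def fun_eq_iff left_diff_distrib distrib_right)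
      finally show ?thesis .
    qed
    have ht: "h \<in> tens n k" by (simp add: h_def gl_act_tens)
    obtain t where t: "t \<in> idx n k" "h t \<noteq> 0"
      using nz ht tens_eqI[of h n k 0] by (force simp: tens_def h_def)
    have "tweight n k t = v"
    proof
      fix a
      show "tweight n k t a = v a"
      proof (cases "a < n")
        case True
        then show ?thesis using tweight_eqI[OF wvh[OF True] True t] by simp
      next
        case False
        then show ?thesis using w(1) ij by (auto simp: tweight_def v_def W_def)
      qed
    qed
    then have "v \<in> W" using t wvh hS nz by (auto simp: W_def wv_def h_def)
    moreover have "ht v = ht w + (int i - int j)"
    proof -
      have "ht v - ht w = (\<Sum>a<n. int a * (v a - w a))"
        by (simp add: ht_def sum_subtractf right_diff_distrib)
      also have "\<dots> = (\<Sum>a<n. (if a = i then int i else 0) - (if a = j then int j else 0))"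
        by (rule sum.cong) (use ij in \<open>auto simp: v_def\<close>)
      also have "\<dots> = int i - int j" using ij by (simp add: sum_subtractf)
      finally show ?thesis by simp
    qed
    ultimately show False using w(2)[of v] ij by simp
  qed
  then have "g \<in> hw n k w" using g S by (auto simp: hw_def wv_def stable_def)
  then show ?thesis using g w by (auto simp: W_def wv_def)
qed

section \<open>Complements and generation by highest weight vectors\<close>

definition ortho :: "nat \<Rightarrow> nat \<Rightarrow> tvec set \<Rightarrow> tvec set \<Rightarrow> tvec set" where
  "ortho n k N S = {f \<in> S. \<forall>g\<in>N. inner n k g f = 0}"

lemma stable_ortho:
  assumes "stable n k N" "stable n k S"
  shows "stable n k (ortho n k N S)"
  unfolding stable_def
proof (intro conjI allI ballI)
  have "fs.subspace S" using assms by (simp add: stable_def)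
  then show "fs.subspace (ortho n k N S)"
    by (auto simp: fs.subspace_def ortho_def inner_zero_right inner_add_right inner_scal_right)
  show "ortho n k N S \<subseteq> tens n k" using assms by (auto simp: stable_def ortho_def)
  show "gl_act n k X f \<in> ortho n k N S" if "f \<in> ortho n k N S" for X f
    using that assms by (auto simp: stable_def ortho_def inner_gl_act)
qed

lemma ortho_decompose:
  assumes "stable n k N" "stable n k S" "N \<subseteq> S" "f \<in> S"
  shows "\<exists>u\<in>N. f - u \<in> ortho n k N S"
proof -
  have N: "fs.subspace N" "N \<subseteq> tens n k" using assms(1) by (simp_all add: stable_def)
  obtain B where B: "B \<subseteq> N" "finite B" "fs.span B = N"
    using tens_basis[OF N] by metis
  then obtain u where u: "u \<in> N" "\<forall>b\<in>N. inner n k b (f - u) = 0"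
    using orthogonal_projection[of B n k f] N by auto
  have "f - u \<in> S" using u assms by (auto simp: stable_def intro: fs.subspace_diff)
  then show ?thesis using u by (auto simp: ortho_def)
qed

lemma ortho_Int: "f \<in> N \<Longrightarrow> f \<in> ortho n k N S \<Longrightarrow> S \<subseteq> tens n k \<Longrightarrow> f = 0"
  using inner_eq_0[of n k f] by (auto simp: ortho_def)

text \<open>Were the orthogonal complement nonzero, it would contain a highest weight vector. That
  vector lies in \<open>N\<close> too, so it is orthogonal to itself.\<close>

lemma stable_contains_hw_eq_tens:
  assumes N: "stable n k N" and hwN: "\<And>w. w \<in> tweight n k ` idx n k \<Longrightarrow> hw n k w \<subseteq> N"
  shows "N = tens n k"
proof -
  let ?C = "ortho n k N (tens n k)"
  have C: "stable n k ?C" using N stable_tens by (rule stable_ortho)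
  have C0: "f = 0" if fC: "f \<in> ?C" for f
  proof (rule ccontr)
    assume "f \<noteq> 0"
    then obtain w g where g: "w \<in> tweight n k ` idx n k" "g \<in> ?C" "g \<noteq> 0" "g \<in> hw n k w"
      using hw_exists[OF C fC \<open>f \<noteq> 0\<close>] by blast
    then have "g = 0" using hwN[OF g(1)] ortho_Int[of g N n k "tens n k"] by blast
    then show False using g by simp
  qed
  have "f \<in> N" if f: "f \<in> tens n k" for f
  proof -
    obtain u where u: "u \<in> N" "f - u \<in> ?C"
      using ortho_decompose[OF N stable_tens _ f] N by (auto simp: stable_def)
    then have "f = u" using C0 by (metis eq_iff_diff_eq_0)
    then show ?thesis using u by simp
  qed
  then show ?thesis using N by (auto simp: stable_def)
qed

section \<open>Invariant kernels as endomorphisms\<close>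

definition kop :: "nat \<Rightarrow> nat \<Rightarrow> ((nat \<times> nat) list \<Rightarrow> (nat \<times> nat) list \<Rightarrow> complex) \<Rightarrow> tvec \<Rightarrow> tvec" where
  "kop n k K f s = (if s \<in> idx n k then \<Sum>t\<in>idx n k. K s t * f t else 0)"

text \<open>The entrywise form of "the operator commutes with \<open>X\<close>": on the right the
  conjugations and \<open>adjoint_mat\<close> turn the action in the variable \<open>t\<close> into
  multiplication by \<open>X\<close> from the other side.\<close>

definition invariant_kernel :: "nat \<Rightarrow> nat \<Rightarrow> ((nat \<times> nat) list \<Rightarrow> (nat \<times> nat) list \<Rightarrow> complex) \<Rightarrow> bool" where
  "invariant_kernel n k K \<longleftrightarrow> (\<forall>X. \<forall>s\<in>idx n k. \<forall>t\<in>idx n k.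
     gl_act n k X (\<lambda>s. K s t) s = cnj (gl_act n k (adjoint_mat X) (\<lambda>t. cnj (K s t)) t))"

lemma kop_equivariant:
  assumes "invariant_kernel n k K"
  shows "gl_act n k X (kop n k K f) = kop n k K (gl_act n k X f)"
proof
  fix s
  show "gl_act n k X (kop n k K f) s = kop n k K (gl_act n k X f) s"
  proof (cases "s \<in> idx n k")
    case True
    have "gl_act n k X (kop n k K f) = gl_act n k X (\<lambda>s. \<Sum>t\<in>idx n k. f t * K s t)"
      by (rule gl_act_cong) (simp add: kop_def mult.commute)
    then have "gl_act n k X (kop n k K f) s = (\<Sum>t\<in>idx n k. f t * gl_act n k X (\<lambda>s. K s t) s)"
      by (simp add: gl_act_lincomb finite_idx)
    also have "\<dots> = inner n k (gl_act n k (adjoint_mat X) (\<lambda>t. cnj (K s t))) f"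
      unfolding inner_def using assms True
      by (intro sum.cong refl) (simp add: invariant_kernel_def mult.commute)
    also have "\<dots> = inner n k (\<lambda>t. cnj (K s t)) (gl_act n k X f)" by (simp add: inner_gl_act)
    also have "\<dots> = kop n k K (gl_act n k X f) s" using True by (simp add: kop_def inner_def)
    finally show ?thesis .
  qed (simp add: gl_act_outside kop_def)
qed

lemma invariant_kernel_lincomb:
  assumes "finite I" "\<And>i. i \<in> I \<Longrightarrow> invariant_kernel n k (K i)"
  shows "invariant_kernel n k (\<lambda>s t. \<Sum>i\<in>I. c i * K i s t)"
  unfolding invariant_kernel_def
proof (intro allI ballI)
  fix X s t assume "s \<in> idx n k" "t \<in> idx n k"
  then show "gl_act n k X (\<lambda>s. \<Sum>i\<in>I. c i * K i s t) s =
     cnj (gl_act n k (adjoint_mat X) (\<lambda>t. cnj (\<Sum>i\<in>I. c i * K i s t)) t)"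
    using assms(2) by (simp add: gl_act_lincomb[OF assms(1)] invariant_kernel_def)
qed

lemma kop_add: "kop n k K (f + g) = kop n k K f + kop n k K g"
  by (auto simp: kop_def fun_eq_iff distrib_left sum.distrib)

lemma kop_scal: "kop n k K (scal c f) = scal c (kop n k K f)"
  by (auto simp: kop_def fun_eq_iff scal_def sum_distrib_left mult.left_commute)

lemma linear_kop: "Vector_Spaces.linear scal scal (kop n k K)"
  by (rule linearI_fun) (auto simp: kop_add kop_scal)

lemma kop_tens: "kop n k K f \<in> tens n k"
  by (simp add: kop_def tens_def)

lemma kop_hw:
  assumes "invariant_kernel n k K" "f \<in> hw n k w"
  shows "kop n k K f \<in> hw n k w"
  using assms(2) fp.linear_0[OF linear_kop[of n k K]]
  by (auto simp: hw_def kop_equivariant[OF assms(1)] kop_tens kop_scal)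

section \<open>Contractions indexed by permutations\<close>

definition perm_delta :: "nat \<Rightarrow> (nat \<Rightarrow> nat) \<Rightarrow> (nat \<Rightarrow> nat) \<Rightarrow> (nat \<Rightarrow> nat) \<Rightarrow> complex" where
  "perm_delta N \<sigma> x y = (if \<forall>p<N. x p = y (\<sigma> p) then 1 else 0)"

text \<open>Applying \<open>X\<close> at one end of the matched pair p and \<sigma> p, or at its
  other end, replaces the same Kronecker delta by the same entry of \<open>X\<close>.\<close>

lemma perm_delta_invariant:
  assumes \<sigma>: "\<sigma> permutes {..<N}" and x: "\<And>p. p < N \<Longrightarrow> x p < n" and y: "\<And>p. p < N \<Longrightarrow> y p < n"
  shows "(\<Sum>p<N. \<Sum>i<n. X (x p) i * perm_delta N \<sigma> (x(p := i)) y) =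
         (\<Sum>q<N. \<Sum>j<n. X j (y q) * perm_delta N \<sigma> x (y(q := j)))"
proof -
  \<comment> \<open>The common value: all deltas but the one at p, times the matrix entry joining
    its two ends.\<close>
  define R where "R = (\<lambda>p. if \<forall>p'<N. p' \<noteq> p \<longrightarrow> x p' = y (\<sigma> p') then X (x p) (y (\<sigma> p)) else 0)"
  have lt: "\<sigma> p < N" if "p < N" for p using permutes_in_image[OF \<sigma>] that by simp
  have inj: "\<sigma> p = \<sigma> q \<longleftrightarrow> p = q" for p q using permutes_inj[OF \<sigma>] by (simp add: inj_eq)
  have A: "(\<Sum>i<n. X (x p) i * perm_delta N \<sigma> (x(p := i)) y) = R p" if p: "p < N" for p
  proof -
    have "(\<Sum>i<n. X (x p) i * perm_delta N \<sigma> (x(p := i)) y) = (\<Sum>i<n. if i = y (\<sigma> p) then R p else 0)"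
      by (rule sum.cong) (use p in \<open>auto simp: perm_delta_def R_def\<close>)
    then show ?thesis using y[OF lt[OF p]] by simp
  qed
  have B: "(\<Sum>j<n. X j (y (\<sigma> p)) * perm_delta N \<sigma> x (y(\<sigma> p := j))) = R p" if p: "p < N" for p
  proof -
    have "(\<Sum>j<n. X j (y (\<sigma> p)) * perm_delta N \<sigma> x (y(\<sigma> p := j))) = (\<Sum>j<n. if j = x p then R p else 0)"
      by (rule sum.cong) (use p in \<open>auto simp: perm_delta_def R_def inj\<close>)
    then show ?thesis using x[OF p] by simp
  qed
  have "(\<Sum>q<N. \<Sum>j<n. X j (y q) * perm_delta N \<sigma> x (y(q := j))) =
     (\<Sum>p<N. \<Sum>j<n. X j (y (\<sigma> p)) * perm_delta N \<sigma> x (y(\<sigma> p := j)))"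
    using sum.permute[OF \<sigma>, of "\<lambda>q. \<Sum>j<n. X j (y q) * perm_delta N \<sigma> x (y(q := j))"] by simp
  then show ?thesis using A B by simp
qed

text \<open>An endomorphism kernel on \<open>V\<^sup>k \<otimes> V*\<^sup>k\<close> has \<open>2k\<close> indices transforming like \<open>V\<close> (\<open>up_idx\<close>)
  and \<open>2k\<close> transforming like the dual (\<open>down_idx\<close>); matching them by a permutation is invariant.\<close>

definition up_idx :: "nat \<Rightarrow> (nat \<times> nat) list \<Rightarrow> (nat \<times> nat) list \<Rightarrow> nat \<Rightarrow> nat" where
  "up_idx k s t p = (if p < k then fst (s ! p) else snd (t ! (p - k)))"

definition down_idx :: "nat \<Rightarrow> (nat \<times> nat) list \<Rightarrow> (nat \<times> nat) list \<Rightarrow> nat \<Rightarrow> nat" where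
  "down_idx k s t q = (if q < k then snd (s ! q) else fst (t ! (q - k)))"

definition perm_kernel :: "nat \<Rightarrow> (nat \<Rightarrow> nat) \<Rightarrow> (nat \<times> nat) list \<Rightarrow> (nat \<times> nat) list \<Rightarrow> complex" where
  "perm_kernel k \<sigma> s t = perm_delta (k + k) \<sigma> (up_idx k s t) (down_idx k s t)"

lemma sum_lessThan_add:
  fixes f :: "nat \<Rightarrow> 'a :: comm_monoid_add"
  shows "(\<Sum>p<k + m. f p) = (\<Sum>p<k. f p) + (\<Sum>p<m. f (k + p))"
  by (induction m) (auto simp: add.assoc)

text \<open>The input word \<open>t\<close> stands on the dual side, so its first indices behave
  like the dual and its second ones like V. Moving the \<open>t\<close>-terms of the invariance of
  \<open>perm_delta\<close> across the equation gives the intertwining condition.\<close>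

lemma invariant_perm_kernel:
  assumes \<sigma>: "\<sigma> permutes {..<k + k}"
  shows "invariant_kernel n k (perm_kernel k \<sigma>)"
  unfolding invariant_kernel_def
proof (intro allI ballI)
  fix X s t assume st: "s \<in> idx n k" "t \<in> idx n k"
  let ?x = "up_idx k s t" and ?y = "down_idx k s t"
  define A where "A = (\<lambda>p. \<Sum>i<n. X (?x p) i * perm_delta (k + k) \<sigma> (?x(p := i)) ?y)"
  define B where "B = (\<lambda>q. \<Sum>j<n. X j (?y q) * perm_delta (k + k) \<sigma> ?x (?y(q := j)))"
  have len: "length s = k" "length t = k" using st by (auto simp: idx_iff)
  have bd: "fst (s ! p) < n" "snd (s ! p) < n" "fst (t ! p) < n" "snd (t ! p) < n" if "p < k" for p
    using st that by (auto simp: idx_def valid_idx_def)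
  have "(\<Sum>p<k + k. A p) = (\<Sum>p<k + k. B p)"
    unfolding A_def B_def
    by (rule perm_delta_invariant[OF \<sigma>]) (auto simp: up_idx_def down_idx_def bd)
  then have eq: "(\<Sum>p<k. A p) + (\<Sum>p<k. A (k + p)) = (\<Sum>p<k. B p) + (\<Sum>p<k. B (k + p))"
    by (simp only: sum_lessThan_add)
  have u1: "up_idx k (s[p := (i, snd (s ! p))]) t = ?x(p := i)"
    "down_idx k (s[p := (i, snd (s ! p))]) t = ?y"
    "up_idx k (s[p := (fst (s ! p), i)]) t = ?x"
    "down_idx k (s[p := (fst (s ! p), i)]) t = ?y(p := i)" if "p < k" for p i
    using that len by (auto simp: up_idx_def down_idx_def fun_eq_iff nth_list_update)
  have u2: "up_idx k s (t[p := (i, snd (t ! p))]) = ?x"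
    "down_idx k s (t[p := (i, snd (t ! p))]) = ?y(k + p := i)"
    "up_idx k s (t[p := (fst (t ! p), i)]) = ?x(k + p := i)"
    "down_idx k s (t[p := (fst (t ! p), i)]) = ?y" if "p < k" for p i
    using that len by (auto simp: up_idx_def down_idx_def fun_eq_iff nth_list_update)
  have "gl_act n k X (\<lambda>s. perm_kernel k \<sigma> s t) s = (\<Sum>p<k. A p - B p)"
    unfolding gl_act_def using st
    by (auto simp: valid_idx_iff perm_kernel_def u1 A_def B_def up_idx_def down_idx_def intro!: sum.cong)
  moreover have "cnj (gl_act n k (adjoint_mat X) (\<lambda>t. cnj (perm_kernel k \<sigma> s t)) t) = (\<Sum>p<k. B (k + p) - A (k + p))"
    unfolding gl_act_def using st
    by (auto simp: valid_idx_iff perm_kernel_def u2 A_def B_def adjoint_mat_def up_idx_def[of k s t "k + _"]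
        down_idx_def[of k s t "k + _"] intro!: sum.cong)
  ultimately show "gl_act n k X (\<lambda>s. perm_kernel k \<sigma> s t) s =
     cnj (gl_act n k (adjoint_mat X) (\<lambda>t. cnj (perm_kernel k \<sigma> s t)) t)"
    using eq by (simp only: sum_subtractf) (simp add: diff_eq_eq algebra_simps)
qed

text \<open>A pair of words on which only the contraction for \<tau> is nonzero isolates its
  coefficient.\<close>

lemma perm_kernel_independent:
  assumes n: "k + k \<le> n" and z: "\<And>s t. s \<in> idx n k \<Longrightarrow> t \<in> idx n k \<Longrightarrow>
      (\<Sum>\<sigma>\<in>{\<sigma>. \<sigma> permutes {..<k + k}}. c \<sigma> * perm_kernel k \<sigma> s t) = 0"
    and \<tau>: "\<tau> permutes {..<k + k}"
  shows "c \<tau> = 0"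
proof -
  let ?i = "Hilbert_Choice.inv \<tau>"
  have inv: "?i permutes {..<k + k}" using \<tau> by (rule permutes_inv)
  have lt: "?i p < k + k" if "p < k + k" for p using permutes_in_image[OF inv] that by simp
  \<comment> \<open>The 2k upper indices become 0, ..., 2k - 1, all distinct since 2k \<le> n, and
    the lower ones are arranged by the inverse of \<tau>. Only \<tau> matches equal values.\<close>
  define s where "s = map (\<lambda>p. (p, ?i p)) [0..<k]"
  define t where "t = map (\<lambda>p. (?i (k + p), k + p)) [0..<k]"
  have st: "s \<in> idx n k" "t \<in> idx n k"
    using n lt by (force simp: s_def t_def idx_iff less_le_trans[OF lt])+
  have x: "up_idx k s t p = p" "down_idx k s t p = ?i p" if "p < k + k" for p
    using that by (auto simp: s_def t_def up_idx_def down_idx_def)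
  have K: "perm_kernel k \<sigma> s t = (if \<sigma> = \<tau> then 1 else 0)" if \<sigma>: "\<sigma> permutes {..<k + k}" for \<sigma>
  proof -
    have lt': "\<sigma> p < k + k" if "p < k + k" for p using permutes_in_image[OF \<sigma>] that by simp
    have "(\<forall>p<k + k. up_idx k s t p = down_idx k s t (\<sigma> p)) \<longleftrightarrow> (\<forall>p<k + k. \<sigma> p = \<tau> p)"
      using x lt' permutes_inv_eq[OF \<tau>] by (metis (no_types))
    also have "\<dots> \<longleftrightarrow> \<sigma> = \<tau>"
      using \<sigma> \<tau> by (metis (full_types) ext lessThan_iff permutes_not_in)
    finally show ?thesis by (simp add: perm_kernel_def perm_delta_def)
  qed
  have "(\<Sum>\<sigma>\<in>{\<sigma>. \<sigma> permutes {..<k + k}}. c \<sigma> * perm_kernel k \<sigma> s t) =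
      (\<Sum>\<sigma>\<in>{\<sigma>. \<sigma> permutes {..<k + k}}. if \<sigma> = \<tau> then c \<tau> else 0)"
    by (rule sum.cong) (auto simp: K)
  also have "\<dots> = c \<tau>" using \<tau> by (simp add: finite_permutations)
  finally show ?thesis using z[OF st] by simp
qed

lemma kop_delta: "s \<in> idx n k \<Longrightarrow> t \<in> idx n k \<Longrightarrow> kop n k K (delta t) s = K s t"
  by (simp add: kop_def delta_def finite_idx if_distrib cong: if_cong)

text \<open>The endomorphism algebra acts faithfully on the spaces of highest weight vectors, and an element of
  such a space is determined by its values on \<open>pathwords\<close>.\<close>

lemma fact_le_sum_dim_hw:
  assumes n: "k + k \<le> n"
  shows "fact (k + k) \<le> (\<Sum>w\<in>tweight n k ` idx n k. fs.dim (hw n k w) * card (pathwords n (alt_signs k) w))"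
proof (rule ccontr)
  let ?\<Omega> = "tweight n k ` idx n k" and ?Y = "pathwords n (alt_signs k)"
  let ?P = "{\<sigma>. \<sigma> permutes {..<k + k}}"
  assume less: "\<not> ?thesis"
  have "\<forall>w. \<exists>B. B \<subseteq> hw n k w \<and> finite B \<and> fs.span B = hw n k w \<and> card B = fs.dim (hw n k w)"
    using tens_basis[OF subspace_hw hw_subset_tens] by metis
  then obtain B where B: "\<And>w. B w \<subseteq> hw n k w" "\<And>w. finite (B w)" "\<And>w. fs.span (B w) = hw n k w"
    "\<And>w. card (B w) = fs.dim (hw n k w)" by metis
  \<comment> \<open>One linear equation for each weight, basis vector of its highest weight space
    and path word. Fewer equations than permutations would yield a nontrivial combination of
    contractions satisfying all of them.\<close>
  define E where "E = (SIGMA w:?\<Omega>. B w \<times> ?Y w)"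
  have finE: "finite E" unfolding E_def using B finite_idx finite_pathwords by blast
  have "card E = (\<Sum>w\<in>?\<Omega>. fs.dim (hw n k w) * card (?Y w))"
    unfolding E_def using B finite_idx finite_pathwords by (subst card_SigmaI) (auto simp: card_cartesian_product)
  moreover have "card ?P = fact (k + k)" by (rule card_permutations) auto
  ultimately have "card E < card ?P" using less by simp
  from fewer_equations[OF finE _ this, of "\<lambda>\<sigma> (w, b, y). kop n k (perm_kernel k \<sigma>) b (pairs y)"]
  obtain c where c: "\<exists>\<sigma>\<in>?P. c \<sigma> \<noteq> 0"
    "\<And>w b y. w \<in> ?\<Omega> \<Longrightarrow> b \<in> B w \<Longrightarrow> y \<in> ?Y w \<Longrightarrow> (\<Sum>\<sigma>\<in>?P. c \<sigma> * kop n k (perm_kernel k \<sigma>) b (pairs y)) = 0"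
    by (auto simp: finite_permutations E_def)
  define K where "K = (\<lambda>s t. \<Sum>\<sigma>\<in>?P. c \<sigma> * perm_kernel k \<sigma> s t)"
  have inv: "invariant_kernel n k K"
    unfolding K_def by (rule invariant_kernel_lincomb) (auto simp: finite_permutations invariant_perm_kernel)
  have K: "kop n k K f s = (\<Sum>\<sigma>\<in>?P. c \<sigma> * kop n k (perm_kernel k \<sigma>) f s)" for f s
  proof (cases "s \<in> idx n k")
    case True
    have "kop n k K f s = (\<Sum>t\<in>idx n k. \<Sum>\<sigma>\<in>?P. c \<sigma> * (perm_kernel k \<sigma> s t * f t))"
      using True by (simp add: kop_def K_def sum_distrib_right mult.assoc)
    also have "\<dots> = (\<Sum>\<sigma>\<in>?P. c \<sigma> * kop n k (perm_kernel k \<sigma>) f s)"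
      using True by (subst sum.swap) (simp add: kop_def sum_distrib_left)
    finally show ?thesis .
  qed (simp add: kop_def)
  \<comment> \<open>The kernel of an equivariant operator is a submodule. Containing every highest
    weight vector, it is everything, so all entries of \<open>K\<close> vanish, contradicting the
    independence of the contractions.\<close>
  define N where "N = {f \<in> tens n k. kop n k K f = 0}"
  have lin: "kop n k K 0 = 0" by (rule fp.linear_0[OF linear_kop])
  have s0: "scal x (0 :: tvec) = 0" for x by (auto simp: scal_def)
  have subN: "fs.subspace N"
    using subspace_tens[of n k] lin s0 unfolding fs.subspace_def N_def by (auto simp: kop_add kop_scal)
  have "stable n k N"
    using subN unfolding stable_def by (auto simp: N_def gl_act_tens gl_act_zero simp flip: kop_equivariant[OF inv])
  moreover have "hw n k w \<subseteq> N" if w: "w \<in> ?\<Omega>" for w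
  proof -
    have "b \<in> N" if b: "b \<in> B w" for b
    proof -
      have "kop n k K b = 0"
      proof (rule hw_determined)
        show "kop n k K b \<in> hw n k w" using B(1) b inv by (blast intro: kop_hw)
        show "\<forall>s\<in>?Y w. kop n k K b (pairs s) = 0" using c(2)[OF w b] by (simp add: K)
      qed
      moreover have "b \<in> tens n k" using B(1)[of w] b hw_subset_tens[of n k w] by blast
      ultimately show ?thesis by (simp add: N_def)
    qed
    then show ?thesis using subN B(3) by (metis fs.span_minimal subsetI)
  qed
  ultimately have N: "N = tens n k" by (rule stable_contains_hw_eq_tens)
  have "K s t = 0" if "s \<in> idx n k" "t \<in> idx n k" for s t
  proof -
    have "delta t \<in> N" unfolding N using that by (auto simp: tens_def delta_def)
    then show ?thesis using kop_delta[OF that, of K] by (simp add: N_def)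
  qed
  then have "c \<sigma> = 0" if "\<sigma> \<in> ?P" for \<sigma>
    using perm_kernel_independent[OF n, of c \<sigma>] that by (simp add: K_def)
  then show False using c(1) by blast
qed

section \<open>From \<open>gl\<^sub>n\<close> to \<open>sl\<^sub>n\<close>\<close>

lemma parts_zero:
  assumes "l \<in> parts d" "d \<le> i"
  shows "l i = 0"
proof (rule ccontr)
  assume "l i \<noteq> 0"
  obtain M where M: "\<forall>j\<ge>M. l j = 0" "sum l {..<M} = d" using parts_bound[OF assms(1)] .
  have "1 \<le> l j" if "j \<le> i" for j
    using parts_antimono[OF assms(1) that] \<open>l i \<noteq> 0\<close> by simp
  then have "(\<Sum>j\<in>{..i}. 1) \<le> sum l {..i}" by (intro sum_mono) auto
  also have "\<dots> \<le> sum l {..<M}"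
  proof (rule sum_mono2)
    show "{..i} \<subseteq> {..<M}"
      using M(1) \<open>l i \<noteq> 0\<close> by (metis atMost_iff lessThan_iff not_le order_le_less_trans subsetI)
  qed auto
  finally show False using M assms by simp
qed

section \<open>Exact multiplicities in the full tensor power\<close>

definition pair_weight :: "nat \<Rightarrow> (nat \<Rightarrow> nat) \<Rightarrow> (nat \<Rightarrow> nat) \<Rightarrow> nat \<Rightarrow> int" where
  "pair_weight n l m a = (if a < n then int (l a) - int (m (n - 1 - a)) else 0)"

lemma dominant_pair_weight:
  assumes "l \<in> parts r" "m \<in> parts s"
  shows "dominant n (pair_weight n l m)"
  unfolding dominant_def
proof (intro allI impI)
  fix a assume "Suc a < n"
  moreover have "m (n - 1 - a) \<le> m (n - 1 - Suc a)" by (rule parts_antimono[OF assms(2)]) simp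
  ultimately show "pair_weight n l m (Suc a) \<le> pair_weight n l m a"
    using parts_Suc_le[OF assms(1), of a] by (simp add: pair_weight_def)
qed

text \<open>A partition of r has at most r rows, so with 2r \<le> n the two shapes occupy disjoint
  coordinates and no cancellation hides either of them.\<close>

lemma pos_part_pair_weight:
  assumes "l \<in> parts r" "m \<in> parts r" "r + r \<le> n"
  shows "pos_part n (pair_weight n l m) = l"
proof
  fix i
  show "pos_part n (pair_weight n l m) i = l i"
  proof (cases "i < r")
    case True
    then have "m (n - 1 - i) = 0" using parts_zero[OF assms(2)] assms(3) by simp
    then show ?thesis using True assms(3) by (simp add: pos_part_def pair_weight_def)
  next
    case False
    then have "l i = 0" using parts_zero[OF assms(1)] by simp
    then show ?thesis by (simp add: pos_part_def pair_weight_def)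
  qed
qed

lemma neg_part_pair_weight:
  assumes "l \<in> parts r" "m \<in> parts r" "r + r \<le> n"
  shows "neg_part n (pair_weight n l m) = m"
proof -
  have "neg_part n (pair_weight n l m) = pos_part n (pair_weight n m l)"
    unfolding neg_part_def by (auto simp: pos_part_def dual_weight_def pair_weight_def fun_eq_iff)
  then show ?thesis using pos_part_pair_weight assms by simp
qed

text \<open>The number N of the overview: for equal numbers of both kinds of factors,
  \<open>mixed_coeff\<close> is the squared binomial times the factorial.\<close>

definition gl_mult :: "nat \<Rightarrow> nat \<Rightarrow> (nat \<Rightarrow> nat) \<Rightarrow> (nat \<Rightarrow> nat) \<Rightarrow> nat" where
  "gl_mult k r l m = mixed_coeff k k r r * npaths r l * npaths r m"

lemma card_pathwords_le:
  assumes "dominant n w" "pos_part n w \<in> parts a" "neg_part n w \<in> parts b"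
  shows "card (pathwords n (alt_signs k) w) \<le> mixed_coeff k k a b * npaths a (pos_part n w) * npaths b (neg_part n w)"
  using path_bound[of n "alt_signs k"] assms unfolding count_alt_signs path_bound_def by blast

lemma dim_hw_pair_weight_le:
  assumes "l \<in> parts r" "m \<in> parts r" "r + r \<le> n"
  shows "fs.dim (hw n k (pair_weight n l m)) \<le> gl_mult k r l m"
proof -
  have "card (pathwords n (alt_signs k) (pair_weight n l m)) \<le> gl_mult k r l m"
    using card_pathwords_le[OF dominant_pair_weight[OF assms(1,2)], where n = n and k = k and a = r and b = r] assms
    by (simp add: pos_part_pair_weight neg_part_pair_weight gl_mult_def)
  then show ?thesis using dim_hw_le order_trans by blast
qed

lemma pos_part_parts:
  assumes "dominant n w"
  shows "pos_part n w \<in> parts (sum (pos_part n w) {..<n})"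
  by (rule partsI[of _ n]) (use assms in \<open>auto simp: pos_part_def dominant_def intro!: nat_mono\<close>)

definition shape_pairs :: "nat \<Rightarrow> (nat \<times> (nat \<Rightarrow> nat) \<times> (nat \<Rightarrow> nat)) set" where
  "shape_pairs k = (SIGMA r:{..k}. parts r \<times> parts r)"

lemma finite_shape_pairs: "finite (shape_pairs k)"
  by (auto simp: shape_pairs_def finite_parts)

text \<open>Summing over both shapes gives r! twice. One binomial with r! and (k - r)! makes k!, so
  each r contributes a squared binomial times (k!)^2, and the squares add up to the central binomial
  coefficient.\<close>

lemma sum_gl_mult_squared:
  "(\<Sum>(r, l, m)\<in>shape_pairs k. gl_mult k r l m * gl_mult k r l m) = fact (k + k)"
proof -
  have "(\<Sum>(r, l, m)\<in>shape_pairs k. gl_mult k r l m * gl_mult k r l m) =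
     (\<Sum>r\<le>k. \<Sum>(l, m)\<in>parts r \<times> parts r. gl_mult k r l m * gl_mult k r l m)"
    unfolding shape_pairs_def by (subst sum.Sigma) (auto simp: finite_parts case_prod_unfold)
  also have "\<dots> = (\<Sum>r\<le>k. (k choose r)\<^sup>2 * (fact k * fact k))"
  proof (rule sum.cong)
    fix r assume "r \<in> {..k}"
    then have r: "r \<le> k" by simp
    have "(\<Sum>(l, m)\<in>parts r \<times> parts r. gl_mult k r l m * gl_mult k r l m) =
      (\<Sum>l\<in>parts r. \<Sum>m\<in>parts r. (mixed_coeff k k r r * mixed_coeff k k r r * (npaths r l * npaths r l)) * (npaths r m * npaths r m))"
      unfolding sum.cartesian_product by (rule sum.cong) (auto simp: gl_mult_def)
    also have "\<dots> = mixed_coeff k k r r * mixed_coeff k k r r * fact r * fact r"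
      by (simp only: sum_npaths_squared flip: sum_distrib_left sum_distrib_right)
    also have "\<dots> = ((k choose r) * (fact r * fact (k - r) * (k choose r)))\<^sup>2"
      using r by (simp add: mixed_coeff_def power2_eq_square)
    also have "\<dots> = (k choose r)\<^sup>2 * (fact k * fact k)"
      using binomial_fact_lemma[OF r] by (simp add: power_mult_distrib power2_eq_square)
    finally show "(\<Sum>(l, m)\<in>parts r \<times> parts r. gl_mult k r l m * gl_mult k r l m) =
      (k choose r)\<^sup>2 * (fact k * fact k)" .
  qed simp
  also have "\<dots> = (2 * k choose k) * (fact k * fact k)"
    by (simp only: choose_square_sum flip: sum_distrib_right)
  also have "\<dots> = fact (k + k)"
    unfolding mult_2[symmetric] using binomial_fact_lemma[of k "2 * k"] by (simp add: ac_simps)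
  finally show ?thesis .
qed

text \<open>Weights without path words contribute nothing. Any other weight is dominant and is
  recovered from its two parts, so the remaining sum embeds into the one over pairs of
  shapes.\<close>

lemma sum_dim_hw_le:
  assumes n: "k + k \<le> n"
  shows "(\<Sum>w\<in>tweight n k ` idx n k. fs.dim (hw n k w) * card (pathwords n (alt_signs k) w))
    \<le> (\<Sum>(r, l, m)\<in>shape_pairs k. fs.dim (hw n k (pair_weight n l m)) * gl_mult k r l m)"
proof -
  let ?Y = "pathwords n (alt_signs k)"
  define W where "W = {w \<in> tweight n k ` idx n k. ?Y w \<noteq> {}}"
  define F where "F = (\<lambda>w. (sum (pos_part n w) {..<n}, pos_part n w, neg_part n w))"
  have F: "F w \<in> shape_pairs k" "pair_weight n (pos_part n w) (neg_part n w) = w"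
    "card (?Y w) \<le> gl_mult k (sum (pos_part n w) {..<n}) (pos_part n w) (neg_part n w)" if w: "w \<in> W" for w
  proof -
    have dom: "dominant n w" using w pathwords_dominant by (auto simp: W_def)
    define a where "a = sum (pos_part n w) {..<n}"
    define b where "b = sum (neg_part n w) {..<n}"
    have pa: "pos_part n w \<in> parts a" unfolding a_def using dom by (rule pos_part_parts)
    have nb: "neg_part n w \<in> parts b"
      unfolding b_def neg_part_def by (rule pos_part_parts) (simp add: dominant_dual dom)
    have le: "card (?Y w) \<le> mixed_coeff k k a b * npaths a (pos_part n w) * npaths b (neg_part n w)"
      by (rule card_pathwords_le[OF dom pa nb])
    have "card (?Y w) \<noteq> 0" using w by (simp add: W_def finite_pathwords)
    then have "mixed_coeff k k a b \<noteq> 0" using le by (metis le_zero_eq mult_0)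
    \<comment> \<open>A nonzero coefficient forces k - a = k - b, so both parts have the same size,
      at most k.\<close>
    then have ab: "a \<le> k" "b = a" by (auto simp: mixed_coeff_def split: if_splits)
    show "F w \<in> shape_pairs k" using ab pa nb by (simp add: F_def shape_pairs_def flip: a_def)
    show "card (?Y w) \<le> gl_mult k (sum (pos_part n w) {..<n}) (pos_part n w) (neg_part n w)"
      using le ab by (simp add: gl_mult_def flip: a_def)
    have "w a = 0" if "\<not> a < n" for a using w that by (auto simp: W_def tweight_def)
    then show "pair_weight n (pos_part n w) (neg_part n w) = w"
      by (auto simp: pair_weight_def pos_part_def neg_part_def dual_weight_def fun_eq_iff)
  qed
  have "(\<Sum>w\<in>tweight n k ` idx n k. fs.dim (hw n k w) * card (?Y w)) = (\<Sum>w\<in>W. fs.dim (hw n k w) * card (?Y w))"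
    by (rule sum.mono_neutral_right) (auto simp: W_def finite_idx)
  also have "\<dots> \<le> (\<Sum>(r, l, m)\<in>shape_pairs k. fs.dim (hw n k (pair_weight n l m)) * gl_mult k r l m)"
  proof (rule sum_le_sum_inj[of _ F])
    show "inj_on F W"
    proof (rule inj_onI)
      fix v w assume vw: "v \<in> W" "w \<in> W" "F v = F w"
      then have "pos_part n v = pos_part n w" "neg_part n v = neg_part n w" by (simp_all add: F_def)
      then show "v = w" using F(2)[OF vw(1)] F(2)[OF vw(2)] by metis
    qed
    show "fs.dim (hw n k w) * card (?Y w) \<le> (case F w of (r, l, m) \<Rightarrow> fs.dim (hw n k (pair_weight n l m)) * gl_mult k r l m)"
      if "w \<in> W" for w
      unfolding F_def prod.case F(2)[OF that] by (rule mult_left_mono[OF F(3)[OF that]]) simp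
  qed (use F finite_shape_pairs in auto)
  finally show ?thesis .
qed

text \<open>A single deficit would push the sum of dimension times bound strictly below (2k)!, which
  is also its lower bound.\<close>

lemma dim_hw_pair_weight:
  assumes n: "k + k \<le> n" and r: "r \<le> k" and l: "l \<in> parts r" and m: "m \<in> parts r"
  shows "fs.dim (hw n k (pair_weight n l m)) = gl_mult k r l m"
proof (rule ccontr)
  assume neq: "\<not> ?thesis"
  let ?d = "\<lambda>(r :: nat, l, m). fs.dim (hw n k (pair_weight n l m))"
  let ?g = "\<lambda>(r, l, m). gl_mult k r l m"
  have le: "?d i \<le> ?g i" if "i \<in> shape_pairs k" for i
    using that n by (auto simp: shape_pairs_def intro!: dim_hw_pair_weight_le)
  have mem: "(r, l, m) \<in> shape_pairs k" using r l m by (simp add: shape_pairs_def)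
  then have "?d (r, l, m) < ?g (r, l, m)" using le[OF mem] neq by simp
  \<comment> \<open>Positivity is needed to keep the deficit strict after multiplication by the
    bound; a strict upper bound for a natural number is positive.\<close>
  moreover from this have "0 < ?g (r, l, m)" by linarith
  ultimately have "?d (r, l, m) * ?g (r, l, m) < ?g (r, l, m) * ?g (r, l, m)" by simp
  then have "(\<Sum>i\<in>shape_pairs k. ?d i * ?g i) < (\<Sum>i\<in>shape_pairs k. ?g i * ?g i)"
    by (intro sum_strict_mono_ex1 bexI[OF _ mem] ballI finite_shape_pairs mult_right_mono le) auto
  also have "\<dots> = fact (k + k)"
    using sum_gl_mult_squared[of k] by (simp add: case_prod_unfold)
  also have "\<dots> \<le> (\<Sum>i\<in>shape_pairs k. ?d i * ?g i)"
    using order_trans[OF fact_le_sum_dim_hw[OF n] sum_dim_hw_le[OF n]] by (simp add: case_prod_unfold)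
  finally show False by simp
qed

section \<open>Contracting and inserting a single tensor factor\<close>

primrec tr :: "nat \<Rightarrow> nat \<Rightarrow> tvec \<Rightarrow> tvec" where
  "tr n 0 f u = (\<Sum>a<n. f ((a, a) # u))"
| "tr n (Suc l) f u = tr n l (\<lambda>v. f (hd u # v)) (tl u)"

text \<open>Inserts the invariant matrix I/n as factor \<open>l\<close>; the division by n makes
  contraction of that factor a left inverse when n > 0.\<close>

primrec ins :: "nat \<Rightarrow> nat \<Rightarrow> tvec \<Rightarrow> tvec" where
  "ins n 0 g t = (if fst (hd t) = snd (hd t) then g (tl t) / of_nat n else 0)"
| "ins n (Suc l) g t = ins n l (\<lambda>v. g (hd t # v)) (tl t)"

lemma tr_add: "tr n l (\<lambda>t. f t + g t) u = tr n l f u + tr n l g u"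
  by (induction l arbitrary: f g u) (auto simp: sum.distrib)

lemma tr_scale: "tr n l (\<lambda>t. c * f t) u = c * tr n l f u"
  by (induction l arbitrary: f u) (auto simp: sum_distrib_left)

lemma tr_zero: "tr n l (\<lambda>t. 0) u = 0"
  using tr_scale[of n l 0 "\<lambda>_. 0" u] by simp

lemma tr_sum: "finite I \<Longrightarrow> tr n l (\<lambda>t. \<Sum>i\<in>I. f i t) u = (\<Sum>i\<in>I. tr n l (f i) u)"
  by (induction I rule: finite_induct) (auto simp: tr_zero tr_add)

lemma tr_diff: "tr n l (\<lambda>t. f t - g t) u = tr n l f u - tr n l g u"
  using tr_add[of n l f "\<lambda>t. (-1) * g t" u] by (simp add: tr_scale[of n l "-1" g, simplified])

lemma ins_add: "ins n l (\<lambda>t. f t + g t) u = ins n l f u + ins n l g u"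
  by (induction l arbitrary: f g u) (auto simp: add_divide_distrib)

lemma ins_scale: "ins n l (\<lambda>t. c * f t) u = c * ins n l f u"
  by (induction l arbitrary: f u) auto

lemma ins_zero: "ins n l (\<lambda>t. 0) u = 0"
  using ins_scale[of n l 0 "\<lambda>_. 0" u] by simp

lemma ins_sum: "finite I \<Longrightarrow> ins n l (\<lambda>t. \<Sum>i\<in>I. f i t) u = (\<Sum>i\<in>I. ins n l (f i) u)"
  by (induction I rule: finite_induct) (auto simp: ins_zero ins_add)

lemma ins_diff: "ins n l (\<lambda>t. f t - g t) u = ins n l f u - ins n l g u"
  using ins_add[of n l f "\<lambda>t. (-1) * g t" u] by (simp add: ins_scale[of n l "-1" g, simplified])

lemma tr_cong:
  "l \<le> k \<Longrightarrow> u \<in> idx n k \<Longrightarrow> (\<And>t. t \<in> idx n (Suc k) \<Longrightarrow> f t = g t) \<Longrightarrow> tr n l f u = tr n l g u"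
proof (induction l arbitrary: k u f g)
  case 0
  then show ?case by (auto simp: idx_Cons intro!: sum.cong)
next
  case (Suc l)
  obtain k' where k: "k = Suc k'" using Suc.prems(1) by (cases k) auto
  from Suc.prems(2)[unfolded k] obtain a b v where u: "u = (a, b) # v" "a < n" "b < n" "v \<in> idx n k'"
    by (rule idx_SucE)
  have "tr n l (\<lambda>v. f ((a, b) # v)) v = tr n l (\<lambda>v. g ((a, b) # v)) v"
    using Suc.prems u k by (intro Suc.IH[of k']) (auto simp: idx_Cons)
  then show ?case by (simp add: u)
qed

lemma ins_cong:
  "l \<le> k \<Longrightarrow> t \<in> idx n (Suc k) \<Longrightarrow> (\<And>u. u \<in> idx n k \<Longrightarrow> f u = g u) \<Longrightarrow> ins n l f t = ins n l g t"
proof (induction l arbitrary: k t f g)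
  case 0
  from 0(2) show ?case by (rule idx_SucE) (use 0(3) in auto)
next
  case (Suc l)
  obtain k' where k: "k = Suc k'" using Suc.prems(1) by (cases k) auto
  from Suc.prems(2) obtain a b v where u: "t = (a, b) # v" "a < n" "b < n" "v \<in> idx n k"
    by (rule idx_SucE)
  have "ins n l (\<lambda>v. f ((a, b) # v)) v = ins n l (\<lambda>v. g ((a, b) # v)) v"
    using Suc.prems u k by (intro Suc.IH[of k']) (auto simp: idx_Cons)
  then show ?case by (simp add: u)
qed

lemma gact_add: "gact n k X (\<lambda>t. f t + g t) t = gact n k X f t + gact n k X g t"
  by (induction k arbitrary: f g t) (auto simp: sum.distrib distrib_left)

lemma gact_scale: "gact n k X (\<lambda>t. c * f t) t = c * gact n k X f t"
  by (induction k arbitrary: f t) (auto simp: sum_distrib_left distrib_left right_diff_distrib mult.left_commute)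

lemma gact_zero: "gact n k X (\<lambda>t. 0) t = 0"
  using gact_scale[of n k X 0 "\<lambda>_. 0" t] by simp

lemma gact_sum: "finite I \<Longrightarrow> gact n k X (\<lambda>t. \<Sum>i\<in>I. f i t) u = (\<Sum>i\<in>I. gact n k X (f i) u)"
  by (induction I rule: finite_induct) (auto simp: gact_zero gact_add)

text \<open>At the contracted factor the two halves of the adjoint action have equal trace, by
  exchanging the two sums, so they cancel. The other factors are untouched.\<close>

lemma gact_tr: "l \<le> k \<Longrightarrow> gact n k X (tr n l f) u = tr n l (gact n (Suc k) X f) u"
proof (induction l arbitrary: k f u)
  case 0
  have "(\<Sum>a<n. \<Sum>i<n. X a i * f ((i, a) # u)) = (\<Sum>a<n. \<Sum>j<n. X j a * f ((a, j) # u))"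
    by (rule sum.swap)
  then have "tr n 0 (gact n (Suc k) X f) u = (\<Sum>a<n. gact n k X (\<lambda>v. f ((a, a) # v)) u)"
    by (simp add: sum.distrib sum_subtractf)
  also have "\<dots> = gact n k X (\<lambda>v. \<Sum>a<n. f ((a, a) # v)) u" by (simp add: gact_sum)
  also have "(\<lambda>v. \<Sum>a<n. f ((a, a) # v)) = tr n 0 f" by (simp add: fun_eq_iff)
  finally show ?case by simp
next
  case (Suc l)
  then obtain k' where k: "k = Suc k'" by (cases k) auto
  let ?x = "hd u" and ?v = "tl u"
  have tr: "tr n (Suc l) f (y # v) = tr n l (\<lambda>w. f (y # w)) v" for y v f by simp
  have "tr n (Suc l) (gact n (Suc k) X f) u =
     tr n l (\<lambda>v. (\<Sum>i<n. X (fst ?x) i * f ((i, snd ?x) # v)) - (\<Sum>j<n. X j (snd ?x) * f ((fst ?x, j) # v))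
        + gact n k X (\<lambda>w. f (?x # w)) v) ?v" by simp
  also have "\<dots> = (\<Sum>i<n. X (fst ?x) i * tr n l (\<lambda>v. f ((i, snd ?x) # v)) ?v)
      - (\<Sum>j<n. X j (snd ?x) * tr n l (\<lambda>v. f ((fst ?x, j) # v)) ?v) + tr n l (gact n k X (\<lambda>w. f (?x # w))) ?v"
    by (simp add: tr_add tr_diff tr_sum tr_scale)
  also have "tr n l (gact n k X (\<lambda>w. f (?x # w))) ?v = gact n k' X (tr n l (\<lambda>w. f (?x # w))) ?v"
    unfolding k by (rule Suc.IH[symmetric]) (use Suc.prems k in simp)
  finally show ?case unfolding k by simp
qed

text \<open>The adjoint action annihilates the inserted identity matrix, because it commutes with
  \<open>X\<close>.\<close>

lemma gact_ins: "l \<le> k \<Longrightarrow> t \<in> idx n (Suc k) \<Longrightarrow> gact n (Suc k) X (ins n l g) t = ins n l (gact n k X g) t"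
proof (induction l arbitrary: k g t)
  case 0
  from 0(2) obtain a b u where t: "t = (a, b) # u" "a < n" "b < n" "u \<in> idx n k" by (rule idx_SucE)
  have "(\<Sum>i<n. X a i * (if i = b then g u / of_nat n else 0)) = (\<Sum>i<n. if i = b then X a b * (g u / of_nat n) else 0)"
    by (rule sum.cong) auto
  moreover have "(\<Sum>j<n. X j b * (if a = j then g u / of_nat n else 0)) = (\<Sum>j<n. if j = a then X a b * (g u / of_nat n) else 0)"
    by (rule sum.cong) auto
  moreover have "gact n k X (\<lambda>v. if a = b then g v / of_nat n else 0) u = (if a = b then gact n k X g u / of_nat n else 0)"
    using gact_scale[of n k X "1 / of_nat n" g u] by (simp add: gact_zero)
  ultimately show ?case
    using t(2,3) unfolding t(1) gact.simps ins.simps list.sel fst_conv snd_conv by simp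
next
  case (Suc l)
  then obtain k' where k: "k = Suc k'" by (cases k) auto
  from Suc.prems(2) obtain a b v where t: "t = (a, b) # v" "a < n" "b < n" "v \<in> idx n k" by (rule idx_SucE)
  have "ins n (Suc l) (gact n k X g) t =
     ins n l (\<lambda>v. (\<Sum>i<n. X a i * g ((i, b) # v)) - (\<Sum>j<n. X j b * g ((a, j) # v)) + gact n k' X (\<lambda>w. g ((a, b) # w)) v) v"
    by (simp add: t k)
  also have "\<dots> = (\<Sum>i<n. X a i * ins n l (\<lambda>v. g ((i, b) # v)) v)
      - (\<Sum>j<n. X j b * ins n l (\<lambda>v. g ((a, j) # v)) v) + ins n l (gact n k' X (\<lambda>w. g ((a, b) # w))) v"
    by (simp add: ins_add ins_diff ins_sum ins_scale)
  also have "ins n l (gact n k' X (\<lambda>w. g ((a, b) # w))) v = gact n k X (ins n l (\<lambda>w. g ((a, b) # w))) v"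
    unfolding k by (rule Suc.IH[symmetric]) (use Suc.prems k t in auto)
  finally show ?case by (simp add: t)
qed

lemma tr_ins: "n > 0 \<Longrightarrow> l \<le> length u \<Longrightarrow> tr n l (ins n l g) u = g u"
  by (induction l arbitrary: g u) (auto simp: neq_Nil_conv Suc_le_length_iff)

text \<open>Contractions at different factors commute; once factor m has gone, the factor formerly
  at l + 1 stands at l.\<close>

lemma tr_tr: "m \<le> l \<Longrightarrow> tr n m (tr n (Suc l) f) u = tr n l (tr n m f) u"
proof (induction m arbitrary: l f u)
  case 0
  have "tr n l (tr n 0 f) u = tr n l (\<lambda>v. \<Sum>a<n. f ((a, a) # v)) u"
    by (rule arg_cong[where f = "\<lambda>h. tr n l h u"]) (simp add: fun_eq_iff)
  then show ?case by (simp add: tr_sum)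
next
  case (Suc m)
  then obtain l' where l: "l = Suc l'" by (cases l) auto
  have "tr n m (tr n (Suc l') (\<lambda>v. f (hd u # v))) (tl u) = tr n l' (tr n m (\<lambda>v. f (hd u # v))) (tl u)"
    by (rule Suc.IH) (use Suc.prems l in simp)
  moreover have "tr n (Suc m) (tr n (Suc l) f) u = tr n m (tr n (Suc l') (\<lambda>v. f (hd u # v))) (tl u)"
  proof -
    have "(\<lambda>v. tr n (Suc (Suc l')) f (hd u # v)) = tr n (Suc l') (\<lambda>v. f (hd u # v))"
      by (rule ext) simp
    then show ?thesis unfolding l tr.simps(2)[of n m] by simp
  qed
  moreover have "tr n l (tr n (Suc m) f) u = tr n l' (tr n m (\<lambda>v. f (hd u # v))) (tl u)"
    unfolding l by simp
  ultimately show ?case by (simp only:)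
qed

text \<open>The inserted factor stands to the right of the contracted one and moves one place to the
  left when that disappears. Insertion therefore preserves tracelessness in the earlier
  factors.\<close>

lemma tr_ins_Suc: "m \<le> l \<Longrightarrow> tr n m (ins n (Suc l) g) u = ins n l (tr n m g) u"
proof (induction m arbitrary: l g u)
  case 0
  have "ins n l (tr n 0 g) u = ins n l (\<lambda>v. \<Sum>a<n. g ((a, a) # v)) u"
    by (rule arg_cong[where f = "\<lambda>h. ins n l h u"]) (simp add: fun_eq_iff)
  then show ?case by (simp add: ins_sum)
next
  case (Suc m)
  then obtain l' where l: "l = Suc l'" by (cases l) auto
  have "tr n m (ins n (Suc l') (\<lambda>v. g (hd u # v))) (tl u) = ins n l' (tr n m (\<lambda>v. g (hd u # v))) (tl u)"
    by (rule Suc.IH) (use Suc.prems l in simp)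
  moreover have "tr n (Suc m) (ins n (Suc l) g) u = tr n m (ins n (Suc l') (\<lambda>v. g (hd u # v))) (tl u)"
  proof -
    have "(\<lambda>v. ins n (Suc (Suc l')) g (hd u # v)) = ins n (Suc l') (\<lambda>v. g (hd u # v))"
      by (rule ext) simp
    then show ?thesis unfolding l tr.simps(2)[of n m] by simp
  qed
  moreover have "ins n l (tr n (Suc m) g) u = ins n l' (tr n m (\<lambda>v. g (hd u # v))) (tl u)"
    unfolding l by simp
  ultimately show ?case by (simp only:)
qed

lemma tr_eq_sum: "l \<le> length u \<Longrightarrow> tr n l f u = (\<Sum>a<n. f (take l u @ (a, a) # drop l u))"
proof (induction l arbitrary: f u)
  case (Suc l)
  then obtain x v where "u = x # v" "l \<le> length v" by (cases u) auto
  then show ?case using Suc.IH by simp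
qed simp

text \<open>The cut-off outside valid words makes the result an element of \<open>tens\<close>; the
  recursive \<open>tr\<close> and \<open>ins\<close> carry no such guarantee.\<close>

definition contraction :: "nat \<Rightarrow> nat \<Rightarrow> nat \<Rightarrow> tvec \<Rightarrow> tvec" where
  "contraction n k l f u = (if u \<in> idx n k then tr n l f u else 0)"

definition insertion :: "nat \<Rightarrow> nat \<Rightarrow> nat \<Rightarrow> tvec \<Rightarrow> tvec" where
  "insertion n k l g t = (if t \<in> idx n (Suc k) then ins n l g t else 0)"

lemma contraction_add: "contraction n k l (f + g) = contraction n k l f + contraction n k l g"
  by (rule ext) (simp add: contraction_def tr_add plus_fun_def)

lemma contraction_scal: "contraction n k l (scal c f) = scal c (contraction n k l f)"
  by (rule ext) (simp add: contraction_def scal_def tr_scale)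

lemma insertion_add: "insertion n k l (f + g) = insertion n k l f + insertion n k l g"
  by (rule ext) (simp add: insertion_def ins_add plus_fun_def)

lemma insertion_scal: "insertion n k l (scal c f) = scal c (insertion n k l f)"
  by (rule ext) (simp add: insertion_def scal_def ins_scale)

lemma linear_contraction: "Vector_Spaces.linear scal scal (contraction n k l)"
  by (rule linearI_fun) (simp_all only: contraction_add contraction_scal)

lemma linear_insertion: "Vector_Spaces.linear scal scal (insertion n k l)"
  by (rule linearI_fun) (simp_all only: insertion_add insertion_scal)

lemma gl_act_contraction:
  assumes "l \<le> k"
  shows "gl_act n k X (contraction n k l f) = contraction n k l (gl_act n (Suc k) X f)"
proof
  fix u
  show "gl_act n k X (contraction n k l f) u = contraction n k l (gl_act n (Suc k) X f) u"
  proof (cases "u \<in> idx n k")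
    case True
    have "gl_act n k X (contraction n k l f) = gl_act n k X (tr n l f)"
      by (rule gl_act_cong) (simp add: contraction_def)
    then have "gl_act n k X (contraction n k l f) u = tr n l (gact n (Suc k) X f) u"
      using True gact_tr[OF assms] by (simp add: gl_act_gact)
    also have "\<dots> = tr n l (gl_act n (Suc k) X f) u"
      using assms True by (rule tr_cong) (simp only: gl_act_gact if_True)
    finally show ?thesis using True by (simp add: contraction_def)
  qed (simp add: gl_act_outside contraction_def)
qed

lemma gl_act_insertion:
  assumes "l \<le> k"
  shows "gl_act n (Suc k) X (insertion n k l g) = insertion n k l (gl_act n k X g)"
proof
  fix t
  show "gl_act n (Suc k) X (insertion n k l g) t = insertion n k l (gl_act n k X g) t"
  proof (cases "t \<in> idx n (Suc k)")
    case True
    have "gl_act n (Suc k) X (insertion n k l g) = gl_act n (Suc k) X (ins n l g)"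
      by (rule gl_act_cong) (simp add: insertion_def)
    then have "gl_act n (Suc k) X (insertion n k l g) t = gact n (Suc k) X (ins n l g) t"
      using True by (simp only: gl_act_gact if_True)
    also have "\<dots> = ins n l (gact n k X g) t" by (rule gact_ins[OF assms True])
    also have "\<dots> = ins n l (gl_act n k X g) t"
      using assms True by (rule ins_cong) (simp only: gl_act_gact if_True)
    finally show ?thesis using True by (simp add: insertion_def)
  qed (simp add: gl_act_outside insertion_def)
qed

section \<open>Partially traceless tensors\<close>

definition traceless :: "nat \<Rightarrow> nat \<Rightarrow> nat \<Rightarrow> tvec set" where
  "traceless n k l = {f \<in> tens n k. \<forall>m<l. \<forall>u\<in>idx n (k - 1). tr n m f u = 0}"

lemma subspace_traceless: "fs.subspace (traceless n k l)"
  using subspace_tens[of n k]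
  by (auto simp: fs.subspace_def traceless_def tr_add tr_scale tr_zero plus_fun_def zero_fun_def scal_def)

lemma sl_tensor_traceless: "sl_tensor n k = traceless n k k"
proof (intro equalityI subsetI)
  fix f assume f: "f \<in> sl_tensor n k"
  have "tr n m f u = 0" if m: "m < k" and u: "u \<in> idx n (k - 1)" for m u
  proof (cases "n = 0")
    case True
    then show ?thesis using m u by (subst tr_eq_sum) (auto simp: idx_iff)
  next
    case False
    \<comment> \<open>The pair (0, 0) is a placeholder that the trace overwrites; it is a valid
      index because n is nonzero here.\<close>
    define t where "t = take m u @ (0, 0) # drop m u"
    have len: "length u = k - 1" using u by (simp add: idx_iff)
    have "t \<in> idx n k"
      using u m False by (auto simp: t_def idx_iff dest: in_set_takeD in_set_dropD)
    then have "(\<Sum>a<n. f (t[m := (a, a)])) = 0" using f m by (simp add: sl_tensor_def idx_def)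
    moreover have "t[m := (a, a)] = take m u @ (a, a) # drop m u" for a
      using len m by (simp add: t_def list_update_append)
    ultimately show ?thesis using len m by (simp add: tr_eq_sum)
  qed
  then show "f \<in> traceless n k k" using f by (simp add: sl_tensor_def traceless_def tens_def idx_def)
next
  fix f assume f: "f \<in> traceless n k k"
  have "(\<Sum>a<n. f (t[p := (a, a)])) = 0" if t: "t \<in> idx n k" and p: "p < k" for t p
  proof -
    have len: "length t = k" using t by (simp add: idx_iff)
    define u where "u = take p t @ drop (Suc p) t"
    have u: "u \<in> idx n (k - 1)"
      using t p by (auto simp: u_def idx_iff dest: in_set_takeD in_set_dropD)
    have "t[p := (a, a)] = take p u @ (a, a) # drop p u" for a
      using len p by (simp add: u_def upd_conv_take_nth_drop)
    then have "(\<Sum>a<n. f (t[p := (a, a)])) = tr n p f u"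
      using len p u by (simp add: tr_eq_sum idx_iff)
    then show ?thesis using f u p by (simp add: traceless_def)
  qed
  then show "f \<in> sl_tensor n k" using f by (simp add: sl_tensor_def traceless_def tens_def idx_def)
qed

lemma linear_hw:
  assumes "Vector_Spaces.linear scal scal F" "\<And>X f. gl_act n k' X (F f) = F (gl_act n k X f)"
    and "\<And>f. F f \<in> tens n k'" "f \<in> hw n k w"
  shows "F f \<in> hw n k' w"
  using assms(3,4) fp.linear_0[OF assms(1)] fp.linear_scale[OF assms(1)]
  by (auto simp: hw_def assms(2))

text \<open>The spaces \<open>traceless n k l\<close> run from the full power of gl_n at l = 0 to
  that of sl_n at l = k. Contracting factor l maps the l-th space for k + 1 factors onto the l-th
  space for k factors, with kernel the next space of the chain; insertion is a section and both maps
  are equivariant.\<close>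

lemma dim_traceless_step:
  assumes n: "n > 0" and l: "l \<le> k"
  shows "fs.dim (hw n (Suc k) w \<inter> traceless n (Suc k) l) =
    fs.dim (hw n (Suc k) w \<inter> traceless n (Suc k) (Suc l)) + fs.dim (hw n k w \<inter> traceless n k l)"
proof -
  let ?P = "hw n (Suc k) w \<inter> traceless n (Suc k) l"
  let ?A = "hw n (Suc k) w \<inter> traceless n (Suc k) (Suc l)"
  let ?B = "hw n k w \<inter> traceless n k l"
  have sub: "fs.subspace (hw n k w \<inter> traceless n k l)" "hw n k w \<inter> traceless n k l \<subseteq> tens n k" for k l
    using fs.subspace_inter[OF subspace_hw subspace_traceless] hw_subset_tens by blast+
  obtain A0 where A0: "A0 \<subseteq> ?A" "finite A0" "fs.independent A0" "fs.span A0 = ?A"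
    using tens_basis[OF sub] by metis
  obtain B0 where B0: "B0 \<subseteq> ?B" "finite B0" "fs.independent B0" "fs.span B0 = ?B"
    using tens_basis[OF sub] by metis
  show ?thesis
  proof (rule dim_split[OF linear_contraction[of n k l] linear_insertion[of n k l] A0 B0 sub(1)])
    fix f assume f: "f \<in> ?P"
    have "contraction n k l f \<in> hw n k w"
      by (rule linear_hw[OF linear_contraction gl_act_contraction[OF l]])
        (use f in \<open>auto simp: tens_def contraction_def\<close>)
    moreover have "tr n m (contraction n k l f) u = 0" if m: "m < l" and u: "u \<in> idx n (k - 1)" for m u
    proof -
      obtain k' l' where k: "k = Suc k'" "l = Suc l'" using m l by (cases k; cases l) auto
      have "tr n m (contraction n k l f) u = tr n m (tr n l f) u"
        using m l k u by (intro tr_cong[of _ k']) (auto simp: contraction_def)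
      also have "\<dots> = tr n l' (tr n m f) u" unfolding k using m k by (intro tr_tr) simp
      also have "\<dots> = tr n l' (\<lambda>_. 0) u"
        using f m l k u by (intro tr_cong[of _ k']) (auto simp: traceless_def)
      finally show ?thesis by (simp add: tr_zero)
    qed
    ultimately show "contraction n k l f \<in> ?B" by (auto simp: traceless_def tens_def contraction_def)
  next
    fix g assume g: "g \<in> ?B"
    have "insertion n k l g \<in> hw n (Suc k) w"
      by (rule linear_hw[OF linear_insertion gl_act_insertion[OF l]])
        (use g in \<open>auto simp: tens_def insertion_def\<close>)
    moreover have "tr n m (insertion n k l g) u = 0" if m: "m < l" and u: "u \<in> idx n k" for m u
    proof -
      obtain k' l' where k: "k = Suc k'" "l = Suc l'" using m l by (cases k; cases l) auto
      have "tr n m (insertion n k l g) u = tr n m (ins n l g) u"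
        using m l u by (intro tr_cong[of _ k]) (auto simp: insertion_def)
      also have "\<dots> = ins n l' (tr n m g) u" unfolding k using m k by (intro tr_ins_Suc) simp
      also have "\<dots> = ins n l' (\<lambda>_. 0) u"
        using g m l k u by (intro ins_cong[of _ k']) (auto simp: traceless_def)
      finally show ?thesis by (simp add: ins_zero)
    qed
    ultimately show "insertion n k l g \<in> ?P" by (auto simp: traceless_def tens_def insertion_def)
    show "contraction n k l (insertion n k l g) = g"
    proof
      fix u
      show "contraction n k l (insertion n k l g) u = g u"
      proof (cases "u \<in> idx n k")
        case True
        then have "contraction n k l (insertion n k l g) u = tr n l (ins n l g) u"
          using l by (simp add: contraction_def) (rule tr_cong[of _ k], auto simp: insertion_def)
        then show ?thesis using True l n by (simp add: tr_ins idx_iff)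
      next
        case False
        then show ?thesis using g by (auto simp: contraction_def traceless_def tens_def)
      qed
    qed
  next
    fix f
    show "f \<in> ?A \<longleftrightarrow> f \<in> ?P \<and> contraction n k l f = 0"
      by (auto simp: traceless_def less_Suc_eq contraction_def fun_eq_iff)
  qed
qed

text \<open>Pascal's rule in the form that matches the recursion of
  \<open>dim_traceless_step\<close>: the l-th difference of a sequence minus that of the shifted
  sequence is the next difference.\<close>

lemma alternating_binomial_Suc:
  fixes a :: "nat \<Rightarrow> int"
  shows "(\<Sum>j\<le>Suc l. (-1)^j * int (Suc l choose j) * a j) =
    (\<Sum>j\<le>l. (-1)^j * int (l choose j) * a j) - (\<Sum>j\<le>l. (-1)^j * int (l choose j) * a (Suc j))"
proof -
  have "(\<Sum>j\<le>Suc l. (-1)^j * int (Suc l choose j) * a j) =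
     a 0 + (\<Sum>j\<le>l. (-1)^Suc j * int (l choose Suc j) * a (Suc j)) - (\<Sum>j\<le>l. (-1)^j * int (l choose j) * a (Suc j))"
  proof -
    have "(-1)^Suc j * int (Suc l choose Suc j) * a (Suc j) =
        (-1)^Suc j * int (l choose Suc j) * a (Suc j) - (-1)^j * int (l choose j) * a (Suc j)" for j
      by (simp add: algebra_simps)
    then show ?thesis unfolding sum.atMost_Suc_shift by (simp add: sum_subtractf del: binomial_Suc_Suc power_Suc)
  qed
  also have "a 0 + (\<Sum>j\<le>l. (-1)^Suc j * int (l choose Suc j) * a (Suc j)) = (\<Sum>j\<le>Suc l. (-1)^j * int (l choose j) * a j)"
    by (simp add: sum.atMost_Suc_shift del: sum.atMost_Suc)
  also have "\<dots> = (\<Sum>j\<le>l. (-1)^j * int (l choose j) * a j)" by simp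
  finally show ?thesis .
qed

lemma dim_traceless:
  assumes n: "n > 0"
  shows "l \<le> k \<Longrightarrow> int (fs.dim (hw n k w \<inter> traceless n k l)) =
     (\<Sum>j\<le>l. (-1)^j * int (l choose j) * int (fs.dim (hw n (k - j) w)))"
proof (induction l arbitrary: k)
  case 0
  have "hw n k w \<inter> traceless n k 0 = hw n k w" using hw_subset_tens by (auto simp: traceless_def)
  then show ?case by simp
next
  case (Suc l)
  then obtain k' where k: "k = Suc k'" "l \<le> k'" by (cases k) auto
  have "int (fs.dim (hw n k w \<inter> traceless n k (Suc l))) =
     int (fs.dim (hw n k w \<inter> traceless n k l)) - int (fs.dim (hw n k' w \<inter> traceless n k' l))"
    using dim_traceless_step[OF n k(2), of w] k(1) by simp
  also have "\<dots> = (\<Sum>j\<le>Suc l. (-1)^j * int (Suc l choose j) * int (fs.dim (hw n (k - j) w)))"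
    unfolding alternating_binomial_Suc using Suc.IH[of k] Suc.IH[of k'] k by simp
  finally show ?case .
qed

text \<open>The alternating sum of the known dimensions for k - j factors. Each of them satisfies
  the size condition, since 2(k - j) \<le> n.\<close>

lemma dim_hw_sl:
  assumes n: "2 * k \<le> n" and r: "r \<le> k" and l: "l \<in> parts r" and m: "m \<in> parts r"
  shows "int (fs.dim (hw n k (pair_weight n l m) \<inter> sl_tensor n k)) = int (npaths r l * npaths r m) *
     (\<Sum>j=0..k-r. (-1)^j * int (k choose j) * int ((k-j) choose r)^2 * int (fact (k-r-j)))"
proof -
  have dim: "fs.dim (hw n (k - j) (pair_weight n l m)) =
      (if r \<le> k - j then npaths r l * npaths r m * ((k - j) choose r)^2 * fact (k - r - j) else 0)" if "j \<le> k" for j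
  proof (cases "r \<le> k - j")
    case True
    then have "fs.dim (hw n (k - j) (pair_weight n l m)) = gl_mult (k - j) r l m"
      by (intro dim_hw_pair_weight l m) (use n in auto)
    moreover have "k - r - j = k - j - r" by simp
    ultimately show ?thesis using True by (simp add: gl_mult_def mixed_coeff_def power2_eq_square)
  next
    case False
    \<comment> \<open>When fewer than r factors remain the bound is 0, which truncates the sum at j
      = k - r.\<close>
    have "fs.dim (hw n (k - j) (pair_weight n l m)) \<le> gl_mult (k - j) r l m"
      by (rule dim_hw_pair_weight_le) (use n r l m in auto)
    then show ?thesis using False by (simp add: gl_mult_def mixed_coeff_def)
  qed
  have main: "int (fs.dim (hw n k (pair_weight n l m) \<inter> sl_tensor n k)) =
     (\<Sum>j\<le>k. (-1)^j * int (k choose j) * int (fs.dim (hw n (k - j) (pair_weight n l m))))"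
  \<comment> \<open>The section I/n needs n > 0; for n = 0 the hypothesis forces k = 0, where there
    is no factor to contract.\<close>
  proof (cases "n = 0")
    case True
    then have "k = 0" using n by simp
    moreover have "hw n 0 w \<inter> sl_tensor n 0 = hw n 0 w" for w
      using hw_subset_tens by (auto simp: sl_tensor_traceless traceless_def)
    ultimately show ?thesis by simp
  next
    case False
    then show ?thesis unfolding sl_tensor_traceless by (intro dim_traceless) auto
  qed
  also have "\<dots> = (\<Sum>j=0..k-r. (-1)^j * int (k choose j) * int (fs.dim (hw n (k - j) (pair_weight n l m))))"
    by (rule sum.mono_neutral_right) (use r dim in auto)
  also have "\<dots> = (\<Sum>j=0..k-r. int (npaths r l * npaths r m) *
     ((-1)^j * int (k choose j) * int ((k-j) choose r)^2 * int (fact (k-r-j))))"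
    by (rule sum.cong) (use r dim in auto)
  finally show ?thesis by (simp add: sum_distrib_left)
qed

section \<open>Irreducible components\<close>

lemma sl_tensor_subset_tens: "sl_tensor n k \<subseteq> tens n k"
  by (auto simp: sl_tensor_traceless traceless_def)

lemma traceless_Suc_iff:
  "f \<in> traceless n (Suc k) l \<longleftrightarrow> f \<in> tens n (Suc k) \<and> (\<forall>m<l. contraction n k m f = 0)"
  by (auto simp: traceless_def contraction_def fun_eq_iff)

text \<open>Tracelessness is the vanishing of all contractions, and these are equivariant.
  Contractions lower the number of factors, so k = 0 stands apart.\<close>

lemma stable_sl_tensor: "stable n k (sl_tensor n k)"
proof (cases k)
  case 0
  then have "sl_tensor n k = tens n k" by (auto simp: sl_tensor_traceless traceless_def)
  then show ?thesis by (simp add: stable_tens)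
next
  case (Suc k')
  have "gl_act n k X f \<in> sl_tensor n k" if f: "f \<in> sl_tensor n k" for X f
    unfolding sl_tensor_traceless Suc traceless_Suc_iff
  proof (intro conjI allI impI)
    show "gl_act n (Suc k') X f \<in> tens n (Suc k')" by (rule gl_act_tens)
    fix m assume m: "m < Suc k'"
    then have "contraction n k' m f = 0"
      using f unfolding sl_tensor_traceless Suc traceless_Suc_iff by blast
    then have "gl_act n k' X (contraction n k' m f) = 0" by (simp only: gl_act_zero)
    then show "contraction n k' m (gl_act n (Suc k') X f) = 0"
      using m by (simp only: gl_act_contraction less_Suc_eq_le)
  qed
  then show ?thesis
    using subspace_traceless[of n k k] sl_tensor_subset_tens
    by (auto simp: stable_def sl_tensor_traceless[symmetric])
qed

lemma gl_submodule_iff: "gl_submodule n k W \<longleftrightarrow> W \<subseteq> sl_tensor n k \<and> stable n k W"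
  using sl_tensor_subset_tens[of n k] by (auto simp: gl_submodule_def stable_def is_csubspace_iff)

lemma irreducible_submodule_iff:
  "irreducible_submodule n k W \<longleftrightarrow> gl_submodule n k W \<and> W \<noteq> {0} \<and>
     (\<forall>U. gl_submodule n k U \<and> U \<subseteq> W \<longrightarrow> U = {0} \<or> U = W)"
  by (simp add: irreducible_submodule_def zero_fun_def)

lemma has_highest_weight_iff:
  assumes "W \<subseteq> tens n k"
  shows "has_highest_weight n k W w \<longleftrightarrow> (\<exists>v\<in>W. v \<noteq> 0 \<and> v \<in> hw n k w)"
  using assms unfolding has_highest_weight_def hw_def scal_def zero_fun_def by blast

lemma is_irred_decomposition_iff:
  "is_irred_decomposition n k m W \<longleftrightarrow> (\<forall>i<m. irreducible_submodule n k (W i)) \<and>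
     (\<forall>v\<in>sl_tensor n k. \<exists>!u. (\<forall>i<m. u i \<in> W i) \<and> (\<forall>i\<ge>m. u i = 0) \<and> v = (\<Sum>i<m. u i))"
proof -
  have "(\<lambda>s. \<Sum>i<m. u i s) = (\<Sum>i<m. u i)" for u :: "nat \<Rightarrow> tvec"
    by (rule ext) (simp add: sum_fun_apply)
  then show ?thesis by (simp add: is_irred_decomposition_def zero_fun_def)
qed

text \<open>The orbit of \<open>v\<close> under the enveloping algebra of the strictly lower
  triangular matrices, defined by closure so that statements about it follow by rule
  induction.\<close>

inductive_set lower_span :: "nat \<Rightarrow> nat \<Rightarrow> tvec \<Rightarrow> tvec set" for n k v where
  base: "v \<in> lower_span n k v"
| lower: "u \<in> lower_span n k v \<Longrightarrow> b < a \<Longrightarrow> a < n \<Longrightarrow> gl_act n k (elem_mat a b) u \<in> lower_span n k v"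
| add: "u \<in> lower_span n k v \<Longrightarrow> u' \<in> lower_span n k v \<Longrightarrow> u + u' \<in> lower_span n k v"
| scal: "u \<in> lower_span n k v \<Longrightarrow> scal c u \<in> lower_span n k v"

lemma scal_0: "scal 0 f = 0"
  by (auto simp: scal_def)

lemma subspace_lower_span: "fs.subspace (lower_span n k v)"
proof -
  have "scal 0 v \<in> lower_span n k v" by (intro lower_span.scal lower_span.base)
  then have "0 \<in> lower_span n k v" by (simp only: scal_0)
  then show ?thesis by (auto simp: fs.subspace_def intro: lower_span.intros)
qed

text \<open>An upper triangular unit is commuted past the outermost lowering operator. The
  correction terms are matrix units applied to the earlier vector, which are covered by the
  induction hypothesis or by closure under lowering. Hence \<open>v\<close> generates a submodule by
  lowering alone.\<close>

lemma lower_span_raise: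
  assumes v: "v \<in> hw n k w"
  shows "u \<in> lower_span n k v \<Longrightarrow> a \<le> b \<Longrightarrow> b < n \<Longrightarrow> gl_act n k (elem_mat a b) u \<in> lower_span n k v"
proof (induction arbitrary: a b rule: lower_span.induct)
  case base
  show ?case
  proof (cases "a = b")
    case True
    then have "gl_act n k (elem_mat a b) v = scal (of_int (w a)) v" using v base by (simp add: hw_def)
    then show ?thesis by (simp only: lower_span.base lower_span.scal)
  next
    case False
    then have "gl_act n k (elem_mat a b) v = 0" using v base by (simp add: hw_def)
    then show ?thesis using fs.subspace_0[OF subspace_lower_span] by (simp only:)
  qed
next
  case (lower u b' a')
  have all: "gl_act n k (elem_mat x y) u \<in> lower_span n k v" if "x < n" "y < n" for x y
    using lower.IH[of x y] lower_span.lower[OF lower.hyps(1), of y x] that by (cases "x \<le> y") auto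
  have z: "0 \<in> lower_span n k v" by (rule fs.subspace_0[OF subspace_lower_span])
  have "gl_act n k (elem_mat a' b') (gl_act n k (elem_mat a b) u) \<in> lower_span n k v"
    using lower.prems lower.hyps by (intro lower_span.lower all) auto
  moreover have "(if b = a' then gl_act n k (elem_mat a b') u else 0) \<in> lower_span n k v"
    using lower.prems lower.hyps z by (auto intro: all)
  moreover have "(if b' = a then gl_act n k (elem_mat a' b) u else 0) \<in> lower_span n k v"
    using lower.prems lower.hyps z by (auto intro: all)
  moreover have "b' < n" using lower.hyps by simp
  ultimately show ?case
    unfolding gl_act_elem_commute[OF lower.prems(2) \<open>b' < n\<close>]
    by (intro lower_span.add fs.subspace_diff[OF subspace_lower_span])
next
  case (add u u')
  then show ?case unfolding gl_act_add by (intro lower_span.add) auto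
next
  case (scal u c)
  then show ?case unfolding gl_act_scal by (intro lower_span.scal) auto
qed

lemma stable_lower_span:
  assumes v: "v \<in> hw n k w"
  shows "stable n k (lower_span n k v)"
  unfolding stable_def
proof (intro conjI allI ballI)
  show "fs.subspace (lower_span n k v)" by (rule subspace_lower_span)
  show "lower_span n k v \<subseteq> tens n k"
  proof
    fix u assume "u \<in> lower_span n k v"
    then show "u \<in> tens n k"
    proof induction
      case base
      then show ?case using v hw_subset_tens by blast
    next
      case (lower u b a)
      show ?case by (rule gl_act_tens)
    next
      case (add u u')
      show ?case using add.IH by (rule fs.subspace_add[OF subspace_tens])
    next
      case (scal u c)
      show ?case using scal.IH by (rule fs.subspace_scale[OF subspace_tens])
    qed
  qed
  fix X u assume u: "u \<in> lower_span n k v"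
  have all: "gl_act n k (elem_mat x y) u \<in> lower_span n k v" if "x < n" "y < n" for x y
    using lower_span_raise[OF v u, of x y] lower_span.lower[OF u, of y x] that by (cases "x \<le> y") auto
  show "gl_act n k X u \<in> lower_span n k v"
    unfolding gl_act_elem_expand[of n k X]
    by (rule fs.subspace_sum[OF subspace_lower_span]) (auto intro!: lower_span.scal all)
qed

text \<open>The part of \<open>v'\<close> orthogonal to \<open>v\<close> is still a highest weight
  vector. Moving lowering operators to the other side of the form turns them into raising operators
  that annihilate it, so it is orthogonal to all that \<open>v\<close> generates, which is
  \<open>W\<close> by irreducibility, and so to itself.\<close>

lemma irreducible_hw_unique:
  assumes W: "irreducible_submodule n k W" and v: "v \<in> W" "v \<noteq> 0" "v \<in> hw n k w"
    and v': "v' \<in> W" "v' \<in> hw n k w"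
  shows "\<exists>c. v' = scal c v"
proof -
  have subW: "gl_submodule n k W" and irr: "\<And>U. gl_submodule n k U \<Longrightarrow> U \<subseteq> W \<Longrightarrow> U = {0} \<or> U = W"
    using W by (auto simp: irreducible_submodule_iff)
  have stW: "stable n k W" and slW: "W \<subseteq> sl_tensor n k" using subW by (auto simp: gl_submodule_iff)
  have spW: "fs.subspace W" using stW by (simp add: stable_def)
  let ?G = "lower_span n k v"
  define c where "c = inner n k v v' / inner n k v v"
  define u where "u = v' - scal c v"
  have uW: "u \<in> W" unfolding u_def using v v' spW by (intro fs.subspace_diff fs.subspace_scale)
  have uh: "u \<in> hw n k w" unfolding u_def using v v' subspace_hw by (intro fs.subspace_diff fs.subspace_scale)
  have "inner n k v v \<noteq> 0" using inner_eq_0[of n k v] v hw_subset_tens by blast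
  then have vu: "inner n k v u = 0"
    unfolding u_def inner_diff_right inner_scal_right by (simp add: c_def)
  have orth: "inner n k g u = 0" if "g \<in> ?G" for g
    using that
  proof induction
    case base
    show ?case by (rule vu)
  next
    case (lower g b a)
    have "adjoint_mat (elem_mat b a) = elem_mat a b"
      by (auto simp: adjoint_mat_def elem_mat_def fun_eq_iff)
    then have "inner n k (gl_act n k (elem_mat a b) g) u = inner n k g (gl_act n k (elem_mat b a) u)"
      using inner_gl_act[of n k g "elem_mat b a" u] by simp
    moreover have "gl_act n k (elem_mat b a) u = 0" using uh lower.hyps by (simp add: hw_def)
    ultimately show ?case by (simp only: inner_zero_right)
  next
    case (add g g')
    then show ?case by (simp only: inner_add_left add_0_left)
  next
    case (scal g c)
    then show ?case by (simp only: inner_scal_left mult_zero_right)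
  qed
  have GW: "?G \<subseteq> W"
  proof
    fix g assume "g \<in> ?G"
    then show "g \<in> W"
    proof induction
      case base
      show ?case by (rule v)
    next
      case (lower u b a)
      then show ?case using stW by (simp add: stable_def)
    next
      case (add u u')
      show ?case using add.IH by (rule fs.subspace_add[OF spW])
    next
      case (scal u c)
      show ?case using scal.IH by (rule fs.subspace_scale[OF spW])
    qed
  qed
  have "gl_submodule n k ?G" using GW slW stable_lower_span[OF v(3)] by (auto simp: gl_submodule_iff)
  moreover have "?G \<noteq> {0}" using lower_span.base[of v n k] v(2) by blast
  ultimately have "?G = W" using irr GW by blast
  then have "inner n k u u = 0" using orth uW by simp
  then have "u = 0" using inner_eq_0 uh hw_subset_tens by blast
  then show ?thesis unfolding u_def by (metis eq_iff_diff_eq_0)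
qed

section \<open>Counting components through highest weight vectors\<close>

lemma decomposition_independent:
  assumes dec: "is_irred_decomposition n k m W" and u: "\<And>i. i < m \<Longrightarrow> u i \<in> W i"
    and z: "(\<Sum>i<m. u i) = 0" and i: "i < m"
  shows "u i = 0"
proof -
  have ex1: "\<exists>!u. (\<forall>i<m. u i \<in> W i) \<and> (\<forall>i\<ge>m. u i = 0) \<and> 0 = (\<Sum>i<m. u i)"
  proof -
    have "\<forall>v\<in>sl_tensor n k. \<exists>!u. (\<forall>i<m. u i \<in> W i) \<and> (\<forall>i\<ge>m. u i = 0) \<and> v = (\<Sum>i<m. u i)"
      using dec unfolding is_irred_decomposition_iff by (rule conjunct2)
    moreover have "0 \<in> sl_tensor n k"
      using stable_sl_tensor[of n k] by (intro fs.subspace_0) (simp add: stable_def)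
    ultimately show ?thesis by (rule bspec)
  qed
  have W0: "0 \<in> W i" if "i < m" for i
    using dec that fs.subspace_0 by (auto simp: is_irred_decomposition_iff irreducible_submodule_iff gl_submodule_iff stable_def)
  \<comment> \<open>The families compared by uniqueness of the decomposition of zero must vanish
    from index m on, hence the cut-off.\<close>
  let ?u = "\<lambda>i. if i < m then u i else 0" and ?z = "\<lambda>i::nat. 0 :: tvec"
  have "(\<Sum>i<m. ?u i) = (\<Sum>i<m. u i)" by (rule sum.cong) auto
  then have A: "(\<forall>i<m. ?u i \<in> W i) \<and> (\<forall>i\<ge>m. ?u i = 0) \<and> 0 = (\<Sum>i<m. ?u i)" using u z by simp
  have B: "(\<forall>i<m. ?z i \<in> W i) \<and> (\<forall>i\<ge>m. ?z i = 0) \<and> 0 = (\<Sum>i<m. ?z i)"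
    using W0 by simp
  have "?u = ?z"
  proof (rule Uniq_D)
    show "\<exists>\<^sub>\<le>\<^sub>1 u. (\<forall>i<m. u i \<in> W i) \<and> (\<forall>i\<ge>m. u i = 0) \<and> 0 = (\<Sum>i<m. u i)"
      using ex1 unfolding ex1_iff_ex_Uniq by (rule conjunct2)
  qed (rule A, rule B)
  then have "?u i = ?z i" by (rule fun_cong)
  then show ?thesis using i by (simp only: if_True)
qed

text \<open>One highest weight vector from each component of weight \<open>w\<close> gives a basis
  of the whole space of such vectors: independent because the sum is direct, spanning because each
  component has at most one up to scalars.\<close>

lemma card_highest_weight_components:
  assumes dec: "is_irred_decomposition n k m W"
  shows "card {i. i < m \<and> has_highest_weight n k (W i) w} = fs.dim (hw n k w \<inter> sl_tensor n k)"
proof -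
  define I where "I = {i. i < m \<and> has_highest_weight n k (W i) w}"
  have irr: "irreducible_submodule n k (W i)" if "i < m" for i
    using dec that by (simp add: is_irred_decomposition_iff)
  have sl: "W i \<subseteq> sl_tensor n k" and st: "stable n k (W i)" if "i < m" for i
    using irr[OF that] by (auto simp: irreducible_submodule_iff gl_submodule_iff)
  have sp: "fs.subspace (W i)" if "i < m" for i using st[OF that] by (simp add: stable_def)
  have tens: "W i \<subseteq> tens n k" if "i < m" for i using st[OF that] by (simp add: stable_def)
  have hwI: "i \<in> I \<longleftrightarrow> i < m \<and> (\<exists>v\<in>W i. v \<noteq> 0 \<and> v \<in> hw n k w)" for i
    using has_highest_weight_iff[OF tens] by (auto simp: I_def)
  then have "\<forall>i. \<exists>v. i \<in> I \<longrightarrow> v \<in> W i \<and> v \<noteq> 0 \<and> v \<in> hw n k w" by blast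
  then obtain h where h: "\<And>i. i \<in> I \<Longrightarrow> h i \<in> W i \<and> h i \<noteq> 0 \<and> h i \<in> hw n k w" by metis
  have finI: "finite I" and Im: "\<And>i. i \<in> I \<Longrightarrow> i < m" by (auto simp: I_def)
  have ind: "c i = 0" if c: "(\<Sum>i\<in>I. scal (c i) (h i)) = 0" and i: "i \<in> I" for c i
  proof -
    let ?u = "\<lambda>i. if i \<in> I then scal (c i) (h i) else 0"
    have "(\<Sum>i<m. ?u i) = (\<Sum>i\<in>I. scal (c i) (h i))"
      by (rule sum.mono_neutral_cong_right) (auto simp: Im)
    then have "(\<Sum>i<m. ?u i) = 0" using c by simp
    moreover have "?u i \<in> W i" if "i < m" for i
      using h sp[OF that] by (auto intro: fs.subspace_scale fs.subspace_0)
    ultimately have "?u i = 0" using decomposition_independent[OF dec, of ?u] Im[OF i] by blast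
    then have "scal (c i) (h i) = 0" using i by simp
    then show ?thesis using h[OF i] fs.scale_eq_0_iff by blast
  qed
  have inj: "inj_on h I"
  proof (rule inj_onI)
    fix i j assume ij: "i \<in> I" "j \<in> I" "h i = h j"
    show "i = j"
    proof (rule ccontr)
      assume "i \<noteq> j"
      \<comment> \<open>A coincidence of two chosen vectors is itself a nontrivial relation,
        excluded by \<open>ind\<close>.\<close>
      let ?c = "\<lambda>x. if x = i then 1 else if x = j then -1 else 0 :: complex"
      have "(\<Sum>x\<in>I. scal (?c x) (h x)) = (\<Sum>x\<in>{i, j}. scal (?c x) (h x))"
        by (rule sum.mono_neutral_right) (use ij finI in \<open>auto simp: scal_0\<close>)
      also have "\<dots> = 0" using ij \<open>i \<noteq> j\<close> by (simp add: scal_def fun_eq_iff)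
      finally show False using ind[of ?c i] ij by simp
    qed
  qed
  have "fs.independent (h ` I)"
  proof (rule fs.independent_if_scalars_zero)
    show "finite (h ` I)" using finI by simp
    fix f x assume s: "(\<Sum>x\<in>h ` I. scal (f x) x) = 0" and x: "x \<in> h ` I"
    have "(\<Sum>i\<in>I. scal (f (h i)) (h i)) = 0" using s inj by (simp add: sum.reindex)
    then show "f x = 0" using ind[of "\<lambda>i. f (h i)"] x by auto
  qed
  moreover have "fs.span (h ` I) = hw n k w \<inter> sl_tensor n k"
  proof (rule subset_antisym)
    have "fs.subspace (sl_tensor n k)" using stable_sl_tensor[of n k] by (simp add: stable_def)
    then have "fs.subspace (hw n k w \<inter> sl_tensor n k)" using subspace_hw by (intro fs.subspace_inter)
    moreover have "h ` I \<subseteq> hw n k w \<inter> sl_tensor n k" using h sl Im by blast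
    ultimately show "fs.span (h ` I) \<subseteq> hw n k w \<inter> sl_tensor n k" by (rule fs.span_minimal[rotated])
    show "hw n k w \<inter> sl_tensor n k \<subseteq> fs.span (h ` I)"
    proof
      fix f assume f: "f \<in> hw n k w \<inter> sl_tensor n k"
      then obtain u where u: "\<And>i. i < m \<Longrightarrow> u i \<in> W i" "f = (\<Sum>i<m. u i)"
        using dec unfolding is_irred_decomposition_iff by blast
      \<comment> \<open>The components are stable, so an equation satisfied by the sum is satisfied
        by every summand; likewise for the diagonal operators.\<close>
      have raise: "gl_act n k (elem_mat a b) (u i) = 0" if ab: "a < b" "b < n" and i: "i < m" for a b i
      proof (rule decomposition_independent[OF dec _ _ i, where u = "\<lambda>i. gl_act n k (elem_mat a b) (u i)"])
        show "gl_act n k (elem_mat a b) (u i) \<in> W i" if "i < m" for i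
          using st[OF that] u(1)[OF that] by (simp add: stable_def)
        show "(\<Sum>i<m. gl_act n k (elem_mat a b) (u i)) = 0"
          using f ab unfolding gl_act_sum[symmetric] u(2)[symmetric] by (simp add: hw_def)
      qed
      have diag: "gl_act n k (elem_mat a a) (u i) = scal (of_int (w a)) (u i)" if a: "a < n" and i: "i < m" for a i
      proof -
        have "gl_act n k (elem_mat a a) (u i) - scal (of_int (w a)) (u i) = 0"
        proof (rule decomposition_independent[OF dec _ _ i, where u = "\<lambda>i. gl_act n k (elem_mat a a) (u i) - scal (of_int (w a)) (u i)"])
          show "gl_act n k (elem_mat a a) (u i) - scal (of_int (w a)) (u i) \<in> W i" if "i < m" for i
            using st[OF that] u(1)[OF that] sp[OF that]
            by (intro fs.subspace_diff fs.subspace_scale) (auto simp: stable_def)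
          have "(\<Sum>i<m. gl_act n k (elem_mat a a) (u i) - scal (of_int (w a)) (u i)) =
            gl_act n k (elem_mat a a) f - scal (of_int (w a)) f"
            unfolding u(2) by (simp only: sum_subtractf gl_act_sum fs.scale_sum_right)
          then show "(\<Sum>i<m. gl_act n k (elem_mat a a) (u i) - scal (of_int (w a)) (u i)) = 0"
            using f a by (simp add: hw_def)
        qed
        then show ?thesis by (simp only: right_minus_eq)
      qed
      have "u i \<in> fs.span (h ` I)" if i: "i < m" for i
      proof (cases "u i = 0")
        case True
        then show ?thesis by (simp only: fs.span_zero)
      next
        case False
        have hwu: "u i \<in> hw n k w" using raise diag i tens[OF i] u(1)[OF i] by (auto simp: hw_def)
        then have iI: "i \<in> I" using False u(1)[OF i] i hwI by blast
        obtain c where "u i = scal c (h i)"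
          using irreducible_hw_unique[OF irr[OF i], of "h i" w "u i"] h[OF iI] u(1)[OF i] hwu by blast
        then show ?thesis using iI by (auto intro: fs.span_scale fs.span_base)
      qed
      then show "f \<in> fs.span (h ` I)" unfolding u(2) by (intro fs.span_sum) simp
    qed
  qed
  ultimately have "fs.dim (hw n k w \<inter> sl_tensor n k) = card (h ` I)" by (rule dim_eqI)
  then show ?thesis using inj by (simp add: card_image I_def)
qed

text \<open>Complete reducibility by induction on the dimension: split off an irreducible submodule
  and continue with its orthogonal complement, which is stable and strictly smaller.\<close>

lemma submodule_decomposition:
  "gl_submodule n k S \<Longrightarrow> \<exists>(m :: nat) W. (\<forall>i<m. irreducible_submodule n k (W i) \<and> W i \<subseteq> S) \<and>
     (\<forall>v\<in>S. \<exists>!u. (\<forall>i<m. u i \<in> W i) \<and> (\<forall>i\<ge>m. u i = 0) \<and> v = (\<Sum>i<m. u i))"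
proof (induction "fs.dim S" arbitrary: S rule: less_induct)
  case less
  have S: "S \<subseteq> sl_tensor n k" "stable n k S" using less.prems by (auto simp: gl_submodule_iff)
  then have spS: "fs.subspace S" and tS: "S \<subseteq> tens n k" by (auto simp: stable_def)
  show ?case
  proof (cases "S = {0}")
    case True
    show ?thesis
    proof (rule exI[of _ "0 :: nat"], rule exI[of _ "\<lambda>_ :: nat. {} :: tvec set"], intro conjI ballI)
      fix v assume "v \<in> S"
      then have v: "v = 0" using True by simp
      show "\<exists>!u. (\<forall>i<0::nat. u i \<in> {}) \<and> (\<forall>i\<ge>0. u i = 0) \<and> v = (\<Sum>i<0. u i)"
        by (rule ex1I[of _ "\<lambda>_. 0"]) (auto simp: v)
    qed auto
  next
    case False
    define P where "P = (\<lambda>U. gl_submodule n k U \<and> U \<subseteq> S \<and> U \<noteq> {0})"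
    have "P S" using False less.prems by (simp add: P_def)
    \<comment> \<open>A nonzero submodule of least dimension is irreducible, since a proper nonzero
      submodule of it would have smaller dimension.\<close>
    then obtain U where U: "P U" and min: "\<And>U'. P U' \<Longrightarrow> fs.dim U \<le> fs.dim U'"
      using ex_has_least_nat[of P S fs.dim] by blast
    have Usub: "gl_submodule n k U" "U \<subseteq> S" "U \<noteq> {0}" using U by (auto simp: P_def)
    then have stU: "stable n k U" and spU: "fs.subspace U" by (auto simp: gl_submodule_iff stable_def)
    have irr: "irreducible_submodule n k U"
      unfolding irreducible_submodule_iff
    proof (intro conjI allI impI)
      fix U' assume U': "gl_submodule n k U' \<and> U' \<subseteq> U"
      show "U' = {0} \<or> U' = U"
      proof (rule ccontr)
        assume neg: "\<not> ?thesis"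
        then have "P U'" using U' Usub by (auto simp: P_def)
        moreover have "fs.dim U' < fs.dim U"
        proof (rule psubset_dim_less[of U U' n k])
          show "fs.subspace U'" using U' by (simp add: gl_submodule_iff stable_def)
        qed (use spU U' neg Usub tS in auto)
        ultimately show False using min by (metis not_le)
      qed
    qed (use Usub in auto)
    let ?C = "ortho n k U S"
    have stC: "stable n k ?C" using stU S(2) by (rule stable_ortho)
    have CS: "?C \<subseteq> S" by (auto simp: ortho_def)
    have subC: "gl_submodule n k ?C" using stC CS S by (auto simp: gl_submodule_iff)
    have spC: "fs.subspace ?C" using stC by (simp add: stable_def)
    have UC: "f = 0" if "f \<in> U" "f \<in> ?C" for f using ortho_Int[OF that tS] .
    have "?C \<noteq> S"
    proof
      assume "?C = S"
      then have "U \<subseteq> {0}" using UC Usub by blast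
      then show False using Usub(3) fs.subspace_0[OF spU] by blast
    qed
    then have "fs.dim ?C < fs.dim S"
      using CS by (intro psubset_dim_less[of S ?C n k] spS spC tS) auto
    from less.hyps[OF this subC] obtain m :: nat and W where
      mW: "(\<forall>i<m. irreducible_submodule n k (W i) \<and> W i \<subseteq> ?C) \<and>
        (\<forall>v\<in>?C. \<exists>!u. (\<forall>i<m. u i \<in> W i) \<and> (\<forall>i\<ge>m. u i = 0) \<and> v = (\<Sum>i<m. u i))"
      by (elim exE) (rule that, assumption)
    have W: "irreducible_submodule n k (W i) \<and> W i \<subseteq> ?C" if "i < m" for i
      using conjunct1[OF mW] that by blast
    note dec = bspec[OF conjunct2[OF mW]]
    define W' where "W' = W(m := U)"
    have dec': "\<exists>!u. (\<forall>i<Suc m. u i \<in> W' i) \<and> (\<forall>i\<ge>Suc m. u i = 0) \<and> v = (\<Sum>i<Suc m. u i)" if v: "v \<in> S" for v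
    proof -
      obtain x where x: "x \<in> U" "v - x \<in> ?C" using ortho_decompose[OF stU S(2) Usub(2) v] by blast
      from dec[OF x(2)] obtain u where
        u: "(\<forall>i<m. u i \<in> W i) \<and> (\<forall>i\<ge>m. u i = 0) \<and> v - x = (\<Sum>i<m. u i)"
        and uniq: "\<forall>u'. (\<forall>i<m. u' i \<in> W i) \<and> (\<forall>i\<ge>m. u' i = 0) \<and> v - x = (\<Sum>i<m. u' i) \<longrightarrow> u' = u"
        by (elim ex1E) (rule that, assumption, assumption)
      have sum_u: "(\<Sum>i<m. u i) = v - x" using u by simp
      show ?thesis
      proof (rule ex1I[of _ "u(m := x)"])
        have "(\<Sum>i<m. (u(m := x)) i) = (\<Sum>i<m. u i)" by (rule sum.cong) auto
        then have "(\<Sum>i<Suc m. (u(m := x)) i) = v"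
          by (simp only: sum.lessThan_Suc sum_u fun_upd_same diff_add_cancel)
        then show "(\<forall>i<Suc m. (u(m := x)) i \<in> W' i) \<and> (\<forall>i\<ge>Suc m. (u(m := x)) i = 0) \<and> v = (\<Sum>i<Suc m. (u(m := x)) i)"
        proof (intro conjI)
          show "\<forall>i<Suc m. (u(m := x)) i \<in> W' i" using u x(1) by (auto simp: W'_def less_Suc_eq)
          show "\<forall>i\<ge>Suc m. (u(m := x)) i = 0" using u by auto
        qed (rule sym)
      next
        fix u' assume u': "(\<forall>i<Suc m. u' i \<in> W' i) \<and> (\<forall>i\<ge>Suc m. u' i = 0) \<and> v = (\<Sum>i<Suc m. u' i)"
        have inW: "u' i \<in> W i" if "i < m" for i using u' that by (auto simp: W'_def dest: spec[of _ i])
        have inU: "u' m \<in> U" using u' by (auto simp: W'_def)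
        define y where "y = (\<Sum>i<m. u' i)"
        have "y \<in> ?C" unfolding y_def using inW W spC by (intro fs.subspace_sum) auto
        have v': "v = y + u' m" using u' by (simp only: y_def sum.lessThan_Suc)
        \<comment> \<open>The left side lies in \<open>U\<close> and the right side in its
          complement, so both vanish. This fixes the last entry, and uniqueness for the complement
          fixes the others.\<close>
        have "u' m - x = (v - x) - y" unfolding v' by simp
        moreover have "u' m - x \<in> U" using inU x spU by (intro fs.subspace_diff)
        moreover have "(v - x) - y \<in> ?C" by (rule fs.subspace_diff[OF spC x(2) \<open>y \<in> ?C\<close>])
        ultimately have "u' m - x = 0" using UC by metis
        then have xm: "u' m = x" by (simp only: right_minus_eq)
        have "(\<Sum>i<m. (u'(m := 0)) i) = y" unfolding y_def by (rule sum.cong) auto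
        moreover have "v - x = y" unfolding v' xm by simp
        ultimately have "u'(m := 0) = u" using uniq[rule_format, of "u'(m := 0)"] inW u' by auto
        then show "u' = u(m := x)" using xm by auto
      qed
    qed
    have "\<forall>i<Suc m. irreducible_submodule n k (W' i) \<and> W' i \<subseteq> S"
      using W irr Usub CS by (auto simp: W'_def less_Suc_eq)
    then show ?thesis
      by (intro exI[of _ "Suc m"] exI[of _ W'] conjI ballI dec')
  qed
qed

lemma irred_decomposition_exists: "\<exists>m W. is_irred_decomposition n k m W"
proof -
  have "gl_submodule n k (sl_tensor n k)" using stable_sl_tensor by (simp add: gl_submodule_iff)
  from submodule_decomposition[OF this] show ?thesis unfolding is_irred_decomposition_iff by blast
qed

text \<open>The length condition makes the two nonzero ranges of the weight disjoint, so the case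
  distinction agrees with the difference of the padded shapes.\<close>

lemma lm_weight_pair_weight:
  assumes "length la + length mu \<le> n"
  shows "lm_weight n la mu = pair_weight n (shape la) (shape mu)"
  using assms by (auto simp: fun_eq_iff lm_weight_def pair_weight_def shape_def)

theorem theorem2p2:
  fixes n k r :: nat and la mu :: "nat list"
  assumes "2 * k \<le> n" and "r \<le> k"
    and "is_partition r la" and "is_partition r mu"
  shows "(\<exists>m W. is_irred_decomposition n k m W) \<and>
    (\<forall>m W. is_irred_decomposition n k m W \<longrightarrow>
       int (card {i. i < m \<and> has_highest_weight n k (W i) (lm_weight n la mu)}) =
       int (num_syt la * num_syt mu) *
       (\<Sum>j=0..k-r. (-1)^j * int (k choose j) * int ((k-j) choose r)^2 * int (fact (k-r-j))))"
proof -
  \<comment> \<open>Each partition of r has at most r rows, and 2r \<le> 2k \<le> n.\<close>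
  have "length la + length mu \<le> n"
    using length_partition[OF assms(3)] length_partition[OF assms(4)] assms(1,2) by simp
  then have w: "lm_weight n la mu = pair_weight n (shape la) (shape mu)" by (rule lm_weight_pair_weight)
  show ?thesis
  proof (intro conjI allI impI)
    show "\<exists>m W. is_irred_decomposition n k m W" by (rule irred_decomposition_exists)
    fix m W assume "is_irred_decomposition n k m W"
    then show "int (card {i. i < m \<and> has_highest_weight n k (W i) (lm_weight n la mu)}) =
       int (num_syt la * num_syt mu) *
       (\<Sum>j=0..k-r. (-1)^j * int (k choose j) * int ((k-j) choose r)^2 * int (fact (k-r-j)))"
      unfolding w num_syt_eq_npaths[OF assms(3)] num_syt_eq_npaths[OF assms(4)]
      by (simp only: card_highest_weight_components
          dim_hw_sl[OF assms(1,2) shape_parts[OF assms(3)] shape_parts[OF assms(4)]])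
  qed
qed

end
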